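(* Let $G=(V,E,w)$ be a directed graph with $n$ vertices, $m$ edges and polynomially bounded edge weights $w_e>0$. Fix a global minimum cut $(S,\overline{S})$ of $G$. There is a deterministic algorithm that, given $G$ and an $s$-arborescence $T$ of $G$ rooted at a vertex $s\in S$ such that exactly one edge of $T$ goes from $S$ to $\overline{S}$ (the algorithm is not given $S$), outputs a global minimum cut of $G$ in time $O((MF(m,n)+m)\log n)$.
   Context: For $U\subseteq V$, $\overline{U}=V\setminus U$ and the cut $(U,\overline{U})$ has weight equal to the total weight of edges from $U$ to $\overline{U}$; a global minimum cut is such a cut with $\emptyset\ne U\subsetneq V$ of minimum weight. An $s$-arborescence is a directed spanning tree rooted at $s$ with all edges directed away from $s$. $MF(m,n)$ denotes the running time of an algorithm computing an $s$-$t$ maximum flow in a directed graph with $n$ vertices and $m$ edges; the algorithm may call such a maximum flow subroutine. *)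

theory Defs
  imports Complex_Main "Graph_Theory.Digraph_Component"
begin

section \<open>Cuts and arborescences\<close>

definition cut_weight :: "('a, 'b) pre_digraph \<Rightarrow> ('b \<Rightarrow> nat) \<Rightarrow> 'a set \<Rightarrow> nat" where
  "cut_weight G w U = (\<Sum>e | e \<in> arcs G \<and> tail G e \<in> U \<and> head G e \<in> verts G - U. w e)"

definition global_min_cut :: "('a, 'b) pre_digraph \<Rightarrow> ('b \<Rightarrow> nat) \<Rightarrow> 'a set \<Rightarrow> bool" where
  "global_min_cut G w S \<longleftrightarrow> S \<noteq> {} \<and> S \<subset> verts G \<and>
     (\<forall>U. U \<noteq> {} \<and> U \<subset> verts G \<longrightarrow> cut_weight G w S \<le> cut_weight G w U)"

text \<open>
  The library predicate \<^const>\<open>spanning_tree\<close> only excludes directed cycles and is therefore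
  meaningful for symmetric digraphs only. Here an arborescence is a digraph in which every vertex
  is reached from the root by exactly one directed walk. Walks may repeat vertices, so uniqueness
  also rules out arcs into the root and directed cycles.
\<close>

definition arborescence :: "('a, 'b) pre_digraph \<Rightarrow> 'a \<Rightarrow> bool" where
  "arborescence T s \<longleftrightarrow> wf_digraph T \<and> s \<in> verts T \<and>
     (\<forall>v \<in> verts T. \<exists>!p. pre_digraph.awalk T s p v)"

definition spanning_arborescence ::
    "('a, 'b) pre_digraph \<Rightarrow> ('a, 'b) pre_digraph \<Rightarrow> 'a \<Rightarrow> bool" where
  "spanning_arborescence T G s \<longleftrightarrow> spanning T G \<and> arborescence T s"


section \<open>Maximum flows\<close>

definition is_flow ::
    "('a, 'b) pre_digraph \<Rightarrow> ('b \<Rightarrow> real) \<Rightarrow> 'a \<Rightarrow> 'a \<Rightarrow> ('b \<Rightarrow> real) \<Rightarrow> bool" where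
  "is_flow G c s t f \<longleftrightarrow> (\<forall>e \<in> arcs G. 0 \<le> f e \<and> f e \<le> c e) \<and>
     (\<forall>v \<in> verts G - {s, t}. (\<Sum>e \<in> in_arcs G v. f e) = (\<Sum>e \<in> out_arcs G v. f e))"

definition flow_value :: "('a, 'b) pre_digraph \<Rightarrow> 'a \<Rightarrow> ('b \<Rightarrow> real) \<Rightarrow> real" where
  "flow_value G s f = (\<Sum>e \<in> out_arcs G s. f e) - (\<Sum>e \<in> in_arcs G s. f e)"

definition is_max_flow ::
    "('a, 'b) pre_digraph \<Rightarrow> ('b \<Rightarrow> real) \<Rightarrow> 'a \<Rightarrow> 'a \<Rightarrow> ('b \<Rightarrow> real) \<Rightarrow> bool" where
  "is_max_flow G c s t f \<longleftrightarrow> is_flow G c s t f \<and>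
     (\<forall>g. is_flow G c s t g \<longrightarrow> flow_value G s g \<le> flow_value G s f)"

text \<open>
  An instance for the maximum flow subroutine: the vertices are \<open>0, \<dots>, net_verts - 1\<close>, and
  the arc number \<open>i\<close> is given by the entry \<open>(tail, head, capacity)\<close> at position \<open>i\<close> of the list.
\<close>

record network =
  net_verts :: nat
  net_arcs :: "(nat \<times> nat \<times> nat) list"
  net_source :: nat
  net_sink :: nat

definition net_graph :: "network \<Rightarrow> (nat, nat) pre_digraph" where
  "net_graph N = \<lparr> verts = {..<net_verts N}, arcs = {..<length (net_arcs N)},
     tail = (\<lambda>i. fst (net_arcs N ! i)), head = (\<lambda>i. fst (snd (net_arcs N ! i))) \<rparr>"

definition net_cap :: "network \<Rightarrow> nat \<Rightarrow> nat" where
  "net_cap N i = snd (snd (net_arcs N ! i))"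

definition poly_network :: "nat \<Rightarrow> network \<Rightarrow> bool" where
  "poly_network k N \<longleftrightarrow> digraph (net_graph N) \<and>
     net_source N < net_verts N \<and> net_sink N < net_verts N \<and> net_source N \<noteq> net_sink N \<and>
     (\<forall>i < length (net_arcs N). 0 < net_cap N i \<and> net_cap N i \<le> net_verts N ^ k)"

text \<open>
  A deterministic maximum flow subroutine for digraphs with positive integer capacities bounded by
  the \<open>k\<close>-th power of the number of vertices. On the instance \<open>N\<close> it returns the integral flow
  \<open>mf N\<close> (indexed by arc numbers) after \<open>tm N\<close> steps. \<open>MF m n\<close> bounds its worst-case running time
  over the instances with at most \<open>m\<close> arcs and at most \<open>n\<close> vertices.
\<close>

definition maxflow_subroutine ::
    "nat \<Rightarrow> (network \<Rightarrow> nat \<Rightarrow> nat) \<Rightarrow> (network \<Rightarrow> nat) \<Rightarrow> (nat \<Rightarrow> nat \<Rightarrow> nat) \<Rightarrow> bool" where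
  "maxflow_subroutine k mf tm MF \<longleftrightarrow>
     (\<forall>N. poly_network k N \<longrightarrow>
        is_max_flow (net_graph N) (\<lambda>i. real (net_cap N i)) (net_source N) (net_sink N)
          (\<lambda>i. real (mf N i)) \<and>
        (\<forall>m n. length (net_arcs N) \<le> m \<and> net_verts N \<le> n \<longrightarrow> tm N \<le> MF m n))"


section \<open>A word RAM with a maximum flow instruction\<close>

text \<open>
  Programs work on finitely many scalar variables and arrays of natural numbers. Addition,
  truncated subtraction and comparison are the only arithmetic operations. Each command and each
  evaluation of a test takes one step; as the expressions occurring in a fixed program have bounded
  size, this counts RAM operations up to a constant factor. For the same reason it suffices to bound
  the stored values: intermediate results are larger by at most a constant factor.
\<close>

datatype aexp =
    Num nat
  | Var string
  | Get string aexp
  | Plus aexp aexp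
  | Minus aexp aexp

datatype bexp =
    Less aexp aexp
  | Not bexp
  | And bexp bexp

datatype com =
    Skip
  | Assign string aexp
  | Put string aexp aexp
  | Seq com com
  | If bexp com com
  | While bexp com
  | Max_Flow aexp aexp aexp aexp string string string string

record state =
  vars :: "string \<Rightarrow> nat"
  arrs :: "string \<Rightarrow> nat \<Rightarrow> nat"

primrec aval :: "aexp \<Rightarrow> state \<Rightarrow> nat" where
  "aval (Num a) \<sigma> = a"
| "aval (Var x) \<sigma> = vars \<sigma> x"
| "aval (Get a e) \<sigma> = arrs \<sigma> a (aval e \<sigma>)"
| "aval (Plus e1 e2) \<sigma> = aval e1 \<sigma> + aval e2 \<sigma>"
| "aval (Minus e1 e2) \<sigma> = aval e1 \<sigma> - aval e2 \<sigma>"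

primrec bval :: "bexp \<Rightarrow> state \<Rightarrow> bool" where
  "bval (Less e1 e2) \<sigma> \<longleftrightarrow> aval e1 \<sigma> < aval e2 \<sigma>"
| "bval (Not b) \<sigma> \<longleftrightarrow> \<not> bval b \<sigma>"
| "bval (And b1 b2) \<sigma> \<longleftrightarrow> bval b1 \<sigma> \<and> bval b2 \<sigma>"

text \<open>
  The arguments of \<^const>\<open>Max_Flow\<close> are the numbers of vertices and arcs, the source, the sink, the
  arrays holding tails, heads and capacities, and the array that receives the flow.
\<close>

definition read_network ::
    "aexp \<Rightarrow> aexp \<Rightarrow> aexp \<Rightarrow> aexp \<Rightarrow> string \<Rightarrow> string \<Rightarrow> string \<Rightarrow> state \<Rightarrow> network" where
  "read_network en em es et ta ha ca \<sigma> =
     \<lparr> net_verts = aval en \<sigma>,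
       net_arcs = map (\<lambda>i. (arrs \<sigma> ta i, arrs \<sigma> ha i, arrs \<sigma> ca i)) [0..<aval em \<sigma>],
       net_source = aval es \<sigma>,
       net_sink = aval et \<sigma> \<rparr>"

definition write_flow :: "string \<Rightarrow> nat \<Rightarrow> (nat \<Rightarrow> nat) \<Rightarrow> state \<Rightarrow> state" where
  "write_flow fa m f \<sigma> =
     \<sigma>\<lparr> arrs := (arrs \<sigma>)(fa := (\<lambda>i. if i < m then f i else arrs \<sigma> fa i)) \<rparr>"

text \<open>
  \<open>exec B k mf tm c \<sigma> t \<sigma>'\<close>: started in \<open>\<sigma>\<close>, the program \<open>c\<close> terminates in \<open>\<sigma>'\<close> after \<open>t\<close> steps.
  Every stored value and every address written to is at most \<open>B\<close>; a program violating this, or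
  calling the subroutine on an illegal instance, has no execution. Besides the running time of the
  subroutine, a call is charged for passing the network and receiving the flow.
\<close>

inductive exec ::
    "nat \<Rightarrow> nat \<Rightarrow> (network \<Rightarrow> nat \<Rightarrow> nat) \<Rightarrow> (network \<Rightarrow> nat) \<Rightarrow>
     com \<Rightarrow> state \<Rightarrow> nat \<Rightarrow> state \<Rightarrow> bool"
  for B k :: nat and mf :: "network \<Rightarrow> nat \<Rightarrow> nat" and tm :: "network \<Rightarrow> nat" where
  Skip: "exec B k mf tm Skip \<sigma> 1 \<sigma>"
| Assign: "aval e \<sigma> \<le> B \<Longrightarrow>
    exec B k mf tm (Assign x e) \<sigma> 1 (\<sigma>\<lparr> vars := (vars \<sigma>)(x := aval e \<sigma>) \<rparr>)"
| Put: "aval i \<sigma> \<le> B \<Longrightarrow> aval e \<sigma> \<le> B \<Longrightarrow>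
    exec B k mf tm (Put a i e) \<sigma> 1
      (\<sigma>\<lparr> arrs := (arrs \<sigma>)(a := (arrs \<sigma> a)(aval i \<sigma> := aval e \<sigma>)) \<rparr>)"
| Seq: "exec B k mf tm c1 \<sigma> t1 \<sigma>1 \<Longrightarrow> exec B k mf tm c2 \<sigma>1 t2 \<sigma>2 \<Longrightarrow>
    exec B k mf tm (Seq c1 c2) \<sigma> (t1 + t2) \<sigma>2"
| If_True: "bval b \<sigma> \<Longrightarrow> exec B k mf tm c1 \<sigma> t \<sigma>1 \<Longrightarrow>
    exec B k mf tm (If b c1 c2) \<sigma> (1 + t) \<sigma>1"
| If_False: "\<not> bval b \<sigma> \<Longrightarrow> exec B k mf tm c2 \<sigma> t \<sigma>1 \<Longrightarrow>
    exec B k mf tm (If b c1 c2) \<sigma> (1 + t) \<sigma>1"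
| While_False: "\<not> bval b \<sigma> \<Longrightarrow> exec B k mf tm (While b c) \<sigma> 1 \<sigma>"
| While_True: "bval b \<sigma> \<Longrightarrow> exec B k mf tm c \<sigma> t1 \<sigma>1 \<Longrightarrow>
    exec B k mf tm (While b c) \<sigma>1 t2 \<sigma>2 \<Longrightarrow>
    exec B k mf tm (While b c) \<sigma> (1 + t1 + t2) \<sigma>2"
| Max_Flow: "N = read_network en em es et ta ha ca \<sigma> \<Longrightarrow> poly_network k N \<Longrightarrow>
    (\<forall>i < aval em \<sigma>. i \<le> B \<and> mf N i \<le> B) \<Longrightarrow>
    exec B k mf tm (Max_Flow en em es et ta ha ca fa) \<sigma>
      (1 + net_verts N + length (net_arcs N) + tm N)
      (write_flow fa (aval em \<sigma>) (mf N) \<sigma>)"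

inductive_cases exec_SkipE: "exec B k mf tm Skip \<sigma> t \<sigma>'"
inductive_cases exec_AssignE: "exec B k mf tm (Assign x e) \<sigma> t \<sigma>'"
inductive_cases exec_PutE: "exec B k mf tm (Put a i e) \<sigma> t \<sigma>'"
inductive_cases exec_SeqE: "exec B k mf tm (Seq c1 c2) \<sigma> t \<sigma>'"
inductive_cases exec_IfE: "exec B k mf tm (If b c1 c2) \<sigma> t \<sigma>'"
inductive_cases exec_WhileE: "exec B k mf tm (While b c) \<sigma> t \<sigma>'"
inductive_cases exec_Max_FlowE: "exec B k mf tm (Max_Flow en em es et ta ha ca fa) \<sigma> t \<sigma>'"

lemma exec_deterministic:
  assumes "exec B k mf tm c \<sigma> t \<sigma>'" and "exec B k mf tm c \<sigma> u \<sigma>''"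
  shows "t = u \<and> \<sigma>' = \<sigma>''"
  using assms
proof (induction arbitrary: u \<sigma>'' rule: exec.induct)
  case (Skip \<sigma>)
  then show ?case by (rule exec_SkipE) simp
next
  case (Assign e \<sigma> x)
  from Assign.prems show ?case by (rule exec_AssignE) simp
next
  case (Put i \<sigma> e a)
  from Put.prems show ?case by (rule exec_PutE) simp
next
  case (Seq c1 \<sigma> t1 \<sigma>1 c2 t2 \<sigma>2)
  from Seq.prems show ?case
  proof (rule exec_SeqE)
    fix u1 \<rho> u2
    assume "u = u1 + u2" "exec B k mf tm c1 \<sigma> u1 \<rho>" "exec B k mf tm c2 \<rho> u2 \<sigma>''"
    then show ?thesis using Seq.IH(1)[of u1 \<rho>] Seq.IH(2)[of u2 \<sigma>''] by auto
  qed
next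
  case (If_True b \<sigma> c1 t \<sigma>1 c2)
  from If_True.prems show ?case
    by (rule exec_IfE) (use If_True.hyps(1) in \<open>auto dest: If_True.IH\<close>)
next
  case (If_False b \<sigma> c2 t \<sigma>1 c1)
  from If_False.prems show ?case
    by (rule exec_IfE) (use If_False.hyps(1) in \<open>auto dest: If_False.IH\<close>)
next
  case (While_False b \<sigma> c)
  from While_False.prems show ?case
    by (rule exec_WhileE) (use While_False.hyps(1) in \<open>simp_all\<close>)
next
  case (While_True b \<sigma> c t1 \<sigma>1 t2 \<sigma>2)
  from While_True.prems show ?case
  proof (rule exec_WhileE)
    fix u1 \<rho> u2
    assume "u = Suc (u1 + u2)" "exec B k mf tm c \<sigma> u1 \<rho>"
      "exec B k mf tm (While b c) \<rho> u2 \<sigma>''"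
    then show ?thesis using While_True.IH(1)[of u1 \<rho>] While_True.IH(2)[of u2 \<sigma>''] by auto
  qed (use While_True.hyps(1) in simp_all)
next
  case (Max_Flow N en em es et ta ha ca \<sigma> fa)
  from Max_Flow.prems show ?case by (rule exec_Max_FlowE) (use Max_Flow.hyps(1) in simp)
qed


section \<open>Input and output\<close>

text \<open>
  A digraph is presented with vertices \<open>0, \<dots>, n - 1\<close> and arcs \<open>0, \<dots>, m - 1\<close>; the arborescence is
  marked in an array over the arcs. All other memory is initially zero.
\<close>

definition input_state ::
    "(nat, nat) pre_digraph \<Rightarrow> (nat \<Rightarrow> nat) \<Rightarrow> (nat, nat) pre_digraph \<Rightarrow> nat \<Rightarrow> state" where
  "input_state G w T s =
     \<lparr> vars = (\<lambda>_. 0)(''n'' := card (verts G), ''m'' := card (arcs G), ''s'' := s),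
       arrs = (\<lambda>_ _. 0)(
         ''tail'' := (\<lambda>e. if e \<in> arcs G then tail G e else 0),
         ''head'' := (\<lambda>e. if e \<in> arcs G then head G e else 0),
         ''weight'' := (\<lambda>e. if e \<in> arcs G then w e else 0),
         ''tree'' := (\<lambda>e. if e \<in> arcs T then 1 else 0)) \<rparr>"

definition output_set :: "nat \<Rightarrow> state \<Rightarrow> nat set" where
  "output_set n \<sigma> = {v. v < n \<and> arrs \<sigma> ''cut'' v = 1}"

end

theory Submission
  imports Defs
begin

text \<open>
  Let \<open>X\<close> be the sink side of the minimum cut. Only one arc of the arborescence enters \<open>X\<close>, so \<open>X\<close> is a
  connected piece of the tree that does not contain the root \<open>s\<close>. Remove \<open>s\<close> and then, in rounds,
  a centroid from each remaining component; after \<open>O(log n)\<close> rounds nothing is left. In the first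
  round that removes a vertex \<open>c\<close> of \<open>X\<close>, the set \<open>X\<close> lies in the component \<open>K\<close> of \<open>c\<close>. So if all
  vertices outside \<open>K\<close> are contracted to \<open>s\<close>, then \<open>X\<close> is the sink side of an \<open>s\<close>-\<open>c\<close> cut, and
  a minimum \<open>s\<close>-\<open>c\<close> cut is a global minimum cut.

  An arc matters only for the component that contains its head. Hence the contracted graphs of all components
  of a round share no arc, and gluing them at \<open>s\<close> and identifying all centroids gives one network with at
  most \<open>n\<close> vertices and \<open>m\<close> arcs. A minimum cut of this network restricts to a minimum cut for each
  component, so one maximum flow per round suffices. The cut is read off as the set reachable
  from \<open>s\<close> in the residual graph.
\<close>

text \<open>The hypothesis bounds only the tree arcs that enter \<open>X\<close>; many may leave it.
  So the sink side is connected in the tree but \<open>S\<close> need not be, and the bookkeeping is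
  done with sink sides and entering arcs. The subroutine accepts only loopfree digraphs without
  parallel arcs and with positive capacities. So contraction drops the arcs that would enter
  \<open>s\<close>, leave the glued sink or run straight from \<open>s\<close> to it, and merges
  arcs that become parallel. Dropped arcs of the last kind cross every cut and shift all values by
  one constant; the others never enter a sink side. The algorithm cannot tell in which round
  \<open>X\<close> is hit. Every candidate is therefore evaluated with its true weight in the given
  graph. No candidate can then be lighter than a minimum cut, and one that is at most as heavy as
  \<open>X\<close> suffices. There is no multiplication or division. A centroid is found by
  comparing a doubled subtree size: it is the last vertex, in an order with parents first, whose
  subtree holds more than half of its component.\<close>

notation Seq (infixr \<open>;;\<close> 60)

section \<open>Weakest preconditions with step counts\<close>

definition For :: "string \<Rightarrow> aexp \<Rightarrow> com \<Rightarrow> com" where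
  "For x h c = Seq (Assign x (Num 0))
     (While (Less (Var x) h) (Seq c (Assign x (Plus (Var x) (Num 1)))))"

locale ram =
  fixes B k :: nat
    and mf :: "network \<Rightarrow> nat \<Rightarrow> nat"
    and tm :: "network \<Rightarrow> nat"
begin

text \<open>Existence of an execution already includes termination, legal subroutine calls and the
  memory bound. As executions are deterministic, nothing is lost by not quantifying over all of
  them. The postcondition also receives the step count.\<close>

definition wp :: "com \<Rightarrow> (nat \<Rightarrow> state \<Rightarrow> bool) \<Rightarrow> state \<Rightarrow> bool" where
  "wp c Q \<sigma> \<longleftrightarrow> (\<exists>u \<sigma>'. exec B k mf tm c \<sigma> u \<sigma>' \<and> Q u \<sigma>')"

lemma wp_Skip: "wp Skip Q \<sigma> \<longleftrightarrow> Q 1 \<sigma>"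
  unfolding wp_def by (auto intro: exec.Skip[simplified] elim: exec_SkipE)

lemma wp_Assign:
  "aval e \<sigma> \<le> B \<Longrightarrow> wp (Assign x e) Q \<sigma> \<longleftrightarrow> Q 1 (\<sigma>\<lparr>vars := (vars \<sigma>)(x := aval e \<sigma>)\<rparr>)"
  unfolding wp_def by (auto intro: exec.Assign[simplified] elim: exec_AssignE)

lemma wp_Put:
  "aval i \<sigma> \<le> B \<Longrightarrow> aval e \<sigma> \<le> B \<Longrightarrow>
    wp (Put a i e) Q \<sigma> \<longleftrightarrow>
      Q 1 (\<sigma>\<lparr>arrs := (arrs \<sigma>)(a := (arrs \<sigma> a)(aval i \<sigma> := aval e \<sigma>))\<rparr>)"
  unfolding wp_def by (auto intro: exec.Put[simplified] elim: exec_PutE)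

lemma wp_Seq: "wp (Seq c1 c2) Q \<sigma> \<longleftrightarrow> wp c1 (\<lambda>u. wp c2 (\<lambda>v. Q (u + v))) \<sigma>"
proof
  assume "wp (Seq c1 c2) Q \<sigma>"
  then obtain u \<sigma>' where "exec B k mf tm (Seq c1 c2) \<sigma> u \<sigma>'" "Q u \<sigma>'"
    unfolding wp_def by blast
  then show "wp c1 (\<lambda>u. wp c2 (\<lambda>v. Q (u + v))) \<sigma>"
    unfolding wp_def by (auto elim!: exec_SeqE)
qed (auto simp: wp_def intro: exec.Seq)

lemma wp_If:
  "wp (If b c1 c2) Q \<sigma> \<longleftrightarrow>
     (if bval b \<sigma> then wp c1 (\<lambda>u. Q (1 + u)) \<sigma> else wp c2 (\<lambda>u. Q (1 + u)) \<sigma>)"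
  unfolding wp_def
  by (auto elim!: exec_IfE intro: exec.If_True[simplified] exec.If_False[simplified])

lemmas wp_simps = wp_Skip wp_Assign wp_Put wp_Seq wp_If

lemma wp_mono: "wp c Q \<sigma> \<Longrightarrow> (\<And>u \<sigma>'. Q u \<sigma>' \<Longrightarrow> R u \<sigma>') \<Longrightarrow> wp c R \<sigma>"
  unfolding wp_def by blast

lemma wp_SeqI:
  assumes "wp c1 Q \<sigma>" and "\<And>u \<sigma>'. Q u \<sigma>' \<Longrightarrow> wp c2 (\<lambda>v. R (u + v)) \<sigma>'"
  shows "wp (Seq c1 c2) R \<sigma>"
  unfolding wp_Seq using assms by (rule wp_mono)

text \<open>The variant is the first argument of the invariant and may drop by any positive amount.
  Each round pays \<open>a\<close> for the body and one for the test; the last summand is the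
  failing test.\<close>

lemma wp_While:
  assumes "I i \<sigma>"
    and "\<And>i \<sigma>. I i \<sigma> \<Longrightarrow> bval b \<sigma> \<Longrightarrow> wp c (\<lambda>u \<sigma>'. u \<le> a \<and> (\<exists>j<i. I j \<sigma>')) \<sigma>"
  shows "wp (While b c) (\<lambda>u \<sigma>'. u \<le> (a + 1) * i + 1 \<and> (\<exists>j. I j \<sigma>') \<and> \<not> bval b \<sigma>') \<sigma>"
  using assms(1)
proof (induction i arbitrary: \<sigma> rule: less_induct)
  case (less i)
  show ?case
  proof (cases "bval b \<sigma>")
    case False
    then show ?thesis
      using less.prems unfolding wp_def by (auto intro!: exI exec.While_False)
  next
    case True
    from assms(2)[OF less.prems True] obtain u \<sigma>' j
      where 1: "exec B k mf tm c \<sigma> u \<sigma>'" "u \<le> a" "j < i" "I j \<sigma>'"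
      unfolding wp_def by blast
    from less.IH[OF 1(3,4)] obtain v \<sigma>''
      where 2: "exec B k mf tm (While b c) \<sigma>' v \<sigma>''" "v \<le> (a + 1) * j + 1"
        "\<exists>j. I j \<sigma>''" "\<not> bval b \<sigma>''"
      unfolding wp_def by blast
    have "(a + 1) * (j + 1) \<le> (a + 1) * i"
      using 1(3) by (intro mult_le_mono2) simp
    then have "1 + u + v \<le> (a + 1) * i + 1"
      using 1(2) 2(2) by (simp add: algebra_simps)
    then show ?thesis
      using exec.While_True[OF True 1(1) 2(1)] 2(3,4) unfolding wp_def by blast
  qed
qed

text \<open>The body establishes the invariant for the state with the counter already advanced, so
  the increment is handled once here. Test and increment add two steps per iteration, initialisation
  and failing test two in total. The bound \<open>h\<close> is evaluated afresh each time, hence the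
  demand that the invariant fix its value.\<close>

lemma wp_For:
  assumes init: "I 0 (\<sigma>\<lparr>vars := (vars \<sigma>)(x := 0)\<rparr>)"
    and hi: "\<And>j \<sigma>. I j \<sigma> \<Longrightarrow> aval h \<sigma> = N" and N: "N \<le> B"
    and body: "\<And>j \<sigma>. I j \<sigma> \<Longrightarrow> j < N \<Longrightarrow> vars \<sigma> x = j \<Longrightarrow>
      wp c (\<lambda>u \<sigma>'. u \<le> a \<and> vars \<sigma>' x = j \<and> I (Suc j) (\<sigma>'\<lparr>vars := (vars \<sigma>')(x := Suc j)\<rparr>)) \<sigma>"
  shows "wp (For x h c) (\<lambda>u \<sigma>'. u \<le> (a + 2) * N + 2 \<and> I N \<sigma>') \<sigma>"
proof -
  define J where "J i \<sigma> \<longleftrightarrow> i \<le> N \<and> vars \<sigma> x = N - i \<and> I (N - i) \<sigma>" for i \<sigma>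
  let ?c = "Seq c (Assign x (Plus (Var x) (Num 1)))"
  have "wp (While (Less (Var x) h) ?c)
      (\<lambda>u \<sigma>'. u \<le> (a + 1 + 1) * N + 1 \<and> (\<exists>j. J j \<sigma>') \<and> \<not> bval (Less (Var x) h) \<sigma>')
      (\<sigma>\<lparr>vars := (vars \<sigma>)(x := 0)\<rparr>)"
  proof (rule wp_While)
    show "J N (\<sigma>\<lparr>vars := (vars \<sigma>)(x := 0)\<rparr>)"
      using init by (simp add: J_def)
  next
    fix i \<sigma> assume J: "J i \<sigma>" and b: "bval (Less (Var x) h) \<sigma>"
    from J b hi have i: "0 < i" "N - i < N" "Suc (N - i) = N - (i - 1)"
      by (auto simp: J_def)
    show "wp ?c (\<lambda>u \<sigma>'. u \<le> a + 1 \<and> (\<exists>j<i. J j \<sigma>')) \<sigma>"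
    proof (rule wp_SeqI[OF body])
      show "I (N - i) \<sigma>" "N - i < N" "vars \<sigma> x = N - i"
        using J i by (auto simp: J_def)
    next
      fix u \<sigma>'
      assume *: "u \<le> a \<and> vars \<sigma>' x = N - i \<and>
        I (Suc (N - i)) (\<sigma>'\<lparr>vars := (vars \<sigma>')(x := Suc (N - i))\<rparr>)"
      then have "J (i - 1) (\<sigma>'\<lparr>vars := (vars \<sigma>')(x := Suc (N - i))\<rparr>)"
        using J i by (simp add: J_def)
      then show "wp (Assign x (Plus (Var x) (Num 1))) (\<lambda>v \<sigma>'. u + v \<le> a + 1 \<and> (\<exists>j<i. J j \<sigma>')) \<sigma>'"
        using * i N by (subst wp_Assign) (auto intro!: exI[of _ "i - 1"])
    qed
  qed
  then have "wp (For x h c) (\<lambda>u \<sigma>'. u \<le> (a + 1 + 1) * N + 2 \<and> (\<exists>j. J j \<sigma>') \<and> \<not> vars \<sigma>' x < aval h \<sigma>') \<sigma>"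
    unfolding For_def wp_Seq by (subst wp_Assign) simp_all
  then show ?thesis
  proof (rule wp_mono)
    fix u \<sigma>'
    assume *: "u \<le> (a + 1 + 1) * N + 2 \<and> (\<exists>j. J j \<sigma>') \<and> \<not> vars \<sigma>' x < aval h \<sigma>'"
    then obtain j where j: "J j \<sigma>'" by blast
    then have "aval h \<sigma>' = N" using hi by (auto simp: J_def)
    with j * have "N - j = N" by (auto simp: J_def)
    with j * show "u \<le> (a + 2) * N + 2 \<and> I N \<sigma>'" by (simp add: J_def)
  qed
qed

end

section \<open>Frame conditions for variables and arrays\<close>

definition eq_off :: "'a set \<Rightarrow> ('a \<Rightarrow> 'b) \<Rightarrow> ('a \<Rightarrow> 'b) \<Rightarrow> bool" where
  "eq_off X f g \<longleftrightarrow> (\<forall>x. x \<notin> X \<longrightarrow> g x = f x)"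

text \<open>A frame condition: between the two states only variables in \<open>X\<close> and arrays
  in \<open>Y\<close> may have changed. With explicit string sets, membership is decided by
  simplification.\<close>

definition agree :: "string set \<Rightarrow> string set \<Rightarrow> state \<Rightarrow> state \<Rightarrow> bool" where
  "agree X Y \<sigma> \<sigma>' \<longleftrightarrow> eq_off X (vars \<sigma>) (vars \<sigma>') \<and> eq_off Y (arrs \<sigma>) (arrs \<sigma>')"

lemma eq_off_refl: "eq_off X f f"
  by (simp add: eq_off_def)

lemma eq_off_upd: "x \<in> X \<Longrightarrow> eq_off X f (g(x := a)) = eq_off X f g"
  by (auto simp: eq_off_def)

lemmas agree_simps = agree_def eq_off_refl eq_off_upd

lemma agree_trans:
  "agree X Y \<sigma> \<sigma>' \<Longrightarrow> agree X' Y' \<sigma>' \<sigma>'' \<Longrightarrow> X \<union> X' \<subseteq> X'' \<Longrightarrow> Y \<union> Y' \<subseteq> Y'' \<Longrightarrow> agree X'' Y'' \<sigma> \<sigma>''"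
  unfolding agree_def eq_off_def by (metis UnCI subsetD)

lemma agree_vars: "agree X Y \<sigma> \<sigma>' \<Longrightarrow> x \<notin> X \<Longrightarrow> vars \<sigma>' x = vars \<sigma> x"
  by (simp add: agree_def eq_off_def)

lemma agree_arrs: "agree X Y \<sigma> \<sigma>' \<Longrightarrow> a \<notin> Y \<Longrightarrow> arrs \<sigma>' a = arrs \<sigma> a"
  by (simp add: agree_def eq_off_def)

section \<open>Maximum flows and residual reachability\<close>

text \<open>Net outflow. It is linear in \<open>h\<close>, and conservation as well as the flow
  value are statements about it.\<close>

definition excess :: "('a, 'b) pre_digraph \<Rightarrow> ('b \<Rightarrow> real) \<Rightarrow> 'a \<Rightarrow> real" where
  "excess D h v = (\<Sum>e \<in> out_arcs D v. h e) - (\<Sum>e \<in> in_arcs D v. h e)"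

definition residual :: "('a, 'b) pre_digraph \<Rightarrow> ('b \<Rightarrow> real) \<Rightarrow> ('b \<Rightarrow> real) \<Rightarrow> ('a \<times> 'a) set" where
  "residual D c f = {(tail D e, head D e) | e. e \<in> arcs D \<and> f e < c e} \<union>
     {(head D e, tail D e) | e. e \<in> arcs D \<and> 0 < f e}"

context fin_digraph
begin

lemma excess_eq:
  "excess G h v = (\<Sum>e \<in> arcs G. h e * (of_bool (tail G e = v) - of_bool (head G e = v)))"
proof -
  have "(\<Sum>e \<in> out_arcs G v. h e) = (\<Sum>e \<in> arcs G. h e * of_bool (tail G e = v))"
    by (rule sum.mono_neutral_cong_left) auto
  moreover have "(\<Sum>e \<in> in_arcs G v. h e) = (\<Sum>e \<in> arcs G. h e * of_bool (head G e = v))"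
    by (rule sum.mono_neutral_cong_left) auto
  ultimately show ?thesis
    by (simp add: excess_def right_diff_distrib sum_subtractf)
qed

text \<open>Arcs with both ends in \<open>U\<close> cancel, so only the arcs crossing the boundary
  of \<open>U\<close> remain.\<close>

lemma sum_excess:
  assumes "finite U"
  shows "(\<Sum>v \<in> U. excess G h v) =
    (\<Sum>e \<in> arcs G. h e * (of_bool (tail G e \<in> U) - of_bool (head G e \<in> U)))"
proof -
  have *: "(\<Sum>v\<in>U. of_bool (x = v)) = (of_bool (x \<in> U) :: real)" for x
    using assms by (simp add: of_bool_def)
  show ?thesis
    unfolding excess_eq by (subst sum.swap) (simp add: sum_distrib_left[symmetric] sum_subtractf *)
qed

lemma excess_flow:
  assumes "is_flow G c s t f" "v \<in> verts G" "v \<noteq> s" "v \<noteq> t"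
  shows "excess G f v = 0"
  using assms by (auto simp: is_flow_def excess_def)

lemma flow_value_cut:
  assumes "is_flow G c s t f" "U \<subseteq> verts G" "s \<in> U" "t \<notin> U"
  shows "flow_value G s f =
    (\<Sum>e \<in> arcs G. f e * (of_bool (tail G e \<in> U) - of_bool (head G e \<in> U)))"
proof -
  have "finite U"
    using assms(2) by (rule finite_subset) simp
  moreover have "(\<Sum>v \<in> U. excess G f v) = excess G f s"
    using assms \<open>finite U\<close>
    by (subst sum.remove[of _ s]) (auto intro!: sum.neutral excess_flow)
  ultimately show ?thesis
    using sum_excess[of U f] by (simp add: flow_value_def excess_def)
qed

text \<open>
  The directions in which the flow can be changed form a convex cone. So the residual arcs of a walk
  can be added up, and it does not matter whether the walk is simple.
\<close>

lemma residual_direction: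
  assumes "(s, x) \<in> (residual G c f)\<^sup>*"
  shows "\<exists>h. (\<forall>e \<in> arcs G. (h e < 0 \<longrightarrow> 0 < f e) \<and> (0 < h e \<longrightarrow> f e < c e)) \<and>
    (\<forall>v. excess G h v = of_bool (v = s) - of_bool (v = x))"
  using assms
proof (induction rule: rtrancl_induct)
  case base
  show ?case
    by (rule exI[of _ "\<lambda>_. 0"]) (simp add: excess_def)
next
  case (step x y)
  then obtain h where h: "\<forall>e \<in> arcs G. (h e < 0 \<longrightarrow> 0 < f e) \<and> (0 < h e \<longrightarrow> f e < c e)"
    "\<And>v. excess G h v = of_bool (v = s) - of_bool (v = x)"
    by blast
  from step(2) obtain e and r :: real where e: "e \<in> arcs G"
    "r = 1 \<and> f e < c e \<and> x = tail G e \<and> y = head G e \<or> r = -1 \<and> 0 < f e \<and> x = head G e \<and> y = tail G e"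
    by (force simp: residual_def)
  define h' where "h' e' = h e' + r * of_bool (e' = e)" for e'
  have "excess G h' v = excess G h v + r * (of_bool (tail G e = v) - of_bool (head G e = v))" for v
  proof -
    have "excess G h' v - excess G h v =
        (\<Sum>e' \<in> arcs G. (if e' = e then r * (of_bool (tail G e = v) - of_bool (head G e = v)) else 0))"
      unfolding excess_eq sum_subtractf[symmetric]
      by (rule sum.cong) (auto simp: h'_def algebra_simps)
    then show ?thesis using e(1) by simp
  qed
  moreover have "\<forall>e' \<in> arcs G. (h' e' < 0 \<longrightarrow> 0 < f e') \<and> (0 < h' e' \<longrightarrow> f e' < c e')"
    using h(1) e by (auto simp: h'_def)
  ultimately show ?case
    using e(2) h(2) by (intro exI[of _ h']) auto
qed

text \<open>Admissible step lengths are closed downwards, so the minimum over finitely many arcs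
  works for all of them.\<close>

lemma uniform_step:
  fixes P :: "'c \<Rightarrow> real \<Rightarrow> bool"
  assumes "finite A" "\<And>e. e \<in> A \<Longrightarrow> \<exists>\<epsilon>>0. \<forall>\<delta>. 0 < \<delta> \<and> \<delta> \<le> \<epsilon> \<longrightarrow> P e \<delta>"
  shows "\<exists>\<epsilon>>0. \<forall>\<delta>. 0 < \<delta> \<and> \<delta> \<le> \<epsilon> \<longrightarrow> (\<forall>e \<in> A. P e \<delta>)"
  using assms
proof (induction A)
  case empty
  show ?case by (auto intro: exI[of _ 1])
next
  case (insert e A)
  from insert.IH insert.prems obtain a where a: "0 < a" "\<And>\<delta>. 0 < \<delta> \<Longrightarrow> \<delta> \<le> a \<Longrightarrow> \<forall>e \<in> A. P e \<delta>"
    by auto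
  from insert.prems obtain b where b: "0 < b" "\<And>\<delta>. 0 < \<delta> \<Longrightarrow> \<delta> \<le> b \<Longrightarrow> P e \<delta>"
    by blast
  show ?case
    using a b by (intro exI[of _ "min a b"]) auto
qed

text \<open>A residual walk to the sink yields a direction \<open>h\<close> with unit excess at
  \<open>s\<close>. Following it for a small positive length keeps all capacity bounds and
  conservation, and raises the value by that length.\<close>

lemma max_flow_sink_unreachable:
  assumes max: "is_max_flow G c s t f" and st: "s \<noteq> t"
  shows "(s, t) \<notin> (residual G c f)\<^sup>*"
proof
  assume "(s, t) \<in> (residual G c f)\<^sup>*"
  then obtain h where h: "\<And>e. e \<in> arcs G \<Longrightarrow> h e < 0 \<Longrightarrow> 0 < f e"
    "\<And>e. e \<in> arcs G \<Longrightarrow> 0 < h e \<Longrightarrow> f e < c e"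
    "\<And>v. excess G h v = of_bool (v = s) - of_bool (v = t)"
    using residual_direction by blast
  have f: "is_flow G c s t f"
    using max by (simp add: is_max_flow_def)
  have "\<exists>\<epsilon>>0. \<forall>\<delta>. 0 < \<delta> \<and> \<delta> \<le> \<epsilon> \<longrightarrow> (\<forall>e \<in> arcs G. 0 \<le> f e + \<delta> * h e \<and> f e + \<delta> * h e \<le> c e)"
  proof (rule uniform_step)
    fix e assume e: "e \<in> arcs G"
    then have c: "0 \<le> f e" "f e \<le> c e"
      using f by (auto simp: is_flow_def)
    show "\<exists>\<epsilon>>0. \<forall>\<delta>. 0 < \<delta> \<and> \<delta> \<le> \<epsilon> \<longrightarrow> 0 \<le> f e + \<delta> * h e \<and> f e + \<delta> * h e \<le> c e"
    proof (cases "h e" "0 :: real" rule: linorder_cases)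
      case less
      \<comment> \<open>The arc is emptied exactly at length \<open>f e / (- h e)\<close>; the other
        case is symmetric with the remaining capacity.\<close>
      have "0 \<le> f e + \<delta> * h e \<and> f e + \<delta> * h e \<le> c e" if \<delta>: "0 < \<delta>" "\<delta> \<le> f e / (- h e)" for \<delta>
      proof -
        have "\<delta> * (- h e) \<le> f e"
          using \<delta>(2) less by (simp only: pos_le_divide_eq neg_0_less_iff_less)
        moreover have "\<delta> * h e \<le> 0" using \<delta>(1) less by (simp add: mult_nonneg_nonpos)
        ultimately show ?thesis using c by simp
      qed
      moreover have "0 < f e / (- h e)" using h(1)[OF e less] less by (intro divide_pos_pos) simp_all
      ultimately show ?thesis by blast
    next
      case greater
      with h(2)[OF e] c show ?thesis
        by (intro exI[of _ "(c e - f e) / h e"]) (auto simp: field_simps)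
    qed (use c in \<open>auto intro: exI[of _ 1]\<close>)
  qed simp
  then obtain \<epsilon> where \<epsilon>: "0 < \<epsilon>" "\<And>e. e \<in> arcs G \<Longrightarrow> 0 \<le> f e + \<epsilon> * h e \<and> f e + \<epsilon> * h e \<le> c e"
    by blast
  have ex: "excess G (\<lambda>e. f e + \<epsilon> * h e) v = excess G f v + \<epsilon> * excess G h v" for v
    by (simp add: excess_def sum.distrib sum_distrib_left algebra_simps)
  have "is_flow G c s t (\<lambda>e. f e + \<epsilon> * h e)"
    unfolding is_flow_def
  proof (intro conjI ballI)
    fix v assume v: "v \<in> verts G - {s, t}"
    then have "excess G (\<lambda>e. f e + \<epsilon> * h e) v = 0"
      using ex h(3) f by (simp add: excess_flow)
    then show "(\<Sum>e \<in> in_arcs G v. f e + \<epsilon> * h e) = (\<Sum>e \<in> out_arcs G v. f e + \<epsilon> * h e)"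
      by (simp add: excess_def)
  qed (use \<epsilon> in auto)
  then have "flow_value G s (\<lambda>e. f e + \<epsilon> * h e) \<le> flow_value G s f"
    using max by (simp add: is_max_flow_def)
  then have "excess G f s + \<epsilon> * excess G h s \<le> excess G f s"
    using ex[of s] by (simp add: flow_value_def excess_def)
  then show False
    using \<epsilon>(1) h(3) st by simp
qed

text \<open>Max-flow min-cut duality: arcs leaving \<open>A\<close> are saturated and arcs entering
  it are empty, otherwise \<open>A\<close> would grow. Hence the capacity of \<open>A\<close> equals
  the flow value, which no other cut can undercut.\<close>

lemma residual_reachable_min_cut:
  assumes max: "is_max_flow G c s t f" and "s \<in> verts G" "s \<noteq> t"
    and A: "A = (residual G c f)\<^sup>* `` {s}" and U: "s \<in> U" "t \<notin> U"
  shows "(\<Sum>e | e \<in> arcs G \<and> tail G e \<in> A \<and> head G e \<notin> A. c e)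
    \<le> (\<Sum>e | e \<in> arcs G \<and> tail G e \<in> U \<and> head G e \<notin> U. c e)"
proof -
  have f: "is_flow G c s t f"
    using max by (simp add: is_max_flow_def)
  then have fc: "\<And>e. e \<in> arcs G \<Longrightarrow> 0 \<le> f e \<and> f e \<le> c e"
    by (simp add: is_flow_def)
  have "(s, x) \<in> (residual G c f)\<^sup>* \<Longrightarrow> x \<in> verts G" for x
    by (induction rule: rtrancl_induct) (use assms(2) in \<open>auto simp: residual_def\<close>)
  then have Av: "A \<subseteq> verts G"
    using A by auto
  have st: "s \<in> A" "t \<notin> A"
    using A max_flow_sink_unreachable[OF max assms(3)] by auto
  have Ac: "y \<in> A" if "x \<in> A" "(x, y) \<in> residual G c f" for x y
    using that A by (auto intro: rtrancl_into_rtrancl)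
  have sat: "f e = c e" if "e \<in> arcs G" "tail G e \<in> A" "head G e \<notin> A" for e
    using that Ac[of "tail G e" "head G e"] fc[of e] by (fastforce simp: residual_def)
  have zero: "f e = 0" if "e \<in> arcs G" "head G e \<in> A" "tail G e \<notin> A" for e
    using that Ac[of "head G e" "tail G e"] fc[of e] by (fastforce simp: residual_def)
  have "(\<Sum>e | e \<in> arcs G \<and> tail G e \<in> A \<and> head G e \<notin> A. c e) =
      (\<Sum>e \<in> arcs G. f e * (of_bool (tail G e \<in> A) - of_bool (head G e \<in> A)))"
    by (rule sum.mono_neutral_cong_left) (use sat zero in \<open>auto simp: of_bool_def\<close>)
  also have "\<dots> = flow_value G s f"
    using flow_value_cut[OF f Av st] by simp
  \<comment> \<open>\<open>U\<close> may contain points that are no vertices; intersecting with the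
    vertex set changes no membership of an arc end.\<close>
  also have "\<dots> = (\<Sum>e \<in> arcs G. f e * (of_bool (tail G e \<in> U \<inter> verts G) - of_bool (head G e \<in> U \<inter> verts G)))"
    by (rule flow_value_cut[OF f]) (use U assms(2) in auto)
  also have "\<dots> \<le> (\<Sum>e \<in> arcs G. if tail G e \<in> U \<and> head G e \<notin> U then c e else 0)"
    by (rule sum_mono) (use fc in \<open>auto simp: of_bool_def\<close>)
  also have "\<dots> = (\<Sum>e | e \<in> arcs G \<and> tail G e \<in> U \<and> head G e \<notin> U. c e)"
    by (simp add: sum.inter_filter)
  finally show ?thesis .
qed

end

section \<open>Centroids of forests\<close>

text \<open>The order will be the queue of a search along the tree arcs. All that matters is that
  parents precede children. Nothing is said about \<open>par s\<close>, so the vertex sets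
  \<open>W\<close> below exclude \<open>s\<close>.\<close>

locale ordered_tree =
  fixes n s :: nat and par ord :: "nat \<Rightarrow> nat"
  assumes ord_inj: "inj_on ord {..<n}" and ord_onto: "ord ` {..<n} = {..<n}"
    and ord_0: "ord 0 = s"
    and par_ord: "0 < j \<Longrightarrow> j < n \<Longrightarrow> \<exists>i<j. par (ord j) = ord i"
begin

definition pos :: "nat \<Rightarrow> nat" where
  "pos = the_inv_into {..<n} ord"

lemma pos_ord [simp]: "j < n \<Longrightarrow> pos (ord j) = j"
  unfolding pos_def using ord_inj by (simp add: the_inv_into_f_f)

lemma ord_less: "j < n \<Longrightarrow> ord j < n"
  using ord_onto by blast

lemma ord_pos: "v < n \<Longrightarrow> ord (pos v) = v" and pos_less: "v < n \<Longrightarrow> pos v < n"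
  using ord_onto by (metis imageE lessThan_iff pos_ord)+

lemma pos_par: "v < n \<Longrightarrow> v \<noteq> s \<Longrightarrow> pos (par v) < pos v"
  and par_less: "v < n \<Longrightarrow> v \<noteq> s \<Longrightarrow> par v < n"
proof -
  assume v: "v < n" "v \<noteq> s"
  then have "0 < pos v" using ord_pos[of v] ord_0 by (cases "pos v") auto
  then obtain i where "i < pos v" "par v = ord i"
    using par_ord[of "pos v"] v(1) by (auto simp: ord_pos pos_less)
  then show "pos (par v) < pos v" "par v < n"
    using pos_less[OF v(1)] by (auto simp: ord_less)
qed

text \<open>The links whose child has position at least \<open>j\<close> are those seen by a
  backward pass that has come down to \<open>j\<close>. So \<open>desc W j v\<close> is the part of
  the subtree of \<open>v\<close> already counted, and \<open>desc W 0 v\<close> is the whole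
  subtree inside \<open>W\<close>.\<close>

definition links :: "nat set \<Rightarrow> nat \<Rightarrow> (nat \<times> nat) set" where
  "links W j = {(par x, x) | x. x \<in> W \<and> par x \<in> W \<and> j \<le> pos x}"

definition desc :: "nat set \<Rightarrow> nat \<Rightarrow> nat \<Rightarrow> nat set" where
  "desc W j v = (links W j)\<^sup>* `` {v}"

lemma desc_self: "v \<in> desc W j v"
  by (simp add: desc_def)

lemma desc_step: "u \<in> desc W 0 v \<Longrightarrow> x \<in> W \<Longrightarrow> par x = u \<Longrightarrow> u \<in> W \<Longrightarrow> x \<in> desc W 0 v"
  unfolding desc_def links_def by (auto intro: rtrancl_into_rtrancl)

lemma desc_subset: "desc W j v \<subseteq> insert v W"
proof -
  have "x = v \<or> x \<in> W" if "(v, x) \<in> (links W j)\<^sup>*" for x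
    using that by (cases rule: rtranclE) (auto simp: links_def)
  then show ?thesis by (auto simp: desc_def)
qed

lemma desc_parent:
  assumes "x \<in> desc W j v" "x \<noteq> v"
  shows "x \<in> W \<and> par x \<in> W \<and> j \<le> pos x \<and> par x \<in> desc W j v"
proof -
  have "(v, x) \<in> (links W j)\<^sup>*" using assms by (simp add: desc_def)
  then show ?thesis
    by (cases rule: rtranclE) (use assms(2) in \<open>auto simp: links_def desc_def\<close>)
qed

lemma desc_trans: "x \<in> desc W j v \<Longrightarrow> desc W j x \<subseteq> desc W j v"
  unfolding desc_def by auto

lemma desc_mono: "W' \<subseteq> W \<Longrightarrow> desc W' j v \<subseteq> desc W j v"
proof -
  assume "W' \<subseteq> W"
  then have "links W' j \<subseteq> links W j" by (auto simp: links_def)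
  then show ?thesis unfolding desc_def using rtrancl_mono by blast
qed

section \<open>Component roots and centroids, computed in tree order\<close>

definition csize :: "nat set \<Rightarrow> nat \<Rightarrow> nat" where
  "csize W v = card (desc W 0 v)"

text \<open>State of a forward pass over the positions below \<open>j\<close>. Call a vertex heavy
  if its subtree has more than half the size of its component. \<open>cen\<close>, indexed by
  component roots, holds the last heavy vertex so far; in the end all children of it are
  light.\<close>

definition roots_upto :: "nat set \<Rightarrow> nat \<Rightarrow> (nat \<Rightarrow> nat) \<Rightarrow> (nat \<Rightarrow> nat) \<Rightarrow> bool" where
  "roots_upto W j rt cen \<longleftrightarrow> (\<forall>v \<in> W. pos v < j \<longrightarrow>
     rt v = (if par v \<in> W then rt (par v) else v) \<and>
     (let c = cen (rt v) in
        c \<in> W \<and> pos c < j \<and> rt c = rt v \<and> csize W (rt v) < 2 * csize W c \<and>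
        (\<forall>u \<in> W. pos u < j \<and> pos c < pos u \<and> rt u = rt v \<longrightarrow> 2 * csize W u \<le> csize W (rt v))))"

definition centers :: "nat set \<Rightarrow> (nat \<Rightarrow> nat) \<Rightarrow> (nat \<Rightarrow> nat) \<Rightarrow> nat set" where
  "centers W rt cen = {v \<in> W. cen (rt v) = v}"

context
  fixes W assumes W: "W \<subseteq> {..<n} - {s}"
begin

lemma finite_desc: "finite (desc W j v)"
  using W by (intro finite_subset[OF desc_subset]) (auto intro: finite_subset[of _ "{..<n}"])

lemma card_desc_pos: "0 < card (desc W j v)"
  using finite_desc desc_self card_gt_0_iff by blast

lemma card_desc_le: "v < n \<Longrightarrow> card (desc W j v) \<le> n"
proof -
  assume "v < n"
  then have "desc W j v \<subseteq> {..<n}" using desc_subset W by blast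
  then show ?thesis using card_mono[of "{..<n}"] by fastforce
qed

lemma desc_n: "desc W n v = {v}"
proof -
  have "links W n = {}" using W pos_less by (fastforce simp: links_def)
  then show ?thesis by (simp add: desc_def)
qed

lemma desc_skip:
  assumes "j < n" "\<not> (ord j \<in> W \<and> par (ord j) \<in> W)"
  shows "desc W j v = desc W (Suc j) v"
proof -
  have "j \<le> pos x \<longleftrightarrow> Suc j \<le> pos x" if "x \<in> W" "par x \<in> W" for x
    using that assms W ord_pos[of x] by (cases "j = pos x") auto
  then have "links W j = links W (Suc j)" by (auto simp: links_def)
  then show ?thesis by (simp add: desc_def)
qed

text \<open>The new link runs from \<open>par x\<close> to \<open>x\<close>. The parent has a
  smaller position, so no link yet enters it, and none yet enters \<open>x\<close>. Hence only the
  set of \<open>par x\<close> grows, by the whole set of \<open>x\<close>.\<close>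

lemma card_desc_step:
  assumes j: "j < n" and x: "x = ord j" "x \<in> W" "par x \<in> W"
  shows "card (desc W j v) = card (desc W (Suc j) v) +
    (if v = par x then card (desc W (Suc j) x) else 0)"
proof -
  have "j \<le> pos y \<longleftrightarrow> y = x \<or> Suc j \<le> pos y" if "y \<in> W" for y
    using that j x(1) W ord_pos[of y] by (cases "j = pos y") auto
  then have links: "links W j = insert (par x, x) (links W (Suc j))"
    using x unfolding links_def by blast
  have px: "pos (par x) < j"
    using pos_par[of x] x W j by auto
  have to_par: "v = par x" if "par x \<in> desc W (Suc j) v" for v
    using desc_parent[OF that] px by auto
  have to_x: "v = x" if "x \<in> desc W (Suc j) v" for v
    using desc_parent[OF that] j x(1) by auto
  have "desc W j v = desc W (Suc j) v \<union> (if v = par x then desc W (Suc j) x else {})"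
  proof -
    have "u \<in> desc W j v \<longleftrightarrow> u \<in> desc W (Suc j) v \<or> par x \<in> desc W (Suc j) v \<and> u \<in> desc W (Suc j) x" for u
      unfolding desc_def links rtrancl_insert by blast
    moreover have "par x \<in> desc W (Suc j) v \<longleftrightarrow> v = par x"
      using to_par desc_self by blast
    ultimately show ?thesis by (simp add: set_eq_iff)
  qed
  \<comment> \<open>Parents are unique, so two vertices with a common descendant are comparable:
    climbing from it meets one of them on the way to the other. Both possibilities were just
    excluded.\<close>
  moreover have "desc W (Suc j) (par x) \<inter> desc W (Suc j) x = {}"
  proof (rule ccontr)
    assume "desc W (Suc j) (par x) \<inter> desc W (Suc j) x \<noteq> {}"
    then obtain u where "(par x, u) \<in> (links W (Suc j))\<^sup>*" "(x, u) \<in> (links W (Suc j))\<^sup>*"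
      by (auto simp: desc_def)
    then have "par x \<in> desc W (Suc j) x \<or> x \<in> desc W (Suc j) (par x)"
    proof (induction arbitrary: rule: rtrancl_induct)
      case base
      then show ?case by (simp add: desc_def)
    next
      case (step y z)
      show ?case
      proof (cases "z = x")
        case True
        then show ?thesis using step.hyps by (auto simp: desc_def intro: rtrancl_into_rtrancl)
      next
        case False
        moreover from step.hyps(2) have "par z = y" by (auto simp: links_def)
        ultimately have "(x, y) \<in> (links W (Suc j))\<^sup>*"
          using desc_parent[of z W "Suc j" x] step.prems by (simp add: desc_def)
        then show ?thesis by (rule step.IH)
      qed
    qed
    moreover have "x \<noteq> par x" using px x(1) j by auto
    ultimately show False using to_par to_x by metis
  qed
  ultimately show ?thesis
    by (auto simp: card_Un_disjoint finite_desc)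
qed

lemma roots_upto_0: "roots_upto W 0 rt cen"
  by (simp add: roots_upto_def)

lemma roots_upto_skip:
  assumes "roots_upto W j rt cen" "j < n" "ord j \<notin> W"
  shows "roots_upto W (Suc j) rt cen"
proof -
  have "pos v < Suc j \<longleftrightarrow> pos v < j" if "v \<in> W" for v
    using that assms W ord_pos[of v] by (cases "j = pos v") auto
  then show ?thesis
    using assms(1) unfolding roots_upto_def Let_def by (metis (no_types, lifting) less_Suc_eq)
qed

lemma roots_upto_in:
  assumes "roots_upto W j rt cen" "v \<in> W" "pos v < j"
  shows "rt v \<in> W"
  using assms(2,3)
proof (induction "pos v" arbitrary: v rule: less_induct)
  case less
  have "rt v = (if par v \<in> W then rt (par v) else v)"
    using assms(1) less.prems by (simp add: roots_upto_def)
  moreover have "pos (par v) < pos v"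
    using less.prems W pos_par by auto
  ultimately show ?case
    using less by (cases "par v \<in> W") auto
qed

text \<open>Either \<open>x\<close> is heavy and takes over as candidate, or the candidate of its
  component stays valid. A root is always heavy for itself, so \<open>cen\<close> is written when a
  component is first met and values left from earlier rounds are never read.\<close>

lemma roots_upto_step:
  assumes R: "roots_upto W j rt cen" and j: "j < n" and x: "x = ord j" "x \<in> W"
    and rt': "rt' = rt(x := if par x \<in> W then rt (par x) else x)"
    and cen': "cen' = (if csize W (rt' x) < 2 * csize W x then cen(rt' x := x) else cen)"
  shows "roots_upto W (Suc j) rt' cen'"
proof -
  have pv: "pos v < j \<or> v = x" if "v \<in> W" "pos v < Suc j" for v
    using that x W ord_pos[of v] by (cases "pos v = j") auto
  have px: "pos x = j" using x j by simp
  have ppar: "pos (par v) < pos v" if "v \<in> W" for v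
    using that W pos_par by auto
  have old: "rt v = (if par v \<in> W then rt (par v) else v)" "cen (rt v) \<in> W"
      "pos (cen (rt v)) < j" "rt (cen (rt v)) = rt v"
      "csize W (rt v) < 2 * csize W (cen (rt v))"
      "\<And>u. u \<in> W \<Longrightarrow> pos u < j \<Longrightarrow> pos (cen (rt v)) < pos u \<Longrightarrow> rt u = rt v \<Longrightarrow>
        2 * csize W u \<le> csize W (rt v)"
    if "v \<in> W" "pos v < j" for v
    using R that by (auto simp: roots_upto_def Let_def)
  have root_eq: "rt' v = rt v" if "pos v < j" for v
    using that px rt' by auto
  have root_x: "rt' x = (if par x \<in> W then rt' (par x) else x)"
    using rt' ppar[OF x(2)] px by auto
  have heavy_x: "csize W x < 2 * csize W x"
    using card_desc_pos by (simp add: csize_def)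
  have root_v: "rt' v = (if par v \<in> W then rt' (par v) else v)" if "v \<in> W" "pos v < Suc j" for v
    using pv[OF that] root_x old(1)[OF that(1)] root_eq[of v] root_eq[of "par v"] ppar[OF that(1)] by auto
  have "let c = cen' (rt' v) in
        c \<in> W \<and> pos c < Suc j \<and> rt' c = rt' v \<and> csize W (rt' v) < 2 * csize W c \<and>
        (\<forall>u \<in> W. pos u < Suc j \<and> pos c < pos u \<and> rt' u = rt' v \<longrightarrow> 2 * csize W u \<le> csize W (rt' v))"
    if v: "v \<in> W" "pos v < Suc j" for v
  proof (cases "rt' v = rt' x \<and> csize W (rt' x) < 2 * csize W x")
    case True
    then have "cen' (rt' v) = x" by (simp add: cen')
    then show ?thesis using True x(2) px by (auto simp: Let_def)
  next
    case False
    then have cen_eq: "cen' (rt' v) = cen (rt' v)" by (simp add: cen')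
    \<comment> \<open>An earlier vertex of the same component supplies the old candidate. If
      \<open>v\<close> is \<open>x\<close> itself, then \<open>x\<close> is light, hence no root,
      and its parent serves.\<close>
    obtain v' where v': "v' \<in> W" "pos v' < j" "rt' v' = rt' v"
    proof (cases "v = x")
      case True
      with False heavy_x root_x have "par x \<in> W" "rt' (par x) = rt' v" by (auto split: if_splits)
      then show ?thesis using that ppar[OF x(2)] px by auto
    next
      case False
      then show ?thesis using that pv[OF v] v(1) by auto
    qed
    let ?c = "cen (rt' v)"
    have r: "rt' v = rt v'" using v' root_eq by simp
    have c: "?c \<in> W" "pos ?c < j" "rt ?c = rt v'" "csize W (rt v') < 2 * csize W ?c"
      using old[OF v'(1,2)] r by auto
    have "2 * csize W u \<le> csize W (rt v')"
      if u: "u \<in> W" "pos u < Suc j" "pos ?c < pos u" "rt' u = rt v'" for u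
    proof (cases "u = x")
      case True
      then show ?thesis using False u(4) r by auto
    next
      case False
      then have "pos u < j" using pv u by blast
      then show ?thesis using old(6)[OF v'(1,2), of u] u r root_eq[of u] by simp
    qed
    then show ?thesis
      using c r cen_eq root_eq[OF c(2)] by (simp add: Let_def)
  qed
  then show ?thesis
    using root_v unfolding roots_upto_def by blast
qed

context
  fixes rt cen assumes R: "roots_upto W n rt cen"
begin

lemma root_eq: "v \<in> W \<Longrightarrow> rt v = (if par v \<in> W then rt (par v) else v)"
  using R W pos_less by (auto simp: roots_upto_def)

lemma cen_facts:
  assumes "v \<in> W"
  shows "cen (rt v) \<in> W" "rt (cen (rt v)) = rt v"
    "csize W (rt v) < 2 * csize W (cen (rt v))"
    "u \<in> W \<Longrightarrow> pos (cen (rt v)) < pos u \<Longrightarrow> rt u = rt v \<Longrightarrow> 2 * csize W u \<le> csize W (rt v)"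
  using R W pos_less assms by (auto simp: roots_upto_def Let_def)

lemma root_facts:
  assumes "v \<in> W"
  shows "rt v \<in> W \<and> par (rt v) \<notin> W \<and> v \<in> desc W 0 (rt v) \<and> rt (rt v) = rt v"
  using assms
proof (induction "pos v" arbitrary: v rule: less_induct)
  case less
  show ?case
  proof (cases "par v \<in> W")
    case True
    then show ?thesis
      using less.hyps[of "par v"] less.prems root_eq[OF less.prems] W pos_par[of v]
        desc_step[of "par v" W "rt v" v] by auto
  next
    case False
    then show ?thesis using less.prems root_eq[OF less.prems] by (simp add: desc_self)
  qed
qed

text \<open>Climbing inside \<open>X\<close> preserves the root and stops at a vertex whose parent
  lies outside \<open>X\<close>; there is only one such vertex.\<close>

lemma connected_same_root:
  assumes X: "X \<subseteq> W" "\<And>u v. u \<in> X \<Longrightarrow> v \<in> X \<Longrightarrow> par u \<notin> X \<Longrightarrow> par v \<notin> X \<Longrightarrow> u = v"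
    and uv: "u \<in> X" "v \<in> X"
  shows "rt u = rt v"
proof -
  have top: "\<exists>z \<in> X. par z \<notin> X \<and> rt v = rt z" if "v \<in> X" for v
    using that
  proof (induction "pos v" arbitrary: v rule: less_induct)
    case less
    show ?case
    proof (cases "par v \<in> X")
      case True
      then have "rt v = rt (par v)" "pos (par v) < pos v"
        using subsetD[OF X(1) True] root_eq[of v] X(1) less.prems W pos_par[of v] by auto
      then show ?thesis using less.hyps[of "par v"] True by auto
    qed (use less.prems in blast)
  qed
  from top[OF uv(1)] top[OF uv(2)] X(2) show ?thesis by metis
qed

lemma cen_in_centers: "v \<in> W \<Longrightarrow> cen (rt v) \<in> centers W rt cen"
  using cen_facts by (simp add: centers_def)

text \<open>
  A component left after removing the centers is rooted at a child of a center or at an old root.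
\<close>

lemma csize_halves:
  assumes r: "r \<in> W - centers W rt cen" "par r \<notin> W - centers W rt cen"
  shows "2 * card (desc (W - centers W rt cen) 0 r) \<le> csize W (rt r)"
proof (cases "par r \<in> W")
  case True
  let ?c = "par r"
  from True r have c: "?c \<in> centers W rt cen" "rt r = rt ?c" using root_eq[of r] by auto
  then have "cen (rt r) = ?c" by (simp add: centers_def)
  \<comment> \<open>A child comes after the center in the order and is therefore light by the choice
    of the center.\<close>
  moreover have "pos ?c < pos r" using r(1) W pos_par by auto
  ultimately have "2 * csize W r \<le> csize W (rt r)"
    using cen_facts(4)[of r r] r(1) by auto
  moreover have "card (desc (W - centers W rt cen) 0 r) \<le> csize W r"
    unfolding csize_def by (intro card_mono finite_desc desc_mono) auto
  ultimately show ?thesis by simp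
next
  case False
  then have rr: "rt r = r" using r root_eq[of r] by auto
  let ?c = "cen (rt r)"
  have c: "?c \<in> centers W rt cen" "?c \<in> W" "csize W r < 2 * csize W ?c" "rt ?c = r"
    using r cen_in_centers[of r] cen_facts[of r] rr by auto
  have cr: "desc W 0 ?c \<subseteq> desc W 0 r"
    using root_facts[OF c(2)] c(4) desc_trans by metis
  \<comment> \<open>A path from \<open>r\<close> could enter the subtree of the center only through
    the center, which is removed. So the remaining piece loses the whole subtree, more than half of
    the component.\<close>
  have "u \<notin> desc W 0 ?c" if "(r, u) \<in> (links (W - centers W rt cen) 0)\<^sup>*" for u
    using that
  proof (induction rule: rtrancl_induct)
    case base
    show ?case using desc_parent[of r W 0 ?c] False c(1) r(1) by (metis DiffD2)
  next
    case (step y z)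
    then have "z \<in> W - centers W rt cen" "par z = y" by (auto simp: links_def)
    then show ?case using step.IH desc_parent[of z W 0 ?c] c(1) by auto
  qed
  then have "desc (W - centers W rt cen) 0 r \<subseteq> desc W 0 r - desc W 0 ?c"
    using desc_mono[of "W - centers W rt cen" W 0 r] unfolding desc_def by auto
  then have "card (desc (W - centers W rt cen) 0 r) \<le> card (desc W 0 r - desc W 0 ?c)"
    by (intro card_mono) (auto simp: finite_desc)
  also have "\<dots> = csize W r - csize W ?c"
    using cr finite_desc by (simp add: card_Diff_subset csize_def)
  finally show ?thesis using c(3) rr by simp
qed

end

end

end

section \<open>The contracted network\<close>

text \<open>The cut is given by its sink side and the graph by its arrays. Source sides are
  translated only at the very end.\<close>

definition cut_into ::
    "(nat \<Rightarrow> nat) \<Rightarrow> (nat \<Rightarrow> nat) \<Rightarrow> (nat \<Rightarrow> nat) \<Rightarrow> nat \<Rightarrow> nat set \<Rightarrow> nat" where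
  "cut_into ta he w m X = (\<Sum>e<m. if he e \<in> X \<and> ta e \<notin> X then w e else 0)"

text \<open>The tree enters only through its components, given as classes of \<open>rt\<close>, and
  through \<open>C\<close>, which picks at most one vertex from each class. The center
  \<open>t\<close> serves as the name of the sink into which all of \<open>C\<close> is
  glued.\<close>

locale contraction =
  fixes ta he w :: "nat \<Rightarrow> nat" and m s t :: nat
    and W C :: "nat set" and rt :: "nat \<Rightarrow> nat"
  assumes s_notin: "s \<notin> W" and C_subset: "C \<subseteq> W"
    and C_unique: "c \<in> C \<Longrightarrow> c' \<in> C \<Longrightarrow> rt c = rt c' \<Longrightarrow> c = c'"
    and t_center: "t \<in> C"
    and no_loop: "e < m \<Longrightarrow> ta e \<noteq> he e"
    and no_multi: "e < m \<Longrightarrow> e' < m \<Longrightarrow> ta e = ta e' \<Longrightarrow> he e = he e' \<Longrightarrow> e = e'"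
    and w_pos: "e < m \<Longrightarrow> 0 < w e"
begin

definition inner :: "nat \<Rightarrow> bool" where
  "inner e \<longleftrightarrow> ta e \<in> W \<and> he e \<in> W \<and> rt (ta e) = rt (he e)"

text \<open>An inner arc out of a center would leave the sink, and an outer arc into a center would
  lead from \<open>s\<close> straight to the sink. Arcs with head outside \<open>W\<close> would end
  in the contracted source.\<close>

definition kept :: "nat \<Rightarrow> bool" where
  "kept e \<longleftrightarrow> he e \<in> W \<and> (if inner e then ta e \<notin> C else he e \<notin> C)"

definition ctail :: "nat \<Rightarrow> nat" where
  "ctail e = (if inner e then ta e else s)"

definition chead :: "nat \<Rightarrow> nat" where
  "chead e = (if he e \<in> C then t else he e)"

text \<open>
  \<open>mg v - 1\<close> is the position of the arc from \<open>s\<close> to \<open>v\<close>, if \<open>mg v\<close> is positive. The weights of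
  the arcs merged into one network arc enter only through sums over the arcs with given
  ends, so it is enough to record those sums, tested against an arbitrary \<open>\<Phi>\<close>.
\<close>

definition contracted_upto ::
    "nat \<Rightarrow> nat \<Rightarrow> (nat \<Rightarrow> nat) \<Rightarrow> (nat \<Rightarrow> nat) \<Rightarrow> (nat \<Rightarrow> nat) \<Rightarrow> (nat \<Rightarrow> nat) \<Rightarrow> bool" where
  "contracted_upto b q nt nh nc mg \<longleftrightarrow> q \<le> b \<and>
     (\<forall>\<Phi> :: nat \<Rightarrow> nat \<Rightarrow> nat. (\<Sum>i<q. nc i * \<Phi> (nt i) (nh i)) =
        (\<Sum>e<b. if kept e then w e * \<Phi> (ctail e) (chead e) else 0)) \<and>
     (\<forall>i<q. 0 < nc i \<and> (\<exists>e<b. kept e \<and> nt i = ctail e \<and> nh i = chead e)) \<and>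
     (\<forall>i<q. \<forall>j<q. nt i = nt j \<and> nh i = nh j \<longrightarrow> i = j) \<and>
     (\<forall>v. mg v \<le> q \<and> (mg v = 0 \<longrightarrow> (\<forall>i<q. \<not> (nt i = s \<and> nh i = v))) \<and>
        (0 < mg v \<longrightarrow> nt (mg v - 1) = s \<and> nh (mg v - 1) = v))"

lemma contracted_upto_0: "contracted_upto 0 0 nt nh nc (\<lambda>_. 0)"
  by (simp add: contracted_upto_def)

lemma contracted_upto_skip:
  "contracted_upto b q nt nh nc mg \<Longrightarrow> \<not> kept b \<Longrightarrow> contracted_upto (Suc b) q nt nh nc mg"
  unfolding contracted_upto_def by (auto simp: less_Suc_eq)

text \<open>Case of an outer arc whose contracted copy from \<open>s\<close> to \<open>he b\<close>
  exists already: raising its capacity adds exactly one term to each tested sum.\<close>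

lemma contracted_upto_merge:
  assumes N: "contracted_upto b q nt nh nc mg" and b: "kept b" "\<not> inner b" "0 < mg (he b)"
    and i: "i = mg (he b) - 1"
  shows "contracted_upto (Suc b) q nt nh (nc(i := nc i + w b)) mg"
proof -
  have "mg (he b) \<le> q" and ends: "nt i = s" "nh i = he b"
    using N b(3) i by (auto simp: contracted_upto_def)
  then have iq: "i < q" using b(3) i by linarith
  have c: "ctail b = s" "chead b = he b"
    using b by (auto simp: kept_def ctail_def chead_def)
  have "(\<Sum>i'<q. (nc(i := nc i + w b)) i' * \<Phi> (nt i') (nh i')) =
      (\<Sum>e<Suc b. if kept e then w e * \<Phi> (ctail e) (chead e) else 0)" for \<Phi> :: "nat \<Rightarrow> nat \<Rightarrow> nat"
  proof -
    have "(\<Sum>i'<q. (nc(i := nc i + w b)) i' * \<Phi> (nt i') (nh i')) =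
        (\<Sum>i'<q. nc i' * \<Phi> (nt i') (nh i') + (if i' = i then w b * \<Phi> s (he b) else 0))"
      by (rule sum.cong) (auto simp: ends algebra_simps)
    also have "\<dots> = (\<Sum>i'<q. nc i' * \<Phi> (nt i') (nh i')) + w b * \<Phi> s (he b)"
      using iq by (simp add: sum.distrib)
    finally show ?thesis
      using N b(1) c by (simp add: contracted_upto_def)
  qed
  moreover have "0 < nc i' \<and> (\<exists>e<Suc b. kept e \<and> nt i' = ctail e \<and> nh i' = chead e)" if "i' < q" for i'
    using N that unfolding contracted_upto_def by (meson less_SucI)
  ultimately show ?thesis
    using N unfolding contracted_upto_def by auto
qed

text \<open>Only outer arcs can become parallel, and for them \<open>mg\<close> tells whether a copy
  exists. Inner arcs stay distinct: equal tails put the heads in one class, which has a single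
  center, so gluing identifies no two heads.\<close>

lemma contracted_upto_append:
  assumes N: "contracted_upto b q nt nh nc mg" and b: "b < m" "kept b" "inner b \<or> mg (he b) = 0"
    and mg': "mg' = (if inner b then mg else mg(he b := Suc q))"
  shows "contracted_upto (Suc b) (Suc q) (nt(q := ctail b)) (nh(q := chead b)) (nc(q := w b)) mg'"
proof -
  let ?nt = "nt(q := ctail b)" and ?nh = "nh(q := chead b)" and ?nc = "nc(q := w b)"
  have new: "\<not> (nt i = ctail b \<and> nh i = chead b)" if i: "i < q" for i
  proof (cases "inner b")
    case False
    then have "ctail b = s" "chead b = he b" "mg (he b) = 0"
      using b by (auto simp: ctail_def chead_def kept_def)
    then show ?thesis using N i by (auto simp: contracted_upto_def)
  next
    case True
    obtain e where e: "e < b" "kept e" "nt i = ctail e" "nh i = chead e"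
      using N i by (auto simp: contracted_upto_def)
    show ?thesis
    proof
      assume "nt i = ctail b \<and> nh i = chead b"
      with e have eq: "ctail e = ctail b" "chead e = chead b" by auto
      have tlb: "ctail b = ta b" "ta b \<in> W" "ta b \<notin> C" using True b by (auto simp: inner_def ctail_def kept_def)
      with eq s_notin have ie: "inner e" "ta e = ta b" by (auto simp: ctail_def split: if_splits)
      then have "rt (he e) = rt (he b)" using True by (simp add: inner_def)
      then have "he e = he b"
        using eq(2) C_unique t_center b(2) e(2) by (auto simp: chead_def split: if_splits)
      then show False using no_multi[of e b] ie e(1) b(1) by auto
    qed
  qed
  have c1: "(\<Sum>i<Suc q. ?nc i * \<Phi> (?nt i) (?nh i)) =
      (\<Sum>e<Suc b. if kept e then w e * \<Phi> (ctail e) (chead e) else 0)" for \<Phi> :: "nat \<Rightarrow> nat \<Rightarrow> nat"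
  proof -
    have "(\<Sum>i<q. ?nc i * \<Phi> (?nt i) (?nh i)) =
        (\<Sum>i<q. nc i * \<Phi> (nt i) (nh i))"
      by (rule sum.cong) auto
    then show ?thesis using N b(2) by (simp add: contracted_upto_def)
  qed
  have c2: "0 < ?nc i \<and>
      (\<exists>e<Suc b. kept e \<and> ?nt i = ctail e \<and> ?nh i = chead e)" if "i < Suc q" for i
  proof (cases "i = q")
    case True
    then show ?thesis using b w_pos by auto
  next
    case False
    with that have "i < q" by simp
    then obtain e where "e < b" "kept e" "nt i = ctail e" "nh i = chead e" "0 < nc i"
      using N by (auto simp: contracted_upto_def)
    then show ?thesis using False by (auto intro!: exI[of _ e])
  qed
  have c3: "i = j" if "i < Suc q" "j < Suc q"
    "?nt i = ?nt j" "?nh i = ?nh j" for i j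
  proof -
    have old: "i = j" if "i < q" "j < q" "nt i = nt j" "nh i = nh j"
      using N that unfolding contracted_upto_def by blast
    consider "i = q" "j = q" | "i = q" "j < q" | "i < q" "j = q" | "i < q" "j < q"
      using \<open>i < Suc q\<close> \<open>j < Suc q\<close> by linarith
    then show ?thesis
      by cases (use that(3,4) new[of i] new[of j] old in auto)
  qed
  have c4: "mg' v \<le> Suc q \<and>
      (mg' v = 0 \<longrightarrow> (\<forall>i<Suc q. \<not> (?nt i = s \<and> ?nh i = v))) \<and>
      (0 < mg' v \<longrightarrow> ?nt (mg' v - 1) = s \<and> ?nh (mg' v - 1) = v)" for v
  proof -
    have old: "mg v \<le> q" "mg v = 0 \<Longrightarrow> \<forall>i<q. \<not> (nt i = s \<and> nh i = v)"
      "0 < mg v \<Longrightarrow> nt (mg v - 1) = s \<and> nh (mg v - 1) = v"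
      using N by (auto simp: contracted_upto_def)
    show ?thesis
    proof (cases "inner b")
      case True
      then have "ctail b \<noteq> s" using s_notin by (auto simp: ctail_def inner_def)
      then show ?thesis using True old by (auto simp: mg' less_Suc_eq)
    next
      case False
      then have "ctail b = s" "chead b = he b" using b(2) by (auto simp: ctail_def chead_def kept_def)
      then show ?thesis using False old by (auto simp: mg' less_Suc_eq)
    qed
  qed
  have "Suc q \<le> Suc b" using N by (simp add: contracted_upto_def)
  moreover have "\<forall>\<Phi> :: nat \<Rightarrow> nat \<Rightarrow> nat. (\<Sum>i<Suc q. ?nc i * \<Phi> (?nt i) (?nh i)) =
      (\<Sum>e<Suc b. if kept e then w e * \<Phi> (ctail e) (chead e) else 0)"
    by (rule allI, rule c1)
  moreover have "\<forall>i<Suc q. 0 < ?nc i \<and> (\<exists>e<Suc b. kept e \<and> ?nt i = ctail e \<and> ?nh i = chead e)"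
    by (intro allI impI, rule c2)
  moreover have "\<forall>i<Suc q. \<forall>j<Suc q. ?nt i = ?nt j \<and> ?nh i = ?nh j \<longrightarrow> i = j"
    using c3 by blast
  moreover have "\<forall>v. mg' v \<le> Suc q \<and> (mg' v = 0 \<longrightarrow> (\<forall>i<Suc q. \<not> (?nt i = s \<and> ?nh i = v))) \<and>
      (0 < mg' v \<longrightarrow> ?nt (mg' v - 1) = s \<and> ?nh (mg' v - 1) = v)"
    by (rule allI, rule c4)
  ultimately show ?thesis
    unfolding contracted_upto_def by (intro conjI)
qed

lemma contracted_ends:
  assumes "contracted_upto m q nt nh nc mg" "i < q"
  shows "nt i \<noteq> nh i" "nt i \<in> insert s W" "nh i \<in> W"
proof -
  obtain e where e: "e < m" "kept e" "nt i = ctail e" "nh i = chead e"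
    using assms by (auto simp: contracted_upto_def)
  have "ctail e \<noteq> chead e"
    using e(1,2) s_notin t_center C_subset no_loop[of e]
    by (auto simp: kept_def ctail_def chead_def inner_def)
  then show "nt i \<noteq> nh i" "nt i \<in> insert s W" "nh i \<in> W"
    using e t_center C_subset by (auto simp: kept_def ctail_def chead_def inner_def)
qed

lemma contracted_sum:
  assumes "contracted_upto b q nt nh nc mg"
  shows "(\<Sum>i<q. nc i * \<Phi> (nt i) (nh i)) =
    (\<Sum>e<b. if kept e then w e * \<Phi> (ctail e) (chead e) else 0)"
  using assms unfolding contracted_upto_def by blast

text \<open>The constant test function 1 bounds every merged capacity by the total weight. This
  keeps stored values within memory and the network legal for the subroutine.\<close>

lemma contracted_capacity:
  assumes "contracted_upto b q nt nh nc mg" "i < q"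
  shows "nc i \<le> (\<Sum>e<b. w e)"
proof -
  have "nc i \<le> (\<Sum>i<q. nc i)"
    using assms(2) by (intro member_le_sum) auto
  also have "\<dots> = (\<Sum>e<b. if kept e then w e else 0)"
    using contracted_sum[OF assms(1), of "\<lambda>_ _. 1"] by (simp cong: if_cong)
  also have "\<dots> \<le> (\<Sum>e<b. w e)"
    by (rule sum_mono) simp
  finally show ?thesis .
qed

section \<open>Cut values of the contracted network\<close>

definition ccut :: "nat set \<Rightarrow> nat" where
  "ccut U = (\<Sum>e<m. if kept e \<and> ctail e \<in> U \<and> chead e \<notin> U then w e else 0)"

lemma contracted_cut:
  assumes "contracted_upto m q nt nh nc mg"
  shows "(\<Sum>i | i < q \<and> nt i \<in> U \<and> nh i \<notin> U. nc i) = ccut U"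
proof -
  have "(\<Sum>i | i < q \<and> nt i \<in> U \<and> nh i \<notin> U. nc i) =
      (\<Sum>i<q. nc i * (if nt i \<in> U \<and> nh i \<notin> U then 1 else 0))"
    by (rule sum.mono_neutral_cong_left) auto
  also have "\<dots> = (\<Sum>e<m. if kept e then w e * (if ctail e \<in> U \<and> chead e \<notin> U then 1 else 0) else 0)"
    by (rule contracted_sum[OF assms])
  also have "\<dots> = ccut U"
    unfolding ccut_def by (rule sum.cong) auto
  finally show ?thesis .
qed

text \<open>In the network only \<open>t\<close> stands for the centers, so \<open>U\<close> says
  nothing reliable about the others; all of them belong to the sink side.\<close>

definition sink_side :: "nat set \<Rightarrow> nat set" where
  "sink_side U = C \<union> (W - U)"

text \<open>The arc enters that part of \<open>Z\<close> which lies in the class of its head. An arc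
  between two classes therefore counts even if both ends are in \<open>Z\<close>.\<close>

definition entering :: "nat set \<Rightarrow> nat \<Rightarrow> bool" where
  "entering Z e \<longleftrightarrow> he e \<in> Z \<and> \<not> (ta e \<in> Z \<and> rt (ta e) = rt (he e))"

text \<open>
  The dropped arcs that enter a sink side end in a center and start outside its class, so their weight
  does not depend on the cut.
\<close>

lemma ccut_eq:
  assumes "s \<in> U" "t \<notin> U"
  shows "(\<Sum>e<m. if entering (sink_side U) e then w e else 0) =
    ccut U + (\<Sum>e<m. if he e \<in> C \<and> \<not> inner e then w e else 0)"
  unfolding ccut_def sum.distrib[symmetric]
proof (rule sum.cong)
  fix e
  show "(if entering (sink_side U) e then w e else 0) =
    (if kept e \<and> ctail e \<in> U \<and> chead e \<notin> U then w e else 0) +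
    (if he e \<in> C \<and> \<not> inner e then w e else 0)"
    using assms C_subset s_notin
    by (cases "he e \<in> W"; cases "inner e"; cases "he e \<in> C"; cases "ta e \<in> C")
      (auto simp: entering_def sink_side_def kept_def ctail_def chead_def inner_def)
qed simp

lemma cut_into_class:
  assumes "Z \<subseteq> W"
  shows "cut_into ta he w m {v \<in> Z. rt v = r} = (\<Sum>e<m. if rt (he e) = r \<and> entering Z e then w e else 0)"
  unfolding cut_into_def by (rule sum.cong) (auto simp: entering_def)

text \<open>Exchange argument: keep \<open>A\<close> in all other classes and use the complement of
  \<open>X\<close> in the class of \<open>c\<close>. The other classes contribute the same to both
  cuts, so minimality of \<open>A\<close> becomes a comparison inside this one class.\<close>

lemma min_ccut_class:
  assumes A: "s \<in> A" "t \<notin> A" and min: "\<And>U. s \<in> U \<Longrightarrow> t \<notin> U \<Longrightarrow> ccut A \<le> ccut U"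
    and X: "X \<subseteq> {v \<in> W. rt v = rt c}" "c \<in> C" "c \<in> X"
  shows "cut_into ta he w m {v \<in> sink_side A. rt v = rt c} \<le> cut_into ta he w m X"
proof -
  define K where "K = {v \<in> W. rt v = rt c}"
  define U where "U = (A - K) \<union> (K - X)"
  \<comment> \<open>If \<open>t\<close> lies in the class of \<open>c\<close>, then \<open>t\<close>
    equals \<open>c\<close> and hence lies in \<open>X\<close>.\<close>
  have U: "s \<in> U" "t \<notin> U"
    using A s_notin t_center X C_subset C_unique[of t c] by (auto simp: U_def K_def)
  have ZU: "sink_side U = (sink_side A - K) \<union> X"
    using X C_subset C_unique by (auto simp: sink_side_def U_def K_def)
  let ?in = "\<lambda>Z. \<Sum>e<m. if rt (he e) = rt c \<and> entering Z e then w e else 0"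
  let ?out = "\<lambda>Z. \<Sum>e<m. if rt (he e) \<noteq> rt c \<and> entering Z e then w e else 0"
  have split: "(\<Sum>e<m. if entering Z e then w e else 0) = ?in Z + ?out Z" for Z
    unfolding sum.distrib[symmetric] by (rule sum.cong) auto
  have ZW: "sink_side A \<subseteq> W" "sink_side U \<subseteq> W"
    using C_subset by (auto simp: sink_side_def)
  have "entering (sink_side A) e \<longleftrightarrow> entering (sink_side U) e" if "rt (he e) \<noteq> rt c" for e
    using that X ZW unfolding ZU by (auto simp: entering_def K_def)
  then have "?out (sink_side A) = ?out (sink_side U)"
    by (intro sum.cong) auto
  then have "?in (sink_side A) \<le> ?in (sink_side U)"
    using ccut_eq[OF A] ccut_eq[OF U] min[OF U] by (simp add: split)
  moreover have "?in (sink_side U) = cut_into ta he w m X"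
  proof -
    have "{v \<in> sink_side U. rt v = rt c} = X"
      using X ZW unfolding ZU by (auto simp: K_def)
    then show ?thesis using cut_into_class[OF ZW(2), of "rt c"] by simp
  qed
  ultimately show ?thesis
    using cut_into_class[OF ZW(1), of "rt c"] by simp
qed

end

section \<open>Breadth-first search\<close>

text \<open>\<open>last_arc f b v\<close> is \<open>e + 1\<close> for the last \<open>e < b\<close> with \<open>f e = v\<close>, and \<open>0\<close> if there is none.\<close>

primrec last_arc :: "(nat \<Rightarrow> nat) \<Rightarrow> nat \<Rightarrow> nat \<Rightarrow> nat" where
  "last_arc f 0 v = 0"
| "last_arc f (Suc b) v = (if f b = v then Suc b else last_arc f b v)"

lemma last_arc_le: "last_arc f b v \<le> b"
  by (induction b) auto

lemma last_arc_tail: "0 < last_arc f b v \<Longrightarrow> f (last_arc f b v - 1) = v"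
  by (induction b) (auto split: if_splits)

lemma last_arc_last: "last_arc f b v \<le> e \<Longrightarrow> e < b \<Longrightarrow> f e \<noteq> v"
  by (induction b) (auto simp: less_Suc_eq split: if_splits)

locale search =
  fixes n K s :: nat and src dst :: "nat \<Rightarrow> nat"
  assumes s_less: "s < n" and dst_less: "e < K \<Longrightarrow> dst e < n"
begin

definition arc_rel :: "(nat \<times> nat) set" where
  "arc_rel = {(src e, dst e) | e. e < K}"

text \<open>Adjacency lists are traversed from the largest arc number downwards. At the head of the
  queue the arcs from \<open>p\<close> on are done, \<open>p - 1\<close> is the next one, and
  \<open>p = 0\<close> means the list is exhausted.\<close>

definition explored :: "nat \<Rightarrow> nat \<Rightarrow> nat \<Rightarrow> (nat \<Rightarrow> nat) \<Rightarrow> nat \<Rightarrow> bool" where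
  "explored qh qt p queue e \<longleftrightarrow>
     (\<exists>j<qh. src e = queue j) \<or> (qh < qt \<and> src e = queue qh \<and> p \<le> e)"

text \<open>This gives soundness of the search and, for the tree, the property that parents come
  earlier in the queue.\<close>

definition discovered :: "nat \<Rightarrow> (nat \<Rightarrow> nat) \<Rightarrow> bool" where
  "discovered q queue \<longleftrightarrow> (\<forall>j. 0 < j \<and> j < q \<longrightarrow> (\<exists>i<j. (queue i, queue j) \<in> arc_rel))"

definition search_inv :: "nat \<Rightarrow> nat \<Rightarrow> nat \<Rightarrow> (nat \<Rightarrow> nat) \<Rightarrow> (nat \<Rightarrow> nat) \<Rightarrow> bool" where
  "search_inv qh qt p vis queue \<longleftrightarrow> 0 < qt \<and> qh \<le> qt \<and> inj_on queue {..<qt} \<and>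
     queue ` {..<qt} \<subseteq> {..<n} \<and> (\<forall>v<n. vis v = of_bool (v \<in> queue ` {..<qt})) \<and>
     queue 0 = s \<and> discovered qt queue \<and>
     (qh < qt \<longrightarrow> p \<le> K \<and> (0 < p \<longrightarrow> src (p - 1) = queue qh)) \<and>
     (\<forall>e<K. explored qh qt p queue e \<longrightarrow> dst e \<in> queue ` {..<qt})"

text \<open>The loop variant: an iteration either advances the head of the queue or explores one
  arc. Discovering a vertex leaves it unchanged but happens in the same iteration as an arc.\<close>

definition work :: "nat \<Rightarrow> nat \<Rightarrow> nat \<Rightarrow> (nat \<Rightarrow> nat) \<Rightarrow> nat" where
  "work qh qt p queue = (n - qh) + card {e. e < K \<and> \<not> explored qh qt p queue e}"

lemma search_inv_init:
  assumes "\<And>v. v < n \<Longrightarrow> vis v = 0"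
  shows "search_inv 0 1 (last_arc src K s) (vis(s := 1)) (queue(0 := s))"
  using assms s_less last_arc_le[of src K s] last_arc_tail[of src K s] last_arc_last[of src K s]
  by (auto simp: search_inv_def explored_def discovered_def lessThan_Suc)

lemma work_le: "work qh qt p queue \<le> n + K"
proof -
  have "card {e. e < K \<and> \<not> explored qh qt p queue e} \<le> card {..<K}"
    by (rule card_mono) auto
  then show ?thesis by (simp add: work_def)
qed

lemma search_inv_qt:
  assumes "search_inv qh qt p vis queue"
  shows "qt \<le> n" and "x < n \<Longrightarrow> vis x = 0 \<Longrightarrow> qt < n"
proof -
  have *: "inj_on queue {..<qt}" "queue ` {..<qt} \<subseteq> {..<n}"
    using assms by (auto simp: search_inv_def)
  then show "qt \<le> n"
    using card_inj_on_le[of queue "{..<qt}" "{..<n}"] by simp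
  assume "x < n" "vis x = 0"
  then have "queue ` {..<qt} \<subseteq> {..<n} - {x}"
    using assms by (force simp: search_inv_def)
  then show "qt < n"
    using card_inj_on_le[of queue "{..<qt}" "{..<n} - {x}"] * \<open>x < n\<close> by simp
qed

text \<open>No arc strictly between the old and the new pointer starts at the queue head, so exactly
  \<open>p - 1\<close> becomes explored. It was unexplored before because queue entries are
  distinct.\<close>

lemma explored_step:
  assumes "search_inv qh qt p vis queue" "qh < qt" "0 < p" "e < K"
    and p': "p' = last_arc src (p - 1) (src (p - 1))"
  shows "explored qh qt p' queue e \<longleftrightarrow> e = p - 1 \<or> explored qh qt p queue e"
    and "\<not> explored qh qt p queue (p - 1)"
proof -
  have src: "src (p - 1) = queue qh" and inj: "inj_on queue {..<qt}"
    using assms by (auto simp: search_inv_def)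
  have "p' \<le> p - 1" using last_arc_le p' by simp
  moreover have "src e \<noteq> queue qh" if "p' \<le> e" "e < p - 1"
    using last_arc_last[of src "p - 1" "src (p - 1)" e] that src p' by simp
  ultimately have "src e = queue qh \<Longrightarrow> p' \<le> e \<longleftrightarrow> e = p - 1 \<or> p \<le> e"
    by linarith
  then show "explored qh qt p' queue e \<longleftrightarrow> e = p - 1 \<or> explored qh qt p queue e"
    using src assms(2) unfolding explored_def by auto
  show "\<not> explored qh qt p queue (p - 1)"
    using src assms(2,3) inj_onD[OF inj, of qh] by (fastforce simp: explored_def)
qed

lemma work_arc:
  assumes "search_inv qh qt p vis queue" "qh < qt" "0 < p"
    and p': "p' = last_arc src (p - 1) (src (p - 1))"
  shows "work qh qt p' queue < work qh qt p queue"
proof -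
  have "p - 1 < K" using assms by (auto simp: search_inv_def)
  then have "{e. e < K \<and> \<not> explored qh qt p' queue e} \<subset> {e. e < K \<and> \<not> explored qh qt p queue e}"
    using explored_step[OF assms(1-3) _ p'] by auto
  then show ?thesis
    unfolding work_def by (intro add_strict_left_mono psubset_card_mono) auto
qed

lemma search_inv_old:
  assumes inv: "search_inv qh qt p vis queue" and p: "qh < qt" "0 < p" "vis (dst (p - 1)) \<noteq> 0"
    and p': "p' = last_arc src (p - 1) (src (p - 1))"
  shows "search_inv qh qt p' vis queue"
proof -
  have pK: "p - 1 < K" "src (p - 1) = queue qh" using inv p by (auto simp: search_inv_def)
  then have "dst (p - 1) \<in> queue ` {..<qt}"
    using inv p(3) dst_less by (auto simp: search_inv_def)
  then have "\<forall>e<K. explored qh qt p' queue e \<longrightarrow> dst e \<in> queue ` {..<qt}"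
    using inv explored_step[OF inv p(1,2) _ p'] by (auto simp: search_inv_def)
  moreover have "p' \<le> K" "0 < p' \<Longrightarrow> src (p' - 1) = queue qh"
    using last_arc_le[of src "p - 1" "src (p - 1)"] last_arc_tail[of src "p - 1" "src (p - 1)"] pK p' by auto
  ultimately show ?thesis
    using inv unfolding search_inv_def by blast
qed

lemma search_inv_discover:
  assumes inv: "search_inv qh qt p vis queue" and p: "qh < qt" "0 < p" "x = dst (p - 1)" "vis x = 0"
  shows "search_inv qh (Suc qt) p (vis(x := 1)) (queue(qt := x))"
    and "work qh (Suc qt) p (queue(qt := x)) = work qh qt p queue"
proof -
  let ?q = "queue(qt := x)"
  have pK: "p - 1 < K" "src (p - 1) = queue qh" using inv p by (auto simp: search_inv_def)
  have xn: "x < n" using pK p dst_less by simp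
  have new: "x \<notin> queue ` {..<qt}"
    using inv p(4) xn by (auto simp: search_inv_def)
  have img: "?q ` {..<Suc qt} = insert x (queue ` {..<qt})"
    by (auto simp: lessThan_Suc)
  have inj: "inj_on ?q {..<Suc qt}"
    using inv new by (auto simp: search_inv_def inj_on_def less_Suc_eq)
  have ex: "explored qh (Suc qt) p ?q e \<longleftrightarrow> explored qh qt p queue e" for e
  proof -
    have "(\<exists>j<qh. src e = ?q j) \<longleftrightarrow> (\<exists>j<qh. src e = queue j)"
      using p(1) by (intro ex_cong) auto
    then show ?thesis using p(1) by (simp add: explored_def)
  qed
  have "(queue qh, x) \<in> arc_rel"
    unfolding arc_rel_def using pK p(3) by force
  then have step: "\<exists>i<j. (?q i, ?q j) \<in> arc_rel" if j: "0 < j" "j < Suc qt" for j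
  proof (cases "j = qt")
    case True
    then show ?thesis using \<open>(queue qh, x) \<in> arc_rel\<close> p(1) by (intro exI[of _ qh]) simp
  next
    case False
    then have "j < qt" using j(2) by simp
    moreover have "discovered qt queue"
      using inv by (simp add: search_inv_def)
    ultimately obtain i where "i < j" "(queue i, queue j) \<in> arc_rel"
      using j(1) unfolding discovered_def by meson
    then show ?thesis using False j by (intro exI[of _ i]) simp
  qed
  have "discovered (Suc qt) ?q"
    unfolding discovered_def by (intro allI impI step) simp_all
  then show "search_inv qh (Suc qt) p (vis(x := 1)) ?q"
    using inv inj xn p(1) unfolding search_inv_def img ex by (simp add: subset_iff)
  show "work qh (Suc qt) p ?q = work qh qt p queue"
    by (simp add: work_def ex)
qed

lemma search_inv_next:
  assumes inv: "search_inv qh qt 0 vis queue" and qh: "qh < qt"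
    and p': "Suc qh < qt \<Longrightarrow> p' = last_arc src K (queue (Suc qh))"
  shows "search_inv (Suc qh) qt p' vis queue" and "work (Suc qh) qt p' queue < work qh qt 0 queue"
proof -
  have ex: "explored (Suc qh) qt p' queue e \<longleftrightarrow> explored qh qt 0 queue e" if "e < K" for e
    using qh p' last_arc_last[of src K "queue (Suc qh)" e] that
    unfolding explored_def less_Suc_eq by auto
  then show "search_inv (Suc qh) qt p' vis queue"
    using inv qh p' last_arc_le[of src K] last_arc_tail[of src K]
    unfolding search_inv_def by auto
  have "{e. e < K \<and> \<not> explored (Suc qh) qt p' queue e} = {e. e < K \<and> \<not> explored qh qt 0 queue e}"
    using ex by auto
  moreover have "qt \<le> n" using search_inv_qt(1)[OF inv] .
  ultimately show "work (Suc qh) qt p' queue < work qh qt 0 queue"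
    using qh by (simp add: work_def)
qed

definition searched :: "nat \<Rightarrow> (nat \<Rightarrow> nat) \<Rightarrow> (nat \<Rightarrow> nat) \<Rightarrow> bool" where
  "searched q vis queue \<longleftrightarrow> inj_on queue {..<q} \<and> queue ` {..<q} = arc_rel\<^sup>* `` {s} \<and> 0 < q \<and>
     (\<forall>v<n. vis v = of_bool ((s, v) \<in> arc_rel\<^sup>*)) \<and>
     queue 0 = s \<and> discovered q queue"

text \<open>When the queue is used up, all arcs out of it are explored, so it is closed under
  \<open>arc_rel\<close>. Conversely, predecessors of queue entries lie earlier, so every entry is
  reachable.\<close>

lemma search_inv_end:
  assumes inv: "search_inv qh qt p vis queue" and "\<not> qh < qt"
  shows "searched qt vis queue"
proof -
  have qh: "qh = qt" using assms by (simp add: search_inv_def)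
  have closed: "v \<in> queue ` {..<qt}" if uv: "u \<in> queue ` {..<qt}" "(u, v) \<in> arc_rel" for u v
  proof -
    obtain e where e: "e < K" "u = src e" "v = dst e"
      using uv(2) by (auto simp: arc_rel_def)
    then have "explored qh qt p queue e"
      using uv(1) by (auto simp: explored_def qh)
    then show ?thesis using inv e by (auto simp: search_inv_def)
  qed
  have "v \<in> queue ` {..<qt}" if "(s, v) \<in> arc_rel\<^sup>*" for v
    using that
  proof (induction rule: rtrancl_induct)
    case base
    then show ?case using inv by (force simp: search_inv_def)
  qed (rule closed)
  moreover have "j < qt \<Longrightarrow> (s, queue j) \<in> arc_rel\<^sup>*" for j
  proof (induction j rule: less_induct)
    case (less j)
    show ?case
    proof (cases "j = 0")
      case True
      then show ?thesis using inv by (simp add: search_inv_def)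
    next
      case False
      then obtain i where "i < j" "(queue i, queue j) \<in> arc_rel"
        using inv less.prems unfolding search_inv_def discovered_def by blast
      then show ?thesis using less by (meson less_trans rtrancl_into_rtrancl)
    qed
  qed
  ultimately have "queue ` {..<qt} = arc_rel\<^sup>* `` {s}" by auto
  then show ?thesis
    using inv unfolding search_inv_def searched_def by auto
qed

end

section \<open>The search as a program\<close>

definition bfs_init :: com where
  "bfs_init = For ''i'' (Var ''n'') (Put ''vis'' (Var ''i'') (Num 0) ;; Put ''first'' (Var ''i'') (Num 0))"

text \<open>Linked adjacency lists threaded through two arrays. Arc numbers are shifted by one so
  that 0 ends a list.\<close>

definition bfs_lists :: com where
  "bfs_lists = For ''i'' (Var ''K'')
     (Put ''next'' (Var ''i'') (Get ''first'' (Get ''src'' (Var ''i''))) ;;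
      Put ''first'' (Get ''src'' (Var ''i'')) (Plus (Var ''i'') (Num 1)))"

definition bfs_start :: com where
  "bfs_start = Put ''vis'' (Var ''s'') (Num 1) ;; Put ''queue'' (Num 0) (Var ''s'') ;;
     Assign ''qh'' (Num 0) ;; Assign ''qt'' (Num 1) ;; Assign ''p'' (Get ''first'' (Var ''s''))"

definition bfs_body :: com where
  "bfs_body = If (Less (Num 0) (Var ''p''))
     (Assign ''x'' (Get ''dst'' (Minus (Var ''p'') (Num 1))) ;;
      If (Less (Get ''vis'' (Var ''x'')) (Num 1))
        (Put ''vis'' (Var ''x'') (Num 1) ;; Put ''queue'' (Var ''qt'') (Var ''x'') ;;
         Assign ''qt'' (Plus (Var ''qt'') (Num 1)))
        Skip ;;
      Assign ''p'' (Get ''next'' (Minus (Var ''p'') (Num 1))))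
     (Assign ''qh'' (Plus (Var ''qh'') (Num 1)) ;;
      If (Less (Var ''qh'') (Var ''qt'')) (Assign ''p'' (Get ''first'' (Get ''queue'' (Var ''qh'')))) Skip)"

definition bfs :: com where
  "bfs = bfs_init ;; bfs_lists ;; bfs_start ;; While (Less (Var ''qh'') (Var ''qt'')) bfs_body"

context ram
begin

lemma wp_bfs_init:
  assumes "vars \<sigma> ''n'' = n" "n \<le> B"
  shows "wp bfs_init (\<lambda>u \<sigma>'. u \<le> 4 * n + 2 \<and> agree {''i''} {''vis'', ''first''} \<sigma> \<sigma>' \<and>
    (\<forall>v<n. arrs \<sigma>' ''vis'' v = 0 \<and> arrs \<sigma>' ''first'' v = 0)) \<sigma>"
proof -
  define I where "I j \<sigma>' \<longleftrightarrow> agree {''i''} {''vis'', ''first''} \<sigma> \<sigma>' \<and>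
    (\<forall>v<j. arrs \<sigma>' ''vis'' v = 0 \<and> arrs \<sigma>' ''first'' v = 0)" for j \<sigma>'
  have "wp bfs_init (\<lambda>u \<sigma>'. u \<le> (2 + 2) * n + 2 \<and> I n \<sigma>') \<sigma>"
    unfolding bfs_init_def
  proof (rule wp_For)
    show "I 0 (\<sigma>\<lparr>vars := (vars \<sigma>)(''i'' := 0)\<rparr>)"
      by (simp add: I_def agree_simps)
    show "aval (Var ''n'') \<sigma>' = n" if "I j \<sigma>'" for j \<sigma>'
      using that assms by (simp add: I_def agree_def eq_off_def)
    show "wp (Put ''vis'' (Var ''i'') (Num 0) ;; Put ''first'' (Var ''i'') (Num 0))
      (\<lambda>u \<sigma>''. u \<le> 2 \<and> vars \<sigma>'' ''i'' = j \<and> I (Suc j) (\<sigma>''\<lparr>vars := (vars \<sigma>'')(''i'' := Suc j)\<rparr>)) \<sigma>'"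
      if "I j \<sigma>'" "j < n" "vars \<sigma>' ''i'' = j" for j \<sigma>'
      using that assms by (simp add: wp_simps I_def agree_simps less_Suc_eq)
  qed (use assms in simp)
  then show ?thesis by (simp add: I_def)
qed

lemma wp_bfs_lists:
  assumes "vars \<sigma> ''K'' = K" "K \<le> B" "\<And>e. e < K \<Longrightarrow> arrs \<sigma> ''src'' e < n" "n \<le> B"
    "\<And>v. v < n \<Longrightarrow> arrs \<sigma> ''first'' v = 0"
  shows "wp bfs_lists (\<lambda>u \<sigma>'. u \<le> 4 * K + 2 \<and> agree {''i''} {''next'', ''first''} \<sigma> \<sigma>' \<and>
    (\<forall>v<n. arrs \<sigma>' ''first'' v = last_arc (arrs \<sigma> ''src'') K v) \<and>
    (\<forall>e<K. arrs \<sigma>' ''next'' e = last_arc (arrs \<sigma> ''src'') e (arrs \<sigma> ''src'' e))) \<sigma>"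
proof -
  define I where "I j \<sigma>' \<longleftrightarrow> agree {''i''} {''next'', ''first''} \<sigma> \<sigma>' \<and>
    (\<forall>v<n. arrs \<sigma>' ''first'' v = last_arc (arrs \<sigma> ''src'') j v) \<and>
    (\<forall>e<j. arrs \<sigma>' ''next'' e = last_arc (arrs \<sigma> ''src'') e (arrs \<sigma> ''src'' e))" for j \<sigma>'
  have "wp bfs_lists (\<lambda>u \<sigma>'. u \<le> (2 + 2) * K + 2 \<and> I K \<sigma>') \<sigma>"
    unfolding bfs_lists_def
  proof (rule wp_For)
    show "I 0 (\<sigma>\<lparr>vars := (vars \<sigma>)(''i'' := 0)\<rparr>)"
      using assms by (simp add: I_def agree_simps)
    show "aval (Var ''K'') \<sigma>' = K" if "I j \<sigma>'" for j \<sigma>'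
      using that assms by (simp add: I_def agree_def eq_off_def)
    fix j \<sigma>' assume *: "I j \<sigma>'" "j < K" "vars \<sigma>' ''i'' = j"
    then have "arrs \<sigma>' ''src'' = arrs \<sigma> ''src''"
      by (simp add: I_def agree_def eq_off_def)
    moreover have "last_arc (arrs \<sigma> ''src'') j v \<le> B" for v
      using last_arc_le[of "arrs \<sigma> ''src''" j v] *(2) assms(2) by linarith
    ultimately show "wp (Put ''next'' (Var ''i'') (Get ''first'' (Get ''src'' (Var ''i''))) ;;
          Put ''first'' (Get ''src'' (Var ''i'')) (Plus (Var ''i'') (Num 1)))
      (\<lambda>u \<sigma>''. u \<le> 2 \<and> vars \<sigma>'' ''i'' = j \<and> I (Suc j) (\<sigma>''\<lparr>vars := (vars \<sigma>'')(''i'' := Suc j)\<rparr>)) \<sigma>'"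
      using * assms(2,4) assms(3)[of j] by (simp add: wp_simps I_def agree_simps less_Suc_eq)
  qed (use assms in simp)
  then show ?thesis by (simp add: I_def)
qed

lemma wp_bfs:
  assumes "vars \<sigma> ''n'' = n" "vars \<sigma> ''K'' = K" "vars \<sigma> ''s'' = s" "s < n" "n \<le> B" "K \<le> B"
    and src: "src = arrs \<sigma> ''src''" and dst: "dst = arrs \<sigma> ''dst''"
    and arcs: "\<And>e. e < K \<Longrightarrow> src e < n \<and> dst e < n"
  shows "wp bfs (\<lambda>u \<sigma>'. u \<le> 12 * (n + K) + 10 \<and>
    agree {''i'', ''x'', ''p'', ''qh'', ''qt''} {''vis'', ''first'', ''next'', ''queue''} \<sigma> \<sigma>' \<and>
    search.searched n K s src dst (vars \<sigma>' ''qt'') (arrs \<sigma>' ''vis'') (arrs \<sigma>' ''queue'')) \<sigma>"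
proof -
  interpret search n K s src dst
    using assms by unfold_locales auto
  let ?X = "{''i'', ''x'', ''p'', ''qh'', ''qt''}" and ?Y = "{''vis'', ''first'', ''next'', ''queue''}"
  define J where "J \<sigma>' \<longleftrightarrow> agree ?X ?Y \<sigma> \<sigma>' \<and>
    (\<forall>v<n. arrs \<sigma>' ''first'' v = last_arc src K v) \<and>
    (\<forall>e<K. arrs \<sigma>' ''next'' e = last_arc src e (src e)) \<and>
    search_inv (vars \<sigma>' ''qh'') (vars \<sigma>' ''qt'') (vars \<sigma>' ''p'') (arrs \<sigma>' ''vis'') (arrs \<sigma>' ''queue'')" for \<sigma>'
  define M :: "state \<Rightarrow> nat" where "M \<sigma>' = work (vars \<sigma>' ''qh'') (vars \<sigma>' ''qt'') (vars \<sigma>' ''p'') (arrs \<sigma>' ''queue'')" for \<sigma>'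
  have B: "last_arc src b v \<le> B" if "b \<le> K" for b v
    using last_arc_le[of src b v] that assms(6) by linarith
  \<comment> \<open>Seven steps occur when a new vertex is found: two tests, three commands to
    enqueue it, fetching the head and moving the pointer.\<close>
  have body: "wp bfs_body (\<lambda>u \<sigma>''. u \<le> 7 \<and> (\<exists>j<i. J \<sigma>'' \<and> j = M \<sigma>'')) \<sigma>'"
    if J: "J \<sigma>' \<and> i = M \<sigma>'" and b: "bval (Less (Var ''qh'') (Var ''qt'')) \<sigma>'" for i \<sigma>'
  proof -
    let ?qh = "vars \<sigma>' ''qh''" and ?qt = "vars \<sigma>' ''qt''" and ?p = "vars \<sigma>' ''p''"
    let ?vis = "arrs \<sigma>' ''vis''" and ?queue = "arrs \<sigma>' ''queue''"
    have inv: "search_inv ?qh ?qt ?p ?vis ?queue" and qh: "?qh < ?qt"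
      and dst': "arrs \<sigma>' ''dst'' = dst" and ag: "agree ?X ?Y \<sigma> \<sigma>'"
      and first: "\<forall>v<n. arrs \<sigma>' ''first'' v = last_arc src K v"
      and nxt: "\<forall>e<K. arrs \<sigma>' ''next'' e = last_arc src e (src e)"
      using J b agree_arrs[of ?X ?Y \<sigma> \<sigma>' "''dst''"] by (auto simp: J_def dst)
    have qt: "?qt \<le> n" using search_inv_qt(1)[OF inv] .
    show ?thesis
    proof (cases "0 < ?p")
      case False
      then have p: "?p = 0" by simp
      have q: "Suc ?qh < ?qt \<Longrightarrow> ?queue (Suc ?qh) < n"
        using inv by (auto simp: search_inv_def)
      note step = search_inv_next[OF inv[unfolded p] qh]
      show ?thesis
        using step[of "last_arc src K (?queue (Suc ?qh))"] step[of 0] p q qh qt ag first nxt J assms(5) B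
        by (auto simp: bfs_body_def wp_simps J_def M_def agree_simps)
    next
      case True
      let ?x = "dst (?p - 1)" and ?p' = "last_arc src (?p - 1) (src (?p - 1))"
      have pK: "?p - 1 < K" using inv qh True by (auto simp: search_inv_def)
      then have x: "?x < n" and n': "arrs \<sigma>' ''next'' (?p - 1) = ?p'" "?p' \<le> B"
        using arcs nxt B by auto
      show ?thesis
      proof (cases "?vis ?x = 0")
        case False
        show ?thesis
          using search_inv_old[OF inv qh True False refl] work_arc[OF inv qh True refl] True False
            pK x n' dst' ag first nxt J assms(5)
          by (simp add: bfs_body_def wp_simps J_def M_def agree_simps)
      next
        case new: True
        note step = search_inv_discover[OF inv qh True refl new]
        have qh': "?qh < Suc ?qt" using qh by simp
        \<comment> \<open>After enqueueing, the head of the current arc is visited, so advancing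
          past the arc is the case already treated.\<close>
        have inv': "search_inv ?qh (Suc ?qt) ?p' (?vis(?x := 1)) (?queue(?qt := ?x))"
          by (rule search_inv_old[OF step(1) qh' True]) simp_all
        have qt': "Suc ?qt \<le> B" using search_inv_qt(2)[OF inv x new] assms(5) by simp
        show ?thesis
          using inv' work_arc[OF step(1) qh' True refl] step(2) True new
            pK x n' dst' ag first nxt J assms(5) qt'
          by (simp add: bfs_body_def wp_simps J_def M_def agree_simps)
      qed
    qed
  qed
  have loop: "wp (While (Less (Var ''qh'') (Var ''qt'')) bfs_body)
      (\<lambda>u \<sigma>''. u \<le> 8 * (n + K) + 1 \<and> agree ?X ?Y \<sigma> \<sigma>'' \<and>
        searched (vars \<sigma>'' ''qt'') (arrs \<sigma>'' ''vis'') (arrs \<sigma>'' ''queue'')) \<sigma>'"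
    if J: "J \<sigma>'" for \<sigma>'
  proof (rule wp_mono[OF wp_While[where I = "\<lambda>i \<sigma>''. J \<sigma>'' \<and> i = M \<sigma>''" and i = "M \<sigma>'" and a = 7]])
    fix u \<sigma>''
    assume *: "u \<le> (7 + 1) * M \<sigma>' + 1 \<and> (\<exists>j. J \<sigma>'' \<and> j = M \<sigma>'') \<and>
      \<not> bval (Less (Var ''qh'') (Var ''qt'')) \<sigma>''"
    have "M \<sigma>' \<le> n + K" unfolding M_def by (rule work_le)
    then show "u \<le> 8 * (n + K) + 1 \<and> agree ?X ?Y \<sigma> \<sigma>'' \<and>
        searched (vars \<sigma>'' ''qt'') (arrs \<sigma>'' ''vis'') (arrs \<sigma>'' ''queue'')"
      using * search_inv_end by (auto simp: J_def)
  qed (use J body in auto)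
  show ?thesis
    unfolding bfs_def
  proof (rule wp_SeqI[OF wp_bfs_init[OF assms(1,5)]], goal_cases)
    case (1 u1 \<sigma>1)
    then have 1: "u1 \<le> 4 * n + 2" "agree {''i''} {''vis'', ''first''} \<sigma> \<sigma>1"
      "\<And>v. v < n \<Longrightarrow> arrs \<sigma>1 ''vis'' v = 0 \<and> arrs \<sigma>1 ''first'' v = 0"
      by auto
    note ag1 = agree_vars[OF 1(2)] agree_arrs[OF 1(2)]
    have K1: "vars \<sigma>1 ''K'' = K" and src1: "\<And>e. e < K \<Longrightarrow> arrs \<sigma>1 ''src'' e < n"
      and first1: "\<And>v. v < n \<Longrightarrow> arrs \<sigma>1 ''first'' v = 0"
      using assms 1(3) by (simp_all add: ag1)
    show ?case
    proof (rule wp_SeqI[OF wp_bfs_lists[OF K1 assms(6) src1 assms(5) first1]], goal_cases)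
      case (3 u2 \<sigma>2)
      then have 2: "u2 \<le> 4 * K + 2" "agree {''i''} {''next'', ''first''} \<sigma>1 \<sigma>2"
        "\<forall>v<n. arrs \<sigma>2 ''first'' v = last_arc src K v"
        "\<forall>e<K. arrs \<sigma>2 ''next'' e = last_arc src e (src e)"
        by (auto simp: ag1 src)
      note ag2 = agree_vars[OF 2(2)] agree_arrs[OF 2(2)]
      have ag: "agree ?X ?Y \<sigma> \<sigma>2"
        by (rule agree_trans[OF 1(2) 2(2)]) auto
      have i: "search_inv 0 1 (last_arc src K s) ((arrs \<sigma>2 ''vis'')(s := 1)) ((arrs \<sigma>2 ''queue'')(0 := s))"
        by (rule search_inv_init) (use 1(3) in \<open>simp add: ag2\<close>)
      have "wp bfs_start (\<lambda>u \<sigma>'. u \<le> 5 \<and> J \<sigma>') \<sigma>2"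
        using i ag 2(3,4) assms B[of K s]
        by (simp add: bfs_start_def wp_simps J_def agree_simps ag1 ag2)
      then show ?case
      proof (rule wp_SeqI, goal_cases)
        case (1 u3 \<sigma>3)
        then show ?case
          using loop[of \<sigma>3] 2(1) \<open>u1 \<le> 4 * n + 2\<close> by (auto elim!: wp_mono)
      qed
    qed
  qed
qed

end

section \<open>One round of the algorithm\<close>

definition Eq :: "aexp \<Rightarrow> aexp \<Rightarrow> bexp" where
  "Eq a b = And (Not (Less a b)) (Not (Less b a))"

definition Set :: "string \<Rightarrow> aexp \<Rightarrow> bexp" where
  "Set a e = Less (Num 0) (Get a e)"

lemma bval_Eq [simp]: "bval (Eq a b) \<sigma> \<longleftrightarrow> aval a \<sigma> = aval b \<sigma>"
  by (auto simp: Eq_def)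

lemma bval_Set [simp]: "bval (Set a e) \<sigma> \<longleftrightarrow> 0 < arrs \<sigma> a (aval e \<sigma>)"
  by (simp add: Set_def)

section \<open>Phases of a round up to the contracted network\<close>

definition reset :: com where
  "reset = For ''i'' (Var ''n'')
     (Put ''size'' (Var ''i'') (Num 1) ;; Put ''mrg'' (Var ''i'') (Num 0) ;; Put ''acc'' (Var ''i'') (Num 0))"

text \<open>The order is traversed backwards, so the size of a vertex is final before it is added to
  that of its parent.\<close>

definition sizes :: com where
  "sizes = For ''i'' (Var ''n'')
     (Assign ''v'' (Get ''ord'' (Minus (Minus (Var ''n'') (Num 1)) (Var ''i''))) ;;
      If (And (Set ''alive'' (Var ''v'')) (Set ''alive'' (Get ''par'' (Var ''v''))))
        (Put ''size'' (Get ''par'' (Var ''v''))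
          (Plus (Get ''size'' (Get ''par'' (Var ''v''))) (Get ''size'' (Var ''v''))))
        Skip)"

definition roots :: com where
  "roots = For ''i'' (Var ''n'')
     (Assign ''v'' (Get ''ord'' (Var ''i'')) ;;
      If (Set ''alive'' (Var ''v''))
        (If (Set ''alive'' (Get ''par'' (Var ''v'')))
           (Put ''root'' (Var ''v'') (Get ''root'' (Get ''par'' (Var ''v''))))
           (Put ''root'' (Var ''v'') (Var ''v'')) ;;
         If (Less (Get ''size'' (Get ''root'' (Var ''v'')))
                  (Plus (Get ''size'' (Var ''v'')) (Get ''size'' (Var ''v''))))
           (Put ''cen'' (Get ''root'' (Var ''v'')) (Var ''v''))
           Skip)
        Skip)"

definition mark_centers :: com where
  "mark_centers = For ''i'' (Var ''n'')
     (If (And (Set ''alive'' (Var ''i'')) (Eq (Get ''cen'' (Get ''root'' (Var ''i''))) (Var ''i'')))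
        (Put ''isc'' (Var ''i'') (Num 1) ;; Assign ''t'' (Var ''i''))
        (Put ''isc'' (Var ''i'') (Num 0)))"

definition contract_arc :: com where
  "contract_arc =
     Assign ''u'' (Get ''tail'' (Var ''i'')) ;; Assign ''v'' (Get ''head'' (Var ''i'')) ;;
     If (Set ''alive'' (Var ''v''))
       (If (And (Set ''alive'' (Var ''u'')) (Eq (Get ''root'' (Var ''u'')) (Get ''root'' (Var ''v''))))
          (If (Set ''isc'' (Var ''u''))
             Skip
             (Put ''nt'' (Var ''q'') (Var ''u'') ;;
              If (Set ''isc'' (Var ''v'')) (Put ''nh'' (Var ''q'') (Var ''t'')) (Put ''nh'' (Var ''q'') (Var ''v'')) ;;
              Put ''nc'' (Var ''q'') (Get ''weight'' (Var ''i'')) ;;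
              Assign ''q'' (Plus (Var ''q'') (Num 1))))
          (If (Set ''isc'' (Var ''v''))
             Skip
             (If (Set ''mrg'' (Var ''v''))
                (Put ''nc'' (Minus (Get ''mrg'' (Var ''v'')) (Num 1))
                  (Plus (Get ''nc'' (Minus (Get ''mrg'' (Var ''v'')) (Num 1))) (Get ''weight'' (Var ''i''))))
                (Put ''nt'' (Var ''q'') (Var ''s'') ;; Put ''nh'' (Var ''q'') (Var ''v'') ;;
                 Put ''nc'' (Var ''q'') (Get ''weight'' (Var ''i'')) ;;
                 Assign ''q'' (Plus (Var ''q'') (Num 1)) ;; Put ''mrg'' (Var ''v'') (Var ''q'')))))
       Skip"

definition contract :: com where
  "contract = Assign ''q'' (Num 0) ;; For ''i'' (Var ''m'') contract_arc"

text \<open>The factor 2 in the bound on \<open>m\<close> is for residual graphs, which store two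
  arcs per network arc. The total weight bounds every merged capacity and every accumulated cut
  value.\<close>

locale solver = ram B k mf tm + ordered_tree n s par ord
  for B k :: nat and mf :: "network \<Rightarrow> nat \<Rightarrow> nat" and tm :: "network \<Rightarrow> nat"
    and n s :: nat and par ord :: "nat \<Rightarrow> nat" +
  fixes m :: nat and ta he w :: "nat \<Rightarrow> nat"
  assumes s_less: "s < n"
    and ta_less: "e < m \<Longrightarrow> ta e < n" and he_less: "e < m \<Longrightarrow> he e < n"
    and loopfree: "e < m \<Longrightarrow> ta e \<noteq> he e"
    and nomulti: "e < m \<Longrightarrow> e' < m \<Longrightarrow> ta e = ta e' \<Longrightarrow> he e = he e' \<Longrightarrow> e = e'"
    and w_pos: "e < m \<Longrightarrow> 0 < w e"
    and n_B: "n \<le> B" and m_B: "2 * m \<le> B" and w_B: "(\<Sum>e<m. w e) \<le> B"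
    and w_k: "(\<Sum>e<m. w e) \<le> n ^ k"
begin

definition base :: "state \<Rightarrow> bool" where
  "base \<sigma> \<longleftrightarrow> vars \<sigma> ''n'' = n \<and> vars \<sigma> ''m'' = m \<and> vars \<sigma> ''s'' = s \<and>
     arrs \<sigma> ''tail'' = ta \<and> arrs \<sigma> ''head'' = he \<and> arrs \<sigma> ''weight'' = w \<and>
     arrs \<sigma> ''par'' = par \<and> arrs \<sigma> ''ord'' = ord"

lemma base_agree:
  assumes "base \<sigma>" "agree X Y \<sigma> \<sigma>'" "X \<inter> {''n'', ''m'', ''s''} = {}"
    "Y \<inter> {''tail'', ''head'', ''weight'', ''par'', ''ord''} = {}"
  shows "base \<sigma>'"
  using assms by (simp add: base_def agree_def eq_off_def)

lemma w_le: "e < m \<Longrightarrow> w e \<le> B"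
  using w_B member_le_sum[of e "{..<m}" w] by simp

definition marks :: "(nat \<Rightarrow> nat) \<Rightarrow> nat set \<Rightarrow> bool" where
  "marks a W \<longleftrightarrow> (\<forall>v<n. a v = of_bool (v \<in> W))"

lemma marksD: "marks a W \<Longrightarrow> v < n \<Longrightarrow> a v = of_bool (v \<in> W)"
  by (simp add: marks_def)

lemma wp_reset:
  assumes "base \<sigma>"
  shows "wp reset (\<lambda>u \<sigma>'. u \<le> 5 * n + 2 \<and> agree {''i''} {''size'', ''mrg'', ''acc''} \<sigma> \<sigma>' \<and>
    (\<forall>v<n. arrs \<sigma>' ''size'' v = 1 \<and> arrs \<sigma>' ''mrg'' v = 0 \<and> arrs \<sigma>' ''acc'' v = 0)) \<sigma>"
proof -
  define I where "I j \<sigma>' \<longleftrightarrow> agree {''i''} {''size'', ''mrg'', ''acc''} \<sigma> \<sigma>' \<and> base \<sigma>' \<and>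
    (\<forall>v<j. arrs \<sigma>' ''size'' v = 1 \<and> arrs \<sigma>' ''mrg'' v = 0 \<and> arrs \<sigma>' ''acc'' v = 0)" for j \<sigma>'
  have "wp reset (\<lambda>u \<sigma>'. u \<le> (3 + 2) * n + 2 \<and> I n \<sigma>') \<sigma>"
    unfolding reset_def
  proof (rule wp_For)
    show "I 0 (\<sigma>\<lparr>vars := (vars \<sigma>)(''i'' := 0)\<rparr>)"
      using assms by (simp add: I_def agree_simps base_def)
    show "aval (Var ''n'') \<sigma>' = n" if "I j \<sigma>'" for j \<sigma>'
      using that by (simp add: I_def base_def)
    fix j \<sigma>' assume "I j \<sigma>'" "j < n" "vars \<sigma>' ''i'' = j"
    then show "wp (Put ''size'' (Var ''i'') (Num 1) ;; Put ''mrg'' (Var ''i'') (Num 0) ;; Put ''acc'' (Var ''i'') (Num 0))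
      (\<lambda>u \<sigma>''. u \<le> 3 \<and> vars \<sigma>'' ''i'' = j \<and> I (Suc j) (\<sigma>''\<lparr>vars := (vars \<sigma>'')(''i'' := Suc j)\<rparr>)) \<sigma>'"
      using n_B by (simp add: wp_simps I_def agree_simps less_Suc_eq base_def)
  qed (rule n_B)
  then show ?thesis by (rule wp_mono) (auto simp: I_def)
qed

lemma wp_sizes:
  assumes "base \<sigma>" and W: "W \<subseteq> {..<n} - {s}" and al: "arrs \<sigma> ''alive'' = al" "marks al W"
    and "\<forall>v<n. arrs \<sigma> ''size'' v = 1"
  shows "wp sizes (\<lambda>u \<sigma>'. u \<le> 5 * n + 2 \<and> agree {''i'', ''v''} {''size''} \<sigma> \<sigma>' \<and>
    (\<forall>v<n. arrs \<sigma>' ''size'' v = csize W v)) \<sigma>"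
proof -
  define I where "I j \<sigma>' \<longleftrightarrow> agree {''i'', ''v''} {''size''} \<sigma> \<sigma>' \<and> base \<sigma>' \<and> arrs \<sigma>' ''alive'' = al \<and>
    (\<forall>v<n. arrs \<sigma>' ''size'' v = card (desc W (n - j) v))" for j \<sigma>'
  have "wp sizes (\<lambda>u \<sigma>'. u \<le> (3 + 2) * n + 2 \<and> I n \<sigma>') \<sigma>"
    unfolding sizes_def
  proof (rule wp_For)
    show "I 0 (\<sigma>\<lparr>vars := (vars \<sigma>)(''i'' := 0)\<rparr>)"
      using assms by (simp add: I_def agree_simps base_def desc_n[OF W])
    show "aval (Var ''n'') \<sigma>' = n" if "I j \<sigma>'" for j \<sigma>'
      using that by (simp add: I_def base_def)
    fix i \<sigma>' assume I: "I i \<sigma>'" "i < n" "vars \<sigma>' ''i'' = i"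
    \<comment> \<open>The iteration counter runs up while the position \<open>j\<close> runs down
      from \<open>n - 1\<close>.\<close>
    define j where "j = n - 1 - i"
    have j: "j < n" "Suc j = n - i" "n - Suc i = j" using I(2) by (auto simp: j_def)
    have x: "ord j < n" "ord j \<le> B" using ord_less[OF j(1)] n_B by auto
    have cond: "0 < al (ord j) \<and> 0 < al (par (ord j)) \<longleftrightarrow> ord j \<in> W \<and> par (ord j) \<in> W"
    proof (cases "ord j \<in> W")
      case True
      then have "par (ord j) < n" using W par_less by auto
      then show ?thesis using True x marksD[OF al(2)] by auto
    qed (use x marksD[OF al(2)] in auto)
    have bound: "card (desc W (Suc j) (par (ord j))) + card (desc W (Suc j) (ord j)) \<le> B" "par (ord j) < n"
      if "ord j \<in> W" "par (ord j) \<in> W"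
      using card_desc_step[OF W j(1) refl that, of "par (ord j)"] that W n_B
        card_desc_le[OF W, of "par (ord j)" j] by auto
    show "wp (Assign ''v'' (Get ''ord'' (Minus (Minus (Var ''n'') (Num 1)) (Var ''i''))) ;;
      If (And (Set ''alive'' (Var ''v'')) (Set ''alive'' (Get ''par'' (Var ''v''))))
        (Put ''size'' (Get ''par'' (Var ''v''))
          (Plus (Get ''size'' (Get ''par'' (Var ''v''))) (Get ''size'' (Var ''v''))))
        Skip)
      (\<lambda>u \<sigma>''. u \<le> 3 \<and> vars \<sigma>'' ''i'' = i \<and> I (Suc i) (\<sigma>''\<lparr>vars := (vars \<sigma>'')(''i'' := Suc i)\<rparr>)) \<sigma>'"
    proof (cases "ord j \<in> W \<and> par (ord j) \<in> W")
      case False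
      then show ?thesis
        using False I x cond desc_skip[OF W j(1) False]
        by (auto simp: wp_simps I_def agree_simps base_def j(2,3) j_def[symmetric])
    next
      case True
      then show ?thesis
        using I x cond bound n_B card_desc_step[OF W j(1) refl]
        by (simp add: wp_simps I_def agree_simps base_def j(2,3) j_def[symmetric])
    qed
  qed (rule n_B)
  then show ?thesis by (rule wp_mono) (auto simp: I_def csize_def)
qed

lemma wp_roots:
  assumes "base \<sigma>" and W: "W \<subseteq> {..<n} - {s}" and al: "arrs \<sigma> ''alive'' = al" "marks al W"
    and sz: "arrs \<sigma> ''size'' = sz" "\<And>v. v < n \<Longrightarrow> sz v = csize W v"
  shows "wp roots (\<lambda>u \<sigma>'. u \<le> 8 * n + 2 \<and> agree {''i'', ''v''} {''root'', ''cen''} \<sigma> \<sigma>' \<and>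
    roots_upto W n (arrs \<sigma>' ''root'') (arrs \<sigma>' ''cen'')) \<sigma>"
proof -
  define I where "I j \<sigma>' \<longleftrightarrow> agree {''i'', ''v''} {''root'', ''cen''} \<sigma> \<sigma>' \<and> base \<sigma>' \<and>
    arrs \<sigma>' ''alive'' = al \<and> arrs \<sigma>' ''size'' = sz \<and>
    roots_upto W j (arrs \<sigma>' ''root'') (arrs \<sigma>' ''cen'')" for j \<sigma>'
  have "wp roots (\<lambda>u \<sigma>'. u \<le> (6 + 2) * n + 2 \<and> I n \<sigma>') \<sigma>"
    unfolding roots_def
  proof (rule wp_For)
    show "I 0 (\<sigma>\<lparr>vars := (vars \<sigma>)(''i'' := 0)\<rparr>)"
      using assms by (simp add: I_def agree_simps base_def roots_upto_0)
    show "aval (Var ''n'') \<sigma>' = n" if "I j \<sigma>'" for j \<sigma>'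
      using that by (simp add: I_def base_def)
    fix j \<sigma>' assume I: "I j \<sigma>'" "j < n" "vars \<sigma>' ''i'' = j"
    let ?c = "Assign ''v'' (Get ''ord'' (Var ''i'')) ;;
      If (Set ''alive'' (Var ''v''))
        (If (Set ''alive'' (Get ''par'' (Var ''v'')))
           (Put ''root'' (Var ''v'') (Get ''root'' (Get ''par'' (Var ''v''))))
           (Put ''root'' (Var ''v'') (Var ''v'')) ;;
         If (Less (Get ''size'' (Get ''root'' (Var ''v'')))
                  (Plus (Get ''size'' (Var ''v'')) (Get ''size'' (Var ''v''))))
           (Put ''cen'' (Get ''root'' (Var ''v'')) (Var ''v''))
           Skip)
        Skip"
    let ?x = "ord j" and ?rt = "arrs \<sigma>' ''root''" and ?cen = "arrs \<sigma>' ''cen''"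
    have x: "?x < n" "?x \<le> B" using ord_less[OF I(2)] n_B by auto
    have R: "roots_upto W j ?rt ?cen" using I(1) by (simp add: I_def)
    show "wp ?c
      (\<lambda>u \<sigma>''. u \<le> 6 \<and> vars \<sigma>'' ''i'' = j \<and> I (Suc j) (\<sigma>''\<lparr>vars := (vars \<sigma>'')(''i'' := Suc j)\<rparr>)) \<sigma>'"
    proof (cases "?x \<in> W")
      case False
      then have "al ?x = 0" using x marksD[OF al(2)] by simp
      then show ?thesis
        using I x roots_upto_skip[OF W R I(2) False]
        by (simp add: wp_simps I_def agree_simps base_def)
    next
      case True
      let ?r = "if par ?x \<in> W then ?rt (par ?x) else ?x"
      let ?rt' = "?rt(?x := ?r)"
      have px: "par ?x < n" "pos (par ?x) < j"
        using True W par_less pos_par[of ?x] I(2) by auto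
      have r: "?r < n" "?r \<le> B"
        using roots_upto_in[OF W R, of "par ?x"] px x W n_B by (auto split: if_splits)
      have "al ?x = 1" "al (par ?x) = of_bool (par ?x \<in> W)"
        using True x px marksD[OF al(2)] by auto
      moreover note roots_upto_step[OF W R I(2) refl True refl refl]
      moreover have "sz ?r = csize W ?r" "sz ?x = csize W ?x" using sz(2) r x by auto
      ultimately show ?thesis
        using I x r by (cases "par ?x \<in> W") (auto simp: wp_simps I_def agree_simps base_def)
    qed
  qed (rule n_B)
  then show ?thesis by (rule wp_mono) (auto simp: I_def)
qed

lemma wp_mark_centers:
  assumes "base \<sigma>" and W: "W \<subseteq> {..<n} - {s}" and al: "arrs \<sigma> ''alive'' = al" "marks al W"
    and rt: "arrs \<sigma> ''root'' = rt" "arrs \<sigma> ''cen'' = cen"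
    and ex: "centers W rt cen \<noteq> {}"
  shows "wp mark_centers (\<lambda>u \<sigma>'. u \<le> 5 * n + 2 \<and> agree {''i'', ''t''} {''isc''} \<sigma> \<sigma>' \<and>
    marks (arrs \<sigma>' ''isc'') (centers W rt cen) \<and> vars \<sigma>' ''t'' \<in> centers W rt cen) \<sigma>"
proof -
  let ?C = "centers W rt cen"
  define I where "I j \<sigma>' \<longleftrightarrow> agree {''i'', ''t''} {''isc''} \<sigma> \<sigma>' \<and> base \<sigma>' \<and>
    arrs \<sigma>' ''alive'' = al \<and> arrs \<sigma>' ''root'' = rt \<and> arrs \<sigma>' ''cen'' = cen \<and>
    (\<forall>v<j. arrs \<sigma>' ''isc'' v = of_bool (v \<in> ?C)) \<and>
    ((\<exists>v<j. v \<in> ?C) \<longrightarrow> vars \<sigma>' ''t'' \<in> ?C)" for j \<sigma>'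
  have "wp mark_centers (\<lambda>u \<sigma>'. u \<le> (3 + 2) * n + 2 \<and> I n \<sigma>') \<sigma>"
    unfolding mark_centers_def
  proof (rule wp_For)
    show "I 0 (\<sigma>\<lparr>vars := (vars \<sigma>)(''i'' := 0)\<rparr>)"
      using assms by (simp add: I_def agree_simps base_def)
    show "aval (Var ''n'') \<sigma>' = n" if "I j \<sigma>'" for j \<sigma>'
      using that by (simp add: I_def base_def)
    fix j \<sigma>' assume I: "I j \<sigma>'" "j < n" "vars \<sigma>' ''i'' = j"
    have c: "j \<in> ?C \<longleftrightarrow> 0 < al j \<and> cen (rt j) = j"
      using marksD[OF al(2) I(2)] by (simp add: centers_def)
    show "wp (If (And (Set ''alive'' (Var ''i'')) (Eq (Get ''cen'' (Get ''root'' (Var ''i''))) (Var ''i'')))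
        (Put ''isc'' (Var ''i'') (Num 1) ;; Assign ''t'' (Var ''i''))
        (Put ''isc'' (Var ''i'') (Num 0)))
      (\<lambda>u \<sigma>''. u \<le> 3 \<and> vars \<sigma>'' ''i'' = j \<and> I (Suc j) (\<sigma>''\<lparr>vars := (vars \<sigma>'')(''i'' := Suc j)\<rparr>)) \<sigma>'"
      using I n_B c by (auto simp: wp_simps I_def agree_simps base_def less_Suc_eq)
  qed (rule n_B)
  then show ?thesis
  proof (rule wp_mono)
    fix u \<sigma>' assume *: "u \<le> (3 + 2) * n + 2 \<and> I n \<sigma>'"
    have "?C \<subseteq> {..<n}" using W by (auto simp: centers_def)
    with ex * show "u \<le> 5 * n + 2 \<and> agree {''i'', ''t''} {''isc''} \<sigma> \<sigma>' \<and>
      marks (arrs \<sigma>' ''isc'') ?C \<and> vars \<sigma>' ''t'' \<in> ?C"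
      by (auto simp: I_def marks_def)
  qed
qed

lemma wp_contract:
  assumes "base \<sigma>" and W: "W \<subseteq> {..<n} - {s}" and al: "arrs \<sigma> ''alive'' = al" "marks al W"
    and rt: "arrs \<sigma> ''root'' = rt" and isc: "arrs \<sigma> ''isc'' = isc" "marks isc C" 
    and t: "vars \<sigma> ''t'' = t"
    and con: "contraction ta he w m s t W C rt"
    and mrg: "\<forall>v<n. arrs \<sigma> ''mrg'' v = 0"
  shows "wp contract (\<lambda>u \<sigma>'. u \<le> 13 * m + 3 \<and>
    agree {''i'', ''u'', ''v'', ''q''} {''nt'', ''nh'', ''nc'', ''mrg''} \<sigma> \<sigma>' \<and>
    (\<exists>mg. contraction.contracted_upto ta he w s t W C rt m (vars \<sigma>' ''q'')
      (arrs \<sigma>' ''nt'') (arrs \<sigma>' ''nh'') (arrs \<sigma>' ''nc'') mg)) \<sigma>"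
proof -
  interpret contraction ta he w m s t W C rt by (rule con)
  \<comment> \<open>The program clears the merge array only below \<open>n\<close>; beyond that the
    abstract table is set to zero.\<close>
  define mg :: "(nat \<Rightarrow> nat) \<Rightarrow> nat \<Rightarrow> nat" where "mg a v = (if v < n then a v else 0)" for a v
  define I where "I j \<sigma>' \<longleftrightarrow> agree {''i'', ''u'', ''v'', ''q''} {''nt'', ''nh'', ''nc'', ''mrg''} \<sigma> \<sigma>' \<and>
    base \<sigma>' \<and> arrs \<sigma>' ''alive'' = al \<and> arrs \<sigma>' ''root'' = rt \<and> arrs \<sigma>' ''isc'' = isc \<and>
    vars \<sigma>' ''t'' = t \<and>
    contracted_upto j (vars \<sigma>' ''q'') (arrs \<sigma>' ''nt'') (arrs \<sigma>' ''nh'') (arrs \<sigma>' ''nc'') (mg (arrs \<sigma>' ''mrg''))" for j \<sigma>'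
  have mg0: "mg (arrs \<sigma> ''mrg'') = (\<lambda>_. 0)"
    using mrg by (auto simp: mg_def)
  have "wp (For ''i'' (Var ''m'') contract_arc) (\<lambda>u \<sigma>'. u \<le> (11 + 2) * m + 2 \<and> I m \<sigma>')
      (\<sigma>\<lparr>vars := (vars \<sigma>)(''q'' := 0)\<rparr>)"
  proof (rule wp_For)
    show "I 0 (\<sigma>\<lparr>vars := (vars \<sigma>)(''q'' := 0)\<rparr>\<lparr>vars := (vars (\<sigma>\<lparr>vars := (vars \<sigma>)(''q'' := 0)\<rparr>))(''i'' := 0)\<rparr>)"
      using assms by (simp add: I_def agree_simps base_def mg0 contracted_upto_0)
    show "aval (Var ''m'') \<sigma>' = m" if "I j \<sigma>'" for j \<sigma>'
      using that by (simp add: I_def base_def)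
    fix j \<sigma>' assume I: "I j \<sigma>'" "j < m" "vars \<sigma>' ''i'' = j"
    let ?u = "ta j" and ?v = "he j" and ?q = "vars \<sigma>' ''q''"
    let ?nt = "arrs \<sigma>' ''nt''" and ?nh = "arrs \<sigma>' ''nh''" and ?nc = "arrs \<sigma>' ''nc''"
    let ?mrg = "arrs \<sigma>' ''mrg''"
    have N: "contracted_upto j ?q ?nt ?nh ?nc (mg ?mrg)" using I(1) by (simp add: I_def)
    then have q: "?q \<le> j" by (simp add: contracted_upto_def)
    have uv: "?u < n" "?v < n" "?u \<le> B" "?v \<le> B" using ta_less he_less I(2) n_B by (auto intro: less_imp_le less_le_trans)
    have b: "t \<le> B" "s \<le> B" "w j \<le> B" "Suc ?q \<le> B"
      using t_center C_subset W n_B s_less w_le[OF I(2)] q I(2) m_B by auto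
    have al': "al ?u = of_bool (?u \<in> W)" "al ?v = of_bool (?v \<in> W)"
      "isc ?u = of_bool (?u \<in> C)" "isc ?v = of_bool (?v \<in> C)"
      using marksD[OF al(2)] marksD[OF isc(2)] uv by auto
    have mgv: "mg ?mrg ?v = ?mrg ?v" using uv by (simp add: mg_def)
    have mg_upd: "mg (?mrg(?v := a)) = (mg ?mrg)(?v := a)" for a
      using uv by (auto simp: mg_def)
    have skip: "wp contract_arc (\<lambda>u \<sigma>''. u \<le> 11 \<and> vars \<sigma>'' ''i'' = j \<and> I (Suc j) (\<sigma>''\<lparr>vars := (vars \<sigma>'')(''i'' := Suc j)\<rparr>)) \<sigma>'"
      if "\<not> kept j"
      using contracted_upto_skip[OF N that] that I uv al'
      by (auto simp: contract_arc_def wp_simps I_def agree_simps base_def kept_def inner_def)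
    show "wp contract_arc (\<lambda>u \<sigma>''. u \<le> 11 \<and> vars \<sigma>'' ''i'' = j \<and> I (Suc j) (\<sigma>''\<lparr>vars := (vars \<sigma>'')(''i'' := Suc j)\<rparr>)) \<sigma>'"
    proof (cases "kept j")
      case kept: True
      then have vW: "?v \<in> W" by (simp add: kept_def)
      show ?thesis
      proof (cases "inner j")
        case True
        then have *: "?u \<in> W" "rt ?u = rt ?v" "?u \<notin> C" "ctail j = ?u"
          using kept by (auto simp: inner_def kept_def ctail_def)
        show ?thesis
          using contracted_upto_append[OF N I(2) kept disjI1[OF True] refl] True * vW I uv b al'
          by (cases "?v \<in> C") (auto simp: contract_arc_def wp_simps I_def agree_simps base_def chead_def)
      next
        case False
        then have *: "\<not> (?u \<in> W \<and> rt ?u = rt ?v)" "?v \<notin> C" "ctail j = s" "chead j = ?v"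
          using kept vW by (auto simp: inner_def kept_def ctail_def chead_def)
        show ?thesis
        proof (cases "?mrg ?v = 0")
          case True
          then have "mg ?mrg ?v = 0" using mgv by simp
          then show ?thesis
            using contracted_upto_append[OF N I(2) kept disjI2 refl] False True * vW I uv b al' mgv
            by (auto simp: contract_arc_def wp_simps I_def agree_simps base_def mg_upd)
        next
          case mrg: False
          then have "0 < mg ?mrg ?v" using mgv by simp
          moreover have "mg ?mrg ?v \<le> ?q"
            using N unfolding contracted_upto_def by blast
          ultimately have pos: "0 < mg ?mrg ?v" "mg ?mrg ?v \<le> ?q" .
          \<comment> \<open>The capacity so far comes from arcs below \<open>j\<close>, so adding
            \<open>w j\<close> still stays within the total weight.\<close>
          have "?nc (mg ?mrg ?v - 1) \<le> (\<Sum>e<j. w e)"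
            by (rule contracted_capacity[OF N]) (use pos in simp)
          also have "(\<Sum>e<j. w e) + w j \<le> (\<Sum>e<m. w e)"
            using I(2) by (metis Suc_leI finite_lessThan lessThan_subset_iff sum.lessThan_Suc sum_mono2 zero_le)
          finally have "?nc (?mrg ?v - 1) + w j \<le> B"
            using w_B mgv by simp
          moreover have "?mrg ?v - 1 \<le> B" using pos mgv b by simp
          ultimately show ?thesis
            using contracted_upto_merge[OF N kept False pos(1) refl] mrg * vW I uv b al' mgv
            by (auto simp: contract_arc_def wp_simps I_def agree_simps base_def)
        qed
      qed
    qed (rule skip)
  qed (use m_B in simp)
  then have "wp contract (\<lambda>u \<sigma>'. u \<le> 13 * m + 3 \<and> I m \<sigma>') \<sigma>"
    unfolding contract_def wp_Seq by (subst wp_Assign) (auto elim!: wp_mono)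
  then show ?thesis by (rule wp_mono) (auto simp: I_def)
qed

end

text \<open>
  \<open>acc\<close> collects, at the root of each component, the weight of the arcs entering the sink side inside that
  component; \<open>br\<close> is the root of the component with the best new cut, and \<open>imp\<close> tells whether there is one.
  Arcs missing from the residual graph are represented by loops at \<open>s\<close>.
\<close>

definition flow_call :: com where
  "flow_call = Max_Flow (Var ''n'') (Var ''q'') (Var ''s'') (Var ''t'') ''nt'' ''nh'' ''nc'' ''fl''"

definition residual_arcs :: com where
  "residual_arcs = For ''i'' (Var ''q'')
     (If (Less (Get ''fl'' (Var ''i'')) (Get ''nc'' (Var ''i'')))
        (Put ''src'' (Var ''i'') (Get ''nt'' (Var ''i'')) ;; Put ''dst'' (Var ''i'') (Get ''nh'' (Var ''i'')))
        (Put ''src'' (Var ''i'') (Var ''s'') ;; Put ''dst'' (Var ''i'') (Var ''s'')) ;;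
      If (Set ''fl'' (Var ''i''))
        (Put ''src'' (Plus (Var ''q'') (Var ''i'')) (Get ''nh'' (Var ''i'')) ;;
         Put ''dst'' (Plus (Var ''q'') (Var ''i'')) (Get ''nt'' (Var ''i'')))
        (Put ''src'' (Plus (Var ''q'') (Var ''i'')) (Var ''s'') ;;
         Put ''dst'' (Plus (Var ''q'') (Var ''i'')) (Var ''s''))) ;;
     Assign ''K'' (Plus (Var ''q'') (Var ''q''))"

definition mark_sinks :: com where
  "mark_sinks = For ''i'' (Var ''n'')
     (If (And (Set ''alive'' (Var ''i'')) (Not (And (Not (Set ''isc'' (Var ''i''))) (Set ''vis'' (Var ''i'')))))
        (Put ''inz'' (Var ''i'') (Num 1))
        (Put ''inz'' (Var ''i'') (Num 0)))"

definition weigh :: com where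
  "weigh = For ''i'' (Var ''m'')
     (Assign ''u'' (Get ''tail'' (Var ''i'')) ;; Assign ''v'' (Get ''head'' (Var ''i'')) ;;
      If (And (Set ''inz'' (Var ''v''))
              (Not (And (Set ''inz'' (Var ''u'')) (Eq (Get ''root'' (Var ''u'')) (Get ''root'' (Var ''v''))))))
        (Put ''acc'' (Get ''root'' (Var ''v''))
          (Plus (Get ''acc'' (Get ''root'' (Var ''v''))) (Get ''weight'' (Var ''i''))))
        Skip)"

definition select_best :: com where
  "select_best = Assign ''imp'' (Num 0) ;; For ''i'' (Var ''n'')
     (If (And (Set ''isc'' (Var ''i'')) (Less (Get ''acc'' (Get ''root'' (Var ''i''))) (Var ''best'')))
        (Assign ''best'' (Get ''acc'' (Get ''root'' (Var ''i''))) ;;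
         Assign ''br'' (Get ''root'' (Var ''i'')) ;; Assign ''imp'' (Num 1))
        Skip)"

definition record_cut :: com where
  "record_cut = For ''i'' (Var ''n'')
     (If (Less (Num 0) (Var ''imp''))
        (If (And (Set ''inz'' (Var ''i'')) (Eq (Get ''root'' (Var ''i'')) (Var ''br'')))
           (Put ''cut'' (Var ''i'') (Num 0))
           (Put ''cut'' (Var ''i'') (Num 1)))
        Skip)"

definition retire :: com where
  "retire = Assign ''flag'' (Num 0) ;; For ''i'' (Var ''n'')
     (If (Set ''isc'' (Var ''i''))
        (Put ''alive'' (Var ''i'') (Num 0))
        (If (Set ''alive'' (Var ''i'')) (Assign ''flag'' (Num 1)) Skip))"

lemma (in ram) wp_Max_Flow:
  assumes "N = read_network en em es et ta ha ca \<sigma>" "poly_network k N"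
    "\<And>i. i < aval em \<sigma> \<Longrightarrow> i \<le> B \<and> mf N i \<le> B"
    "Q (1 + net_verts N + length (net_arcs N) + tm N) (write_flow fa (aval em \<sigma>) (mf N) \<sigma>)"
  shows "wp (Max_Flow en em es et ta ha ca fa) Q \<sigma>"
  unfolding wp_def using exec.Max_Flow[OF assms(1,2)] assms(3,4) by blast

definition residual_rel ::
    "nat \<Rightarrow> (nat \<Rightarrow> nat) \<Rightarrow> (nat \<Rightarrow> nat) \<Rightarrow> (nat \<Rightarrow> nat) \<Rightarrow> (nat \<Rightarrow> nat) \<Rightarrow> (nat \<times> nat) set" where
  "residual_rel q nt nh nc f = {(nt i, nh i) | i. i < q \<and> f i < nc i} \<union> {(nh i, nt i) | i. i < q \<and> 0 < f i}"

context solver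
begin

section \<open>The maximum flow call on the contracted network\<close>

context
  fixes W C :: "nat set" and rt :: "nat \<Rightarrow> nat" and t :: nat
  assumes W: "W \<subseteq> {..<n} - {s}" and con: "contraction ta he w m s t W C rt"
begin

interpretation contraction ta he w m s t W C rt by (rule con)

lemma t_props: "t < n" "t \<noteq> s" "t \<le> B"
  using t_center C_subset W n_B by auto

text \<open>Legality of the subroutine call: the merging of arcs excludes parallel ones, and the
  total weight bounds the capacities.\<close>

lemma contracted_network:
  assumes N: "contracted_upto m q nt nh nc mg"
    and M: "M = \<lparr>net_verts = n, net_arcs = map (\<lambda>i. (nt i, nh i, nc i)) [0..<q], net_source = s, net_sink = t\<rparr>"
  shows "poly_network k M"
proof -
  have ends: "nt i < n" "nh i < n" "nt i \<noteq> nh i" if "i < q" for i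
    using contracted_ends[OF N that] W s_less by auto
  have inj: "i = j" if "i < q" "j < q" "nt i = nt j" "nh i = nh j" for i j
    using N that unfolding contracted_upto_def by blast
  have pos: "0 < nc i" if "i < q" for i
    using N that unfolding contracted_upto_def by blast
  have "digraph (net_graph M)"
    by unfold_locales (use ends inj in \<open>auto simp: M net_graph_def arc_to_ends_def\<close>)
  then show ?thesis
    using t_props s_less pos contracted_capacity[OF N] w_k
    by (auto simp: M poly_network_def net_cap_def intro: le_trans)
qed

text \<open>Transfers max-flow min-cut duality from real capacities to the integral arrays. The
  bound of the flow by the capacities ensures that the returned values fit into memory.\<close>

lemma contracted_max_flow:
  assumes N: "contracted_upto m q nt nh nc mg"
    and M: "M = \<lparr>net_verts = n, net_arcs = map (\<lambda>i. (nt i, nh i, nc i)) [0..<q], net_source = s, net_sink = t\<rparr>"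
    and f: "is_max_flow (net_graph M) (\<lambda>i. real (net_cap M i)) s t (\<lambda>i. real (f i))"
    and A: "A = (residual_rel q nt nh nc f)\<^sup>* `` {s}"
  shows "t \<notin> A" and "s \<in> U \<Longrightarrow> t \<notin> U \<Longrightarrow> ccut A \<le> ccut U" and "i < q \<Longrightarrow> f i \<le> nc i"
proof -
  interpret D: digraph "net_graph M"
    using contracted_network[OF N M] by (simp add: poly_network_def)
  let ?c = "\<lambda>i. real (net_cap M i)"
  have graph: "arcs (net_graph M) = {..<q}" "verts (net_graph M) = {..<n}"
    by (auto simp: net_graph_def M)
  have arc: "tail (net_graph M) i = nt i" "head (net_graph M) i = nh i" "net_cap M i = nc i" if "i < q" for i
    using that by (auto simp: net_graph_def net_cap_def M)
  have res: "residual (net_graph M) ?c (\<lambda>i. real (f i)) = residual_rel q nt nh nc f"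
    unfolding residual_def residual_rel_def graph by (auto simp: arc)
  show "t \<notin> A"
    using D.max_flow_sink_unreachable[OF f] t_props(2) by (simp add: A res)
  have cut: "(\<Sum>e | e \<in> arcs (net_graph M) \<and> tail (net_graph M) e \<in> U \<and> head (net_graph M) e \<notin> U. ?c e)
      = real (ccut U)" for U
  proof -
    have "(\<Sum>e | e \<in> arcs (net_graph M) \<and> tail (net_graph M) e \<in> U \<and> head (net_graph M) e \<notin> U. ?c e)
        = (\<Sum>i | i < q \<and> nt i \<in> U \<and> nh i \<notin> U. real (nc i))"
      by (rule sum.cong) (auto simp: graph arc)
    then show ?thesis
      using contracted_cut[OF N, of U] by (metis of_nat_sum)
  qed
  show "ccut A \<le> ccut U" if "s \<in> U" "t \<notin> U"
  proof -
    have "s \<in> verts (net_graph M)" "s \<noteq> t"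
        "A = (residual (net_graph M) ?c (\<lambda>i. real (f i)))\<^sup>* `` {s}"
      using t_props(2) s_less by (simp_all add: A res graph)
    from D.residual_reachable_min_cut[OF f this that] show ?thesis
      unfolding cut by simp
  qed
  show "f i \<le> nc i" if "i < q"
  proof -
    have "i \<in> arcs (net_graph M)" using that graph by simp
    then have "real (f i) \<le> ?c i"
      using f unfolding is_max_flow_def is_flow_def by blast
    then show ?thesis using arc that by simp
  qed
qed

lemma wp_flow_call:
  assumes "base \<sigma>" "vars \<sigma> ''t'' = t" "vars \<sigma> ''q'' = q" "arrs \<sigma> ''nt'' = nt" "arrs \<sigma> ''nh'' = nh" "arrs \<sigma> ''nc'' = nc"
    and N: "contracted_upto m q nt nh nc mg" and mf: "maxflow_subroutine k mf tm MF"
  shows "wp flow_call (\<lambda>u \<sigma>'. u \<le> 1 + n + m + MF m n \<and> agree {} {''fl''} \<sigma> \<sigma>' \<and>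
    (\<exists>A. A = (residual_rel q nt nh nc (arrs \<sigma>' ''fl''))\<^sup>* `` {s} \<and> t \<notin> A \<and>
      (\<forall>U. s \<in> U \<and> t \<notin> U \<longrightarrow> ccut A \<le> ccut U))) \<sigma>"
proof -
  define M where "M = \<lparr>net_verts = n, net_arcs = map (\<lambda>i. (nt i, nh i, nc i)) [0..<q], net_source = s, net_sink = t\<rparr>"
  have read: "M = read_network (Var ''n'') (Var ''q'') (Var ''s'') (Var ''t'') ''nt'' ''nh'' ''nc'' \<sigma>"
    using assms(1-6) by (simp add: M_def read_network_def base_def)
  have poly: "poly_network k M" by (rule contracted_network[OF N M_def])
  have q: "q \<le> m" using N by (simp add: contracted_upto_def)
  have f: "is_max_flow (net_graph M) (\<lambda>i. real (net_cap M i)) s t (\<lambda>i. real (mf M i))"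
    using mf poly unfolding maxflow_subroutine_def by (auto simp: M_def)
  have time: "tm M \<le> MF m n"
    using mf poly q unfolding maxflow_subroutine_def by (auto simp: M_def)
  show ?thesis
    unfolding flow_call_def
  proof (rule wp_Max_Flow[OF read poly], goal_cases)
    case (1 i)
    then have i: "i < q" using assms(3) by simp
    have "mf M i \<le> nc i" by (rule contracted_max_flow(3)[OF N M_def f refl i])
    moreover have "nc i \<le> B" using contracted_capacity[OF N i] w_B by simp
    ultimately show ?case using i q m_B by simp
  next
    case 2
    let ?\<sigma> = "write_flow ''fl'' (aval (Var ''q'') \<sigma>) (mf M) \<sigma>"
    have "residual_rel q nt nh nc (arrs ?\<sigma> ''fl'') = residual_rel q nt nh nc (mf M)"
      unfolding residual_rel_def using assms(3) by (auto simp: write_flow_def)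
    then show ?case
      using contracted_max_flow(1,2)[OF N M_def f refl] time q
      by (auto simp: M_def write_flow_def agree_simps)
  qed
qed

end

lemma wp_residual_arcs:
  assumes "base \<sigma>" "vars \<sigma> ''q'' = q" "arrs \<sigma> ''nt'' = nt" "arrs \<sigma> ''nh'' = nh" "arrs \<sigma> ''nc'' = nc" "arrs \<sigma> ''fl'' = f"
    and q: "q \<le> m" and ends: "\<And>i. i < q \<Longrightarrow> nt i < n \<and> nh i < n"
  shows "wp residual_arcs (\<lambda>u \<sigma>'. u \<le> 8 * q + 3 \<and> agree {''i'', ''K''} {''src'', ''dst''} \<sigma> \<sigma>' \<and>
    vars \<sigma>' ''K'' = 2 * q \<and> (\<forall>e<2 * q. arrs \<sigma>' ''src'' e < n \<and> arrs \<sigma>' ''dst'' e < n) \<and>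
    (search.arc_rel (2 * q) (arrs \<sigma>' ''src'') (arrs \<sigma>' ''dst''))\<^sup>* = (residual_rel q nt nh nc f)\<^sup>*) \<sigma>"
proof -
  define fwd where "fwd i = (if f i < nc i then (nt i, nh i) else (s, s))" for i
  define bwd where "bwd i = (if 0 < f i then (nh i, nt i) else (s, s))" for i
  define I where "I j \<sigma>' \<longleftrightarrow> agree {''i'', ''K''} {''src'', ''dst''} \<sigma> \<sigma>' \<and> base \<sigma>' \<and> vars \<sigma>' ''q'' = q \<and>
    arrs \<sigma>' ''nt'' = nt \<and> arrs \<sigma>' ''nh'' = nh \<and> arrs \<sigma>' ''nc'' = nc \<and> arrs \<sigma>' ''fl'' = f \<and>
    (\<forall>i<j. arrs \<sigma>' ''src'' i = fst (fwd i) \<and> arrs \<sigma>' ''dst'' i = snd (fwd i) \<and>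
      arrs \<sigma>' ''src'' (q + i) = fst (bwd i) \<and> arrs \<sigma>' ''dst'' (q + i) = snd (bwd i))" for j \<sigma>'
  have "wp residual_arcs (\<lambda>u \<sigma>'. u \<le> (6 + 2) * q + 3 \<and> I q \<sigma>' \<and> vars \<sigma>' ''K'' = 2 * q) \<sigma>"
    unfolding residual_arcs_def
  proof (rule wp_SeqI[OF wp_For[where I = I and N = q and a = 6]])
    show "I 0 (\<sigma>\<lparr>vars := (vars \<sigma>)(''i'' := 0)\<rparr>)"
      using assms by (simp add: I_def agree_simps base_def)
    show "aval (Var ''q'') \<sigma>' = q" if "I j \<sigma>'" for j \<sigma>'
      using that by (simp add: I_def)
    show "q \<le> B" using q m_B by simp
    show "wp (Assign ''K'' (Plus (Var ''q'') (Var ''q'')))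
        (\<lambda>v \<sigma>''. u + v \<le> (6 + 2) * q + 3 \<and> I q \<sigma>'' \<and> vars \<sigma>'' ''K'' = 2 * q) \<sigma>'"
      if "u \<le> (6 + 2) * q + 2 \<and> I q \<sigma>'" for u \<sigma>'
      using that q m_B by (simp add: wp_simps I_def agree_simps base_def)
    fix j \<sigma>' assume I: "I j \<sigma>'" "j < q" "vars \<sigma>' ''i'' = j"
    have b: "nt j \<le> B" "nh j \<le> B" "s \<le> B" "q + j \<le> B" "j \<le> B"
      using ends[OF I(2)] n_B s_less I(2) q m_B by auto
    show "wp (If (Less (Get ''fl'' (Var ''i'')) (Get ''nc'' (Var ''i'')))
        (Put ''src'' (Var ''i'') (Get ''nt'' (Var ''i'')) ;; Put ''dst'' (Var ''i'') (Get ''nh'' (Var ''i'')))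
        (Put ''src'' (Var ''i'') (Var ''s'') ;; Put ''dst'' (Var ''i'') (Var ''s'')) ;;
      If (Set ''fl'' (Var ''i''))
        (Put ''src'' (Plus (Var ''q'') (Var ''i'')) (Get ''nh'' (Var ''i'')) ;;
         Put ''dst'' (Plus (Var ''q'') (Var ''i'')) (Get ''nt'' (Var ''i'')))
        (Put ''src'' (Plus (Var ''q'') (Var ''i'')) (Var ''s'') ;;
         Put ''dst'' (Plus (Var ''q'') (Var ''i'')) (Var ''s'')))
      (\<lambda>u \<sigma>''. u \<le> 6 \<and> vars \<sigma>'' ''i'' = j \<and> I (Suc j) (\<sigma>''\<lparr>vars := (vars \<sigma>'')(''i'' := Suc j)\<rparr>)) \<sigma>'"
      using I b
      by (cases "f j < nc j"; cases "0 < f j")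
        (simp_all add: wp_simps I_def agree_simps base_def less_Suc_eq all_conj_distrib imp_conjL fwd_def bwd_def)
  qed
  then show ?thesis
  proof (rule wp_mono)
    fix u \<sigma>' assume *: "u \<le> (6 + 2) * q + 3 \<and> I q \<sigma>' \<and> vars \<sigma>' ''K'' = 2 * q"
    let ?src = "arrs \<sigma>' ''src''" and ?dst = "arrs \<sigma>' ''dst''"
    have arcs: "(?src i, ?dst i) = fwd i" "(?src (q + i), ?dst (q + i)) = bwd i" if "i < q" for i
      using * that by (auto simp: I_def)
    have split: "(\<exists>i<q. e = i \<or> e = q + i)" if "e < 2 * q" for e
      using that by (cases "e < q") (auto intro!: exI[of _ "e - q"])
    have fb: "fst (fwd i) < n \<and> snd (fwd i) < n \<and> fst (bwd i) < n \<and> snd (bwd i) < n" if "i < q" for i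
      using ends[OF that] s_less by (simp add: fwd_def bwd_def)
    have less: "\<forall>e<2 * q. ?src e < n \<and> ?dst e < n"
    proof (intro allI impI)
      fix e assume "e < 2 * q"
      then obtain i where "i < q" "e = i \<or> e = q + i" using split by blast
      then show "?src e < n \<and> ?dst e < n" using arcs[of i] fb[of i] by (metis fst_conv snd_conv)
    qed
    interpret S: search n "2 * q" s ?src ?dst
      using less s_less by unfold_locales auto
    let ?R = "residual_rel q nt nh nc f"
    have "S.arc_rel \<subseteq> ?R \<union> Id"
    proof
      fix x assume "x \<in> S.arc_rel"
      then obtain e where e: "e < 2 * q" "x = (?src e, ?dst e)" by (auto simp: S.arc_rel_def)
      then obtain i where i: "i < q" "e = i \<or> e = q + i" using split by blast
      then have "x = fwd i \<or> x = bwd i" using e arcs by auto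
      moreover have "fwd i \<in> ?R \<union> Id"
        unfolding fwd_def residual_rel_def using i(1) by (cases "f i < nc i") (simp, blast, simp)
      moreover have "bwd i \<in> ?R \<union> Id"
        unfolding bwd_def residual_rel_def using i(1) by (cases "0 < f i") (simp, blast, simp)
      ultimately show "x \<in> ?R \<union> Id" by auto
    qed
    moreover have "?R \<subseteq> S.arc_rel"
    proof
      fix x assume "x \<in> ?R"
      then consider i where "i < q" "f i < nc i" "x = (nt i, nh i)" | i where "i < q" "0 < f i" "x = (nh i, nt i)"
        unfolding residual_rel_def by blast
      then obtain i where i: "i < q" "x = fwd i \<or> x = bwd i"
        by cases (metis fwd_def, metis bwd_def)
      then have "x = (?src i, ?dst i) \<or> x = (?src (q + i), ?dst (q + i))" using arcs by metis
      moreover have "i < 2 * q" "q + i < 2 * q" using i(1) by auto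
      ultimately show "x \<in> S.arc_rel" unfolding S.arc_rel_def by blast
    qed
    ultimately have "S.arc_rel\<^sup>* = ?R\<^sup>*"
      by (metis (no_types, lifting) rtrancl_mono rtrancl_reflcl subset_antisym)
    then show "u \<le> 8 * q + 3 \<and> agree {''i'', ''K''} {''src'', ''dst''} \<sigma> \<sigma>' \<and>
      vars \<sigma>' ''K'' = 2 * q \<and> (\<forall>e<2 * q. ?src e < n \<and> ?dst e < n) \<and> S.arc_rel\<^sup>* = ?R\<^sup>*"
      using * less by (auto simp: I_def)
  qed
qed

lemma wp_mark_sinks:
  assumes "base \<sigma>" and al: "arrs \<sigma> ''alive'' = al" "marks al W" and isc: "arrs \<sigma> ''isc'' = isc" "marks isc C"
    and vis: "arrs \<sigma> ''vis'' = vis" "marks vis A" and CW: "C \<subseteq> W"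
  shows "wp mark_sinks (\<lambda>u \<sigma>'. u \<le> 4 * n + 2 \<and> agree {''i''} {''inz''} \<sigma> \<sigma>' \<and>
    marks (arrs \<sigma>' ''inz'') (C \<union> (W - A))) \<sigma>"
proof -
  define I where "I j \<sigma>' \<longleftrightarrow> agree {''i''} {''inz''} \<sigma> \<sigma>' \<and> base \<sigma>' \<and>
    arrs \<sigma>' ''alive'' = al \<and> arrs \<sigma>' ''isc'' = isc \<and> arrs \<sigma>' ''vis'' = vis \<and>
    (\<forall>v<j. arrs \<sigma>' ''inz'' v = of_bool (v \<in> C \<union> (W - A)))" for j \<sigma>'
  have "wp mark_sinks (\<lambda>u \<sigma>'. u \<le> (2 + 2) * n + 2 \<and> I n \<sigma>') \<sigma>"
    unfolding mark_sinks_def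
  proof (rule wp_For)
    show "I 0 (\<sigma>\<lparr>vars := (vars \<sigma>)(''i'' := 0)\<rparr>)"
      using assms by (simp add: I_def agree_simps base_def)
    show "aval (Var ''n'') \<sigma>' = n" if "I j \<sigma>'" for j \<sigma>'
      using that by (simp add: I_def base_def)
    fix j \<sigma>' assume I: "I j \<sigma>'" "j < n" "vars \<sigma>' ''i'' = j"
    have c: "(0 < al j \<and> \<not> (isc j = 0 \<and> 0 < vis j)) \<longleftrightarrow> j \<in> C \<union> (W - A)"
      using marksD[OF al(2) I(2)] marksD[OF isc(2) I(2)] marksD[OF vis(2) I(2)] CW by auto
    show "wp (If (And (Set ''alive'' (Var ''i'')) (Not (And (Not (Set ''isc'' (Var ''i''))) (Set ''vis'' (Var ''i'')))))
        (Put ''inz'' (Var ''i'') (Num 1))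
        (Put ''inz'' (Var ''i'') (Num 0)))
      (\<lambda>u \<sigma>''. u \<le> 2 \<and> vars \<sigma>'' ''i'' = j \<and> I (Suc j) (\<sigma>''\<lparr>vars := (vars \<sigma>'')(''i'' := Suc j)\<rparr>)) \<sigma>'"
      using I n_B c by (auto simp: wp_simps I_def agree_simps base_def less_Suc_eq)
  qed (rule n_B)
  then show ?thesis by (rule wp_mono) (auto simp: I_def marks_def)
qed

lemma wp_weigh:
  assumes "base \<sigma>" and inz: "arrs \<sigma> ''inz'' = inz" "marks inz Z" and rt: "arrs \<sigma> ''root'' = rt"
    and Z: "\<And>v. v \<in> Z \<Longrightarrow> rt v < n" and acc: "\<forall>v<n. arrs \<sigma> ''acc'' v = 0"
  shows "wp weigh (\<lambda>u \<sigma>'. u \<le> 6 * m + 2 \<and> agree {''i'', ''u'', ''v''} {''acc''} \<sigma> \<sigma>' \<and>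
    (\<forall>r<n. arrs \<sigma>' ''acc'' r = cut_into ta he w m {v \<in> Z. rt v = r})) \<sigma>"
proof -
  define enters where "enters r e \<longleftrightarrow> he e \<in> Z \<and> rt (he e) = r \<and> \<not> (ta e \<in> Z \<and> rt (ta e) = r)" for r e
  define I where "I j \<sigma>' \<longleftrightarrow> agree {''i'', ''u'', ''v''} {''acc''} \<sigma> \<sigma>' \<and> base \<sigma>' \<and>
    arrs \<sigma>' ''inz'' = inz \<and> arrs \<sigma>' ''root'' = rt \<and>
    (\<forall>r<n. arrs \<sigma>' ''acc'' r = (\<Sum>e<j. if enters r e then w e else 0))" for j \<sigma>'
  have "wp weigh (\<lambda>u \<sigma>'. u \<le> (4 + 2) * m + 2 \<and> I m \<sigma>') \<sigma>"
    unfolding weigh_def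
  proof (rule wp_For)
    show "I 0 (\<sigma>\<lparr>vars := (vars \<sigma>)(''i'' := 0)\<rparr>)"
      using assms by (simp add: I_def agree_simps base_def)
    show "aval (Var ''m'') \<sigma>' = m" if "I j \<sigma>'" for j \<sigma>'
      using that by (simp add: I_def base_def)
    show "m \<le> B" using m_B by simp
    fix j \<sigma>' assume I: "I j \<sigma>'" "j < m" "vars \<sigma>' ''i'' = j"
    let ?u = "ta j" and ?v = "he j"
    have uv: "?u < n" "?v < n" "?u \<le> B" "?v \<le> B" using ta_less[OF I(2)] he_less[OF I(2)] n_B by auto
    have z: "inz ?u = of_bool (?u \<in> Z)" "inz ?v = of_bool (?v \<in> Z)"
      using marksD[OF inz(2)] uv by auto
    have "(\<Sum>e<j. if enters r e then w e else 0) + w j \<le> B" for r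
    proof -
      have "(\<Sum>e<j. if enters r e then w e else 0) + w j \<le> (\<Sum>e<Suc j. w e)"
        by (simp add: sum_mono)
      also have "\<dots> \<le> (\<Sum>e<m. w e)"
        using I(2) by (intro sum_mono2) auto
      finally show ?thesis using w_B by simp
    qed
    moreover have "?v \<in> Z \<Longrightarrow> rt ?v < n \<and> rt ?v \<le> B" using Z n_B by force
    ultimately show "wp (Assign ''u'' (Get ''tail'' (Var ''i'')) ;; Assign ''v'' (Get ''head'' (Var ''i'')) ;;
      If (And (Set ''inz'' (Var ''v''))
              (Not (And (Set ''inz'' (Var ''u'')) (Eq (Get ''root'' (Var ''u'')) (Get ''root'' (Var ''v''))))))
        (Put ''acc'' (Get ''root'' (Var ''v''))
          (Plus (Get ''acc'' (Get ''root'' (Var ''v''))) (Get ''weight'' (Var ''i''))))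
        Skip)
      (\<lambda>u \<sigma>''. u \<le> 4 \<and> vars \<sigma>'' ''i'' = j \<and> I (Suc j) (\<sigma>''\<lparr>vars := (vars \<sigma>'')(''i'' := Suc j)\<rparr>)) \<sigma>'"
      using I uv z
      by (cases "?v \<in> Z"; cases "?u \<in> Z"; cases "rt ?u = rt ?v")
        (auto simp: wp_simps I_def agree_simps base_def enters_def)
  qed
  moreover have "(\<Sum>e<m. if enters r e then w e else 0) = cut_into ta he w m {v \<in> Z. rt v = r}" for r
    unfolding cut_into_def by (rule sum.cong) (auto simp: enters_def)
  ultimately show ?thesis by (elim wp_mono) (auto simp: I_def)
qed

lemma wp_select_best:
  assumes "base \<sigma>" and isc: "arrs \<sigma> ''isc'' = isc" "marks isc C" and rt: "arrs \<sigma> ''root'' = rt"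
    and acc: "arrs \<sigma> ''acc'' = acc" and C: "\<And>c. c \<in> C \<Longrightarrow> rt c < n \<and> acc (rt c) \<le> B"
    and best: "vars \<sigma> ''best'' = b"
  shows "wp select_best (\<lambda>u \<sigma>'. u \<le> 6 * n + 3 \<and> agree {''i'', ''imp'', ''best'', ''br''} {} \<sigma> \<sigma>' \<and>
    (vars \<sigma>' ''imp'' = 0 \<and> vars \<sigma>' ''best'' = b \<or>
     0 < vars \<sigma>' ''imp'' \<and> (\<exists>c \<in> C. vars \<sigma>' ''br'' = rt c \<and> vars \<sigma>' ''best'' = acc (rt c))) \<and>
    vars \<sigma>' ''best'' \<le> b \<and> (\<forall>c \<in> C. c < n \<longrightarrow> vars \<sigma>' ''best'' \<le> acc (rt c))) \<sigma>"
proof -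
  define I where "I j \<sigma>' \<longleftrightarrow> agree {''i'', ''imp'', ''best'', ''br''} {} \<sigma> \<sigma>' \<and> base \<sigma>' \<and>
    arrs \<sigma>' ''isc'' = isc \<and> arrs \<sigma>' ''root'' = rt \<and> arrs \<sigma>' ''acc'' = acc \<and>
    (vars \<sigma>' ''imp'' = 0 \<and> vars \<sigma>' ''best'' = b \<or>
     0 < vars \<sigma>' ''imp'' \<and> (\<exists>c \<in> C. vars \<sigma>' ''br'' = rt c \<and> vars \<sigma>' ''best'' = acc (rt c))) \<and>
    vars \<sigma>' ''best'' \<le> b \<and> (\<forall>c \<in> C. c < j \<longrightarrow> vars \<sigma>' ''best'' \<le> acc (rt c))" for j \<sigma>'
  have "wp (For ''i'' (Var ''n'') 
     (If (And (Set ''isc'' (Var ''i'')) (Less (Get ''acc'' (Get ''root'' (Var ''i''))) (Var ''best'')))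
        (Assign ''best'' (Get ''acc'' (Get ''root'' (Var ''i''))) ;;
         Assign ''br'' (Get ''root'' (Var ''i'')) ;; Assign ''imp'' (Num 1))
        Skip)) (\<lambda>u \<sigma>'. u \<le> (4 + 2) * n + 2 \<and> I n \<sigma>') (\<sigma>\<lparr>vars := (vars \<sigma>)(''imp'' := 0)\<rparr>)"
  proof (rule wp_For)
    show "I 0 (\<sigma>\<lparr>vars := (vars \<sigma>)(''imp'' := 0)\<rparr>\<lparr>vars := (vars (\<sigma>\<lparr>vars := (vars \<sigma>)(''imp'' := 0)\<rparr>))(''i'' := 0)\<rparr>)"
      using assms by (simp add: I_def agree_simps base_def)
    show "aval (Var ''n'') \<sigma>' = n" if "I j \<sigma>'" for j \<sigma>'
      using that by (simp add: I_def base_def)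
    fix j \<sigma>' assume I: "I j \<sigma>'" "j < n" "vars \<sigma>' ''i'' = j"
    have c: "isc j = of_bool (j \<in> C)" using marksD[OF isc(2) I(2)] .
    have b: "rt j \<le> B \<and> acc (rt j) \<le> B" if "j \<in> C" using C[OF that] n_B by auto
    show "wp (If (And (Set ''isc'' (Var ''i'')) (Less (Get ''acc'' (Get ''root'' (Var ''i''))) (Var ''best'')))
        (Assign ''best'' (Get ''acc'' (Get ''root'' (Var ''i''))) ;;
         Assign ''br'' (Get ''root'' (Var ''i'')) ;; Assign ''imp'' (Num 1))
        Skip)
      (\<lambda>u \<sigma>''. u \<le> 4 \<and> vars \<sigma>'' ''i'' = j \<and> I (Suc j) (\<sigma>''\<lparr>vars := (vars \<sigma>'')(''i'' := Suc j)\<rparr>)) \<sigma>'"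
    proof (cases "j \<in> C \<and> acc (rt j) < vars \<sigma>' ''best''")
      case True
      then show ?thesis
        using I b c n_B s_less by (fastforce simp: wp_simps I_def agree_simps base_def less_Suc_eq)
    next
      case False
      then show ?thesis
        using I c by (auto simp: wp_simps I_def agree_simps base_def less_Suc_eq)
    qed
  qed (rule n_B)
  then have "wp select_best (\<lambda>u \<sigma>'. u \<le> (4 + 2) * n + 3 \<and> I n \<sigma>') \<sigma>"
    unfolding select_best_def wp_Seq by (subst wp_Assign) (auto elim!: wp_mono)
  then show ?thesis by (rule wp_mono) (simp add: I_def)
qed

lemma wp_record_cut:
  assumes "base \<sigma>" and inz: "arrs \<sigma> ''inz'' = inz" "marks inz Z" and rt: "arrs \<sigma> ''root'' = rt"
    and v: "vars \<sigma> ''imp'' = imp" "vars \<sigma> ''br'' = br"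
  shows "wp record_cut (\<lambda>u \<sigma>'. u \<le> 5 * n + 2 \<and> agree {''i''} {''cut''} \<sigma> \<sigma>' \<and>
    (\<forall>v<n. arrs \<sigma>' ''cut'' v = (if 0 < imp then of_bool (v \<notin> Z \<or> rt v \<noteq> br) else arrs \<sigma> ''cut'' v))) \<sigma>"
proof -
  define I where "I j \<sigma>' \<longleftrightarrow> agree {''i''} {''cut''} \<sigma> \<sigma>' \<and> base \<sigma>' \<and>
    arrs \<sigma>' ''inz'' = inz \<and> arrs \<sigma>' ''root'' = rt \<and> vars \<sigma>' ''imp'' = imp \<and> vars \<sigma>' ''br'' = br \<and>
    (\<forall>v. arrs \<sigma>' ''cut'' v = (if v < j \<and> 0 < imp then of_bool (v \<notin> Z \<or> rt v \<noteq> br) else arrs \<sigma> ''cut'' v))" for j \<sigma>'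
  have "wp record_cut (\<lambda>u \<sigma>'. u \<le> (3 + 2) * n + 2 \<and> I n \<sigma>') \<sigma>"
    unfolding record_cut_def
  proof (rule wp_For)
    show "I 0 (\<sigma>\<lparr>vars := (vars \<sigma>)(''i'' := 0)\<rparr>)"
      using assms by (simp add: I_def agree_simps base_def)
    show "aval (Var ''n'') \<sigma>' = n" if "I j \<sigma>'" for j \<sigma>'
      using that by (simp add: I_def base_def)
    fix j \<sigma>' assume I: "I j \<sigma>'" "j < n" "vars \<sigma>' ''i'' = j"
    have c: "inz j = of_bool (j \<in> Z)" using marksD[OF inz(2) I(2)] .
    show "wp (If (Less (Num 0) (Var ''imp''))
        (If (And (Set ''inz'' (Var ''i'')) (Eq (Get ''root'' (Var ''i'')) (Var ''br'')))
           (Put ''cut'' (Var ''i'') (Num 0))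
           (Put ''cut'' (Var ''i'') (Num 1)))
        Skip)
      (\<lambda>u \<sigma>''. u \<le> 3 \<and> vars \<sigma>'' ''i'' = j \<and> I (Suc j) (\<sigma>''\<lparr>vars := (vars \<sigma>'')(''i'' := Suc j)\<rparr>)) \<sigma>'"
      using I n_B c by (auto simp: wp_simps I_def agree_simps base_def less_Suc_eq)
  qed (rule n_B)
  then show ?thesis by (rule wp_mono) (auto simp: I_def)
qed

lemma wp_retire:
  assumes "base \<sigma>" and al: "marks (arrs \<sigma> ''alive'') W" and isc: "arrs \<sigma> ''isc'' = isc" "marks isc C"
    and W: "W \<subseteq> {..<n}"
  shows "wp retire (\<lambda>u \<sigma>'. u \<le> 5 * n + 3 \<and> agree {''i'', ''flag''} {''alive''} \<sigma> \<sigma>' \<and>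
    marks (arrs \<sigma>' ''alive'') (W - C) \<and> (0 < vars \<sigma>' ''flag'' \<longleftrightarrow> W - C \<noteq> {})) \<sigma>"
proof -
  define I where "I j \<sigma>' \<longleftrightarrow> agree {''i'', ''flag''} {''alive''} \<sigma> \<sigma>' \<and> base \<sigma>' \<and> arrs \<sigma>' ''isc'' = isc \<and>
    (\<forall>v<n. arrs \<sigma>' ''alive'' v = of_bool (v \<in> W \<and> \<not> (v < j \<and> v \<in> C))) \<and>
    (0 < vars \<sigma>' ''flag'' \<longleftrightarrow> (\<exists>v<j. v \<in> W - C))" for j \<sigma>'
  have "wp (For ''i'' (Var ''n'')
     (If (Set ''isc'' (Var ''i''))
        (Put ''alive'' (Var ''i'') (Num 0))
        (If (Set ''alive'' (Var ''i'')) (Assign ''flag'' (Num 1)) Skip)))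
    (\<lambda>u \<sigma>'. u \<le> (3 + 2) * n + 2 \<and> I n \<sigma>') (\<sigma>\<lparr>vars := (vars \<sigma>)(''flag'' := 0)\<rparr>)"
  proof (rule wp_For)
    show "I 0 (\<sigma>\<lparr>vars := (vars \<sigma>)(''flag'' := 0)\<rparr>\<lparr>vars := (vars (\<sigma>\<lparr>vars := (vars \<sigma>)(''flag'' := 0)\<rparr>))(''i'' := 0)\<rparr>)"
      using assms by (simp add: I_def agree_simps base_def marks_def)
    show "aval (Var ''n'') \<sigma>' = n" if "I j \<sigma>'" for j \<sigma>'
      using that by (simp add: I_def base_def)
    fix j \<sigma>' assume I: "I j \<sigma>'" "j < n" "vars \<sigma>' ''i'' = j"
    have c: "isc j = of_bool (j \<in> C)" using marksD[OF isc(2) I(2)] .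
    show "wp (If (Set ''isc'' (Var ''i''))
        (Put ''alive'' (Var ''i'') (Num 0))
        (If (Set ''alive'' (Var ''i'')) (Assign ''flag'' (Num 1)) Skip))
      (\<lambda>u \<sigma>''. u \<le> 3 \<and> vars \<sigma>'' ''i'' = j \<and> I (Suc j) (\<sigma>''\<lparr>vars := (vars \<sigma>'')(''i'' := Suc j)\<rparr>)) \<sigma>'"
      using I n_B c s_less
      by (cases "j \<in> C"; cases "j \<in> W") (auto simp: wp_simps I_def agree_simps base_def less_Suc_eq)
  qed (rule n_B)
  then have "wp retire (\<lambda>u \<sigma>'. u \<le> (3 + 2) * n + 3 \<and> I n \<sigma>') \<sigma>"
    unfolding retire_def wp_Seq by (subst wp_Assign) (auto elim!: wp_mono)
  then show ?thesis
    by (rule wp_mono) (use W in \<open>auto simp: I_def marks_def\<close>)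
qed

end

definition one_round :: com where
  "one_round = reset ;; sizes ;; roots ;; mark_centers ;; contract ;; flow_call ;; residual_arcs ;;
     bfs ;; mark_sinks ;; weigh ;; select_best ;; record_cut ;; retire"

lemma (in ram) wpE:
  assumes "wp c Q \<sigma>"
  obtains u \<sigma>' where "exec B k mf tm c \<sigma> u \<sigma>'" "Q u \<sigma>'"
  using assms unfolding wp_def by blast

context solver
begin

abbreviation into :: "nat set \<Rightarrow> nat" where
  "into \<equiv> cut_into ta he w m"

text \<open>For a set avoiding the root, having at most one vertex with parent outside means being a
  connected piece of the tree.\<close>

definition tree_connected :: "nat set \<Rightarrow> bool" where
  "tree_connected X \<longleftrightarrow> (\<forall>u \<in> X. \<forall>v \<in> X. par u \<notin> X \<longrightarrow> par v \<notin> X \<longrightarrow> u = v)"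

text \<open>The recorded cut is stored as its source side, the complement of \<open>Y\<close>.\<close>

definition cut_recorded :: "state \<Rightarrow> bool" where
  "cut_recorded \<sigma> \<longleftrightarrow> (\<exists>Y. Y \<noteq> {} \<and> Y \<subset> {..<n} \<and> vars \<sigma> ''best'' = into Y \<and>
     marks (arrs \<sigma> ''cut'') ({..<n} - Y))"

definition alive_inv :: "nat set \<Rightarrow> state \<Rightarrow> bool" where
  "alive_inv W \<sigma> \<longleftrightarrow> base \<sigma> \<and> W \<subseteq> {..<n} - {s} \<and> marks (arrs \<sigma> ''alive'') W \<and> cut_recorded \<sigma>"

lemma into_le: "into X \<le> B"
proof -
  have "into X \<le> (\<Sum>e<m. w e)"
    unfolding cut_into_def by (rule sum_mono) simp
  then show ?thesis using w_B by simp
qed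

text \<open>The last conclusion speaks of all connected \<open>X\<close>, as the program does not
  know the minimum cut: a set without a center survives into the next round, and one containing a
  center is matched by the best cut found.\<close>

lemma wp_one_round:
  assumes inv: "alive_inv W \<sigma>" and ne: "W \<noteq> {}" and mf: "maxflow_subroutine k mf tm MF"
  shows "wp one_round (\<lambda>u \<sigma>'. u \<le> 60 * (n + m) + 40 + MF m n \<and>
    (\<exists>W'. alive_inv W' \<sigma>' \<and> (0 < vars \<sigma>' ''flag'' \<longleftrightarrow> W' \<noteq> {}) \<and>
      (\<forall>r \<in> W'. par r \<notin> W' \<longrightarrow> (\<exists>r0 \<in> W. par r0 \<notin> W \<and> 2 * csize W' r \<le> csize W r0)) \<and>
      vars \<sigma>' ''best'' \<le> vars \<sigma> ''best'' \<and>
      (\<forall>X. X \<subseteq> W \<and> tree_connected X \<longrightarrow> X \<subseteq> W' \<or> vars \<sigma>' ''best'' \<le> into X))) \<sigma>"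
proof -
  have b0: "base \<sigma>" and W: "W \<subseteq> {..<n} - {s}" and al: "marks (arrs \<sigma> ''alive'') W"
    and cut: "cut_recorded \<sigma>"
    using inv by (auto simp: alive_inv_def)
  have Wn: "W \<subseteq> {..<n}" using W by auto
  obtain u1 \<sigma>1 where e1: "exec B k mf tm reset \<sigma> u1 \<sigma>1" and u1: "u1 \<le> 5 * n + 2"
    and a1: "agree {''i''} {''size'', ''mrg'', ''acc''} \<sigma> \<sigma>1"
    and r1: "\<forall>v<n. arrs \<sigma>1 ''size'' v = 1 \<and> arrs \<sigma>1 ''mrg'' v = 0 \<and> arrs \<sigma>1 ''acc'' v = 0"
    using wpE[OF wp_reset[OF b0]] by metis
  have b1: "base \<sigma>1" by (rule base_agree[OF b0 a1]) auto
  have al1: "marks (arrs \<sigma>1 ''alive'') W" using al by (simp add: agree_arrs[OF a1])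
  obtain u2 \<sigma>2 where e2: "exec B k mf tm sizes \<sigma>1 u2 \<sigma>2" and u2: "u2 \<le> 5 * n + 2"
    and a2: "agree {''i'', ''v''} {''size''} \<sigma>1 \<sigma>2"
    and r2: "\<And>v. v < n \<Longrightarrow> arrs \<sigma>2 ''size'' v = csize W v"
    using wpE[OF wp_sizes[OF b1 W refl al1]] r1 by (metis (no_types, lifting))
  have b2: "base \<sigma>2" by (rule base_agree[OF b1 a2]) auto
  have al2: "marks (arrs \<sigma>2 ''alive'') W" using al1 by (simp add: agree_arrs[OF a2])
  obtain u3 \<sigma>3 where e3: "exec B k mf tm roots \<sigma>2 u3 \<sigma>3" and u3: "u3 \<le> 8 * n + 2"
    and a3: "agree {''i'', ''v''} {''root'', ''cen''} \<sigma>2 \<sigma>3"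
    and R: "roots_upto W n (arrs \<sigma>3 ''root'') (arrs \<sigma>3 ''cen'')"
    using wpE[OF wp_roots[OF b2 W refl al2 refl r2]] by metis
  have b3: "base \<sigma>3" by (rule base_agree[OF b2 a3]) auto
  have al3: "marks (arrs \<sigma>3 ''alive'') W" using al2 by (simp add: agree_arrs[OF a3])
  define rt where "rt = arrs \<sigma>3 ''root''"
  define cen where "cen = arrs \<sigma>3 ''cen''"
  define C where "C = centers W rt cen"
  note R = R[folded rt_def cen_def]
  have CW: "C \<subseteq> W" by (auto simp: C_def centers_def)
  have "C \<noteq> {}" using ne cen_in_centers[OF W R] by (auto simp: C_def)
  then obtain u4 \<sigma>4 where e4: "exec B k mf tm mark_centers \<sigma>3 u4 \<sigma>4" and u4: "u4 \<le> 5 * n + 2"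
    and a4: "agree {''i'', ''t''} {''isc''} \<sigma>3 \<sigma>4"
    and isc4: "marks (arrs \<sigma>4 ''isc'') C" and tC: "vars \<sigma>4 ''t'' \<in> C"
    using wpE[OF wp_mark_centers[OF b3 W refl al3 rt_def[symmetric] cen_def[symmetric]]] unfolding C_def
    by metis
  have b4: "base \<sigma>4" by (rule base_agree[OF b3 a4]) auto
  have al4: "marks (arrs \<sigma>4 ''alive'') W" using al3 by (simp add: agree_arrs[OF a4])
  have rt4: "arrs \<sigma>4 ''root'' = rt" by (simp add: agree_arrs[OF a4] rt_def)
  define t where "t = vars \<sigma>4 ''t''"
  have "c = c'" if "c \<in> C" "c' \<in> C" "rt c = rt c'" for c c'
    using that unfolding C_def centers_def by (metis (mono_tags, lifting) mem_Collect_eq)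
  then have con: "contraction ta he w m s t W C rt"
    using W CW tC loopfree nomulti w_pos by unfold_locales (auto simp: t_def)
  interpret contraction ta he w m s t W C rt by (rule con)
  have mrg4: "\<forall>v<n. arrs \<sigma>4 ''mrg'' v = 0"
    using r1 by (simp add: agree_arrs[OF a4] agree_arrs[OF a3] agree_arrs[OF a2])
  obtain u5 \<sigma>5 where e5: "exec B k mf tm contract \<sigma>4 u5 \<sigma>5" and u5: "u5 \<le> 13 * m + 3"
    and a5: "agree {''i'', ''u'', ''v'', ''q''} {''nt'', ''nh'', ''nc'', ''mrg''} \<sigma>4 \<sigma>5"
    and r5: "\<exists>mg. contracted_upto m (vars \<sigma>5 ''q'') (arrs \<sigma>5 ''nt'') (arrs \<sigma>5 ''nh'') (arrs \<sigma>5 ''nc'') mg"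
    using wpE[OF wp_contract[OF b4 W refl al4 rt4 refl isc4 t_def[symmetric] con mrg4]] by metis
  have b5: "base \<sigma>5" by (rule base_agree[OF b4 a5]) auto
  have t5: "vars \<sigma>5 ''t'' = t" by (simp add: agree_vars[OF a5] t_def)
  define q where "q = vars \<sigma>5 ''q''"
  define nt where "nt = arrs \<sigma>5 ''nt''"
  define nh where "nh = arrs \<sigma>5 ''nh''"
  define nc where "nc = arrs \<sigma>5 ''nc''"
  note defs = q_def[symmetric] nt_def[symmetric] nh_def[symmetric] nc_def[symmetric]
  obtain mg where N: "contracted_upto m q nt nh nc mg" using r5 by (auto simp: defs)
  have qm: "q \<le> m" using N by (simp add: contracted_upto_def)
  obtain u6 \<sigma>6 where e6: "exec B k mf tm flow_call \<sigma>5 u6 \<sigma>6" and u6: "u6 \<le> 1 + n + m + MF m n"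
    and a6: "agree {} {''fl''} \<sigma>5 \<sigma>6"
    and r6: "\<exists>A. A = (residual_rel q nt nh nc (arrs \<sigma>6 ''fl''))\<^sup>* `` {s} \<and> t \<notin> A \<and>
      (\<forall>U. s \<in> U \<and> t \<notin> U \<longrightarrow> ccut A \<le> ccut U)"
    using wpE[OF wp_flow_call[OF W con b5 t5 defs N mf]] by metis
  have b6: "base \<sigma>6" by (rule base_agree[OF b5 a6]) auto
  obtain A where A: "A = (residual_rel q nt nh nc (arrs \<sigma>6 ''fl''))\<^sup>* `` {s}" "t \<notin> A"
    "\<And>U. s \<in> U \<Longrightarrow> t \<notin> U \<Longrightarrow> ccut A \<le> ccut U"
    using r6 by blast
  have defs6: "vars \<sigma>6 ''q'' = q" "arrs \<sigma>6 ''nt'' = nt" "arrs \<sigma>6 ''nh'' = nh" "arrs \<sigma>6 ''nc'' = nc"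
    by (simp_all add: agree_vars[OF a6] agree_arrs[OF a6] defs)
  have ends: "nt i < n \<and> nh i < n" if "i < q" for i
    using contracted_ends[OF N that] W s_less by auto
  obtain u7 \<sigma>7 where e7: "exec B k mf tm residual_arcs \<sigma>6 u7 \<sigma>7" and u7: "u7 \<le> 8 * q + 3"
    and a7: "agree {''i'', ''K''} {''src'', ''dst''} \<sigma>6 \<sigma>7" and K7: "vars \<sigma>7 ''K'' = 2 * q"
    and arcs7: "\<And>e. e < 2 * q \<Longrightarrow> arrs \<sigma>7 ''src'' e < n \<and> arrs \<sigma>7 ''dst'' e < n"
    and r7: "(search.arc_rel (2 * q) (arrs \<sigma>7 ''src'') (arrs \<sigma>7 ''dst''))\<^sup>* =
      (residual_rel q nt nh nc (arrs \<sigma>6 ''fl''))\<^sup>*"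
    using wpE[OF wp_residual_arcs[OF b6 defs6 refl qm ends]] by (metis (no_types, lifting))
  have b7: "base \<sigma>7" by (rule base_agree[OF b6 a7]) auto
  have v7: "vars \<sigma>7 ''n'' = n" "vars \<sigma>7 ''s'' = s" using b7 by (auto simp: base_def)
  have qB: "2 * q \<le> B" using qm m_B by simp
  obtain u8 \<sigma>8 where e8: "exec B k mf tm bfs \<sigma>7 u8 \<sigma>8" and u8: "u8 \<le> 12 * (n + 2 * q) + 10"
    and a8: "agree {''i'', ''x'', ''p'', ''qh'', ''qt''} {''vis'', ''first'', ''next'', ''queue''} \<sigma>7 \<sigma>8"
    and r8: "search.searched n (2 * q) s (arrs \<sigma>7 ''src'') (arrs \<sigma>7 ''dst'')
      (vars \<sigma>8 ''qt'') (arrs \<sigma>8 ''vis'') (arrs \<sigma>8 ''queue'')"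
    using wpE[OF wp_bfs[OF v7(1) K7 v7(2) s_less n_B qB refl refl arcs7]] by (metis (no_types, lifting))
  have b8: "base \<sigma>8" by (rule base_agree[OF b7 a8]) auto
  interpret S: search n "2 * q" s "arrs \<sigma>7 ''src''" "arrs \<sigma>7 ''dst''"
    using s_less arcs7 by unfold_locales auto
  have vis8: "marks (arrs \<sigma>8 ''vis'') A"
    using r8 by (simp add: S.searched_def marks_def A(1) r7)
  note ag8 = agree_arrs[OF a8] agree_arrs[OF a7] agree_arrs[OF a6] agree_arrs[OF a5]
  have al8: "marks (arrs \<sigma>8 ''alive'') W" and isc8: "marks (arrs \<sigma>8 ''isc'') C"
    using al4 isc4 by (simp_all add: ag8)
  obtain u9 \<sigma>9 where e9: "exec B k mf tm mark_sinks \<sigma>8 u9 \<sigma>9" and u9: "u9 \<le> 4 * n + 2"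
    and a9: "agree {''i''} {''inz''} \<sigma>8 \<sigma>9" and inz9: "marks (arrs \<sigma>9 ''inz'') (sink_side A)"
    using wpE[OF wp_mark_sinks[OF b8 refl al8 refl isc8 refl vis8 CW]] unfolding sink_side_def by metis
  have b9: "base \<sigma>9" by (rule base_agree[OF b8 a9]) auto
  have rt9: "arrs \<sigma>9 ''root'' = rt" by (simp add: agree_arrs[OF a9] ag8 rt4)
  have ZW: "sink_side A \<subseteq> W" using CW by (auto simp: sink_side_def)
  have rtW: "rt v \<in> W" if "v \<in> W" for v
    using root_facts[OF W R that] by simp
  then have rtn: "rt v < n" if "v \<in> W" for v
    using that W by auto
  then have rtZ: "rt v < n" if "v \<in> sink_side A" for v
    using that ZW by auto
  have acc9: "\<forall>v<n. arrs \<sigma>9 ''acc'' v = 0"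
    using r1 by (simp add: agree_arrs[OF a9] ag8 agree_arrs[OF a4] agree_arrs[OF a3] agree_arrs[OF a2])
  obtain u10 \<sigma>10 where e10: "exec B k mf tm weigh \<sigma>9 u10 \<sigma>10" and u10: "u10 \<le> 6 * m + 2"
    and a10: "agree {''i'', ''u'', ''v''} {''acc''} \<sigma>9 \<sigma>10"
    and acc10: "\<And>r. r < n \<Longrightarrow> arrs \<sigma>10 ''acc'' r = into {v \<in> sink_side A. rt v = r}"
    by (rule wpE[OF wp_weigh[OF b9 refl inz9 rt9 rtZ acc9]], assumption, elim conjE, rule that, assumption+)
      simp
  have b10: "base \<sigma>10" by (rule base_agree[OF b9 a10]) auto
  have isc10: "marks (arrs \<sigma>10 ''isc'') C"
    using isc8 by (simp add: agree_arrs[OF a10] agree_arrs[OF a9])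
  have rt10: "arrs \<sigma>10 ''root'' = rt" by (simp add: agree_arrs[OF a10] rt9)
  have accC: "rt c < n \<and> arrs \<sigma>10 ''acc'' (rt c) \<le> B" if "c \<in> C" for c
    using that rtn CW acc10 into_le by auto
  obtain u11 \<sigma>11 where e11: "exec B k mf tm select_best \<sigma>10 u11 \<sigma>11" and u11: "u11 \<le> 6 * n + 3"
    and a11: "agree {''i'', ''imp'', ''best'', ''br''} {} \<sigma>10 \<sigma>11"
    and imp: "vars \<sigma>11 ''imp'' = 0 \<and> vars \<sigma>11 ''best'' = vars \<sigma>10 ''best'' \<or>
      0 < vars \<sigma>11 ''imp'' \<and>
      (\<exists>c \<in> C. vars \<sigma>11 ''br'' = rt c \<and> vars \<sigma>11 ''best'' = arrs \<sigma>10 ''acc'' (rt c))"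
    and best11: "vars \<sigma>11 ''best'' \<le> vars \<sigma>10 ''best''"
    and le11: "\<And>c. c \<in> C \<Longrightarrow> c < n \<Longrightarrow> vars \<sigma>11 ''best'' \<le> arrs \<sigma>10 ''acc'' (rt c)"
    by (rule wpE[OF wp_select_best[OF b10 refl isc10 rt10 refl accC refl]], assumption, elim conjE,
        rule that, assumption+) simp
  have b11: "base \<sigma>11" by (rule base_agree[OF b10 a11]) auto
  have inz11: "marks (arrs \<sigma>11 ''inz'') (sink_side A)"
    using inz9 by (simp add: agree_arrs[OF a11] agree_arrs[OF a10])
  have rt11: "arrs \<sigma>11 ''root'' = rt" by (simp add: agree_arrs[OF a11] rt10)
  obtain u12 \<sigma>12 where e12: "exec B k mf tm record_cut \<sigma>11 u12 \<sigma>12" and u12: "u12 \<le> 5 * n + 2"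
    and a12: "agree {''i''} {''cut''} \<sigma>11 \<sigma>12"
    and r12: "\<forall>v<n. arrs \<sigma>12 ''cut'' v = (if 0 < vars \<sigma>11 ''imp''
      then of_bool (v \<notin> sink_side A \<or> rt v \<noteq> vars \<sigma>11 ''br'') else arrs \<sigma>11 ''cut'' v)"
    using wpE[OF wp_record_cut[OF b11 refl inz11 rt11 refl refl]] by metis
  have b12: "base \<sigma>12" by (rule base_agree[OF b11 a12]) auto
  note ag12 = agree_arrs[OF a12] agree_arrs[OF a11] agree_arrs[OF a10] agree_arrs[OF a9] ag8
  have al12: "marks (arrs \<sigma>12 ''alive'') W" and isc12: "marks (arrs \<sigma>12 ''isc'') C"
    using al4 isc4 by (simp_all add: ag12)
  obtain u13 \<sigma>13 where e13: "exec B k mf tm retire \<sigma>12 u13 \<sigma>13" and u13: "u13 \<le> 5 * n + 3"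
    and a13: "agree {''i'', ''flag''} {''alive''} \<sigma>12 \<sigma>13"
    and al13: "marks (arrs \<sigma>13 ''alive'') (W - C)"
    and flag: "0 < vars \<sigma>13 ''flag'' \<longleftrightarrow> W - C \<noteq> {}"
    using wpE[OF wp_retire[OF b12 al12 refl isc12 Wn]] by metis
  have b13: "base \<sigma>13" by (rule base_agree[OF b12 a13]) auto
  have best13: "vars \<sigma>13 ''best'' = vars \<sigma>11 ''best''"
    by (simp add: agree_vars[OF a13] agree_vars[OF a12])
  have best10: "vars \<sigma>10 ''best'' = vars \<sigma> ''best''"
    by (simp add: agree_vars[OF a10] agree_vars[OF a9] agree_vars[OF a8] agree_vars[OF a7] agree_vars[OF a6]
        agree_vars[OF a5] agree_vars[OF a4] agree_vars[OF a3] agree_vars[OF a2] agree_vars[OF a1])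
  have cut11: "arrs \<sigma>11 ''cut'' = arrs \<sigma> ''cut''"
    by (simp add: ag12 agree_arrs[OF a4] agree_arrs[OF a3] agree_arrs[OF a2] agree_arrs[OF a1])
  have cut13: "arrs \<sigma>13 ''cut'' = arrs \<sigma>12 ''cut''"
    by (simp add: agree_arrs[OF a13])
  have "cut_recorded \<sigma>13"
    using imp
  proof (elim disjE conjE bexE)
    assume "vars \<sigma>11 ''imp'' = 0" "vars \<sigma>11 ''best'' = vars \<sigma>10 ''best''"
    then show ?thesis
      using cut r12 by (auto simp: cut_recorded_def marks_def cut13 cut11 best13 best10)
  next
    fix c assume c: "0 < vars \<sigma>11 ''imp''" "c \<in> C" "vars \<sigma>11 ''br'' = rt c"
      "vars \<sigma>11 ''best'' = arrs \<sigma>10 ''acc'' (rt c)"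
    let ?Y = "{v \<in> sink_side A. rt v = rt c}"
    \<comment> \<open>The center makes the candidate nonempty; \<open>s\<close> lies outside it, so
      it is a proper subset of the vertices.\<close>
    have "c \<in> ?Y" using c(2) by (simp add: sink_side_def)
    then have "?Y \<noteq> {}" by blast
    moreover have "?Y \<subset> {..<n}" using ZW W s_less by auto
    moreover have "vars \<sigma>13 ''best'' = into ?Y" using c rtn CW acc10 best13 by auto
    moreover have "marks (arrs \<sigma>13 ''cut'') ({..<n} - ?Y)"
      using r12 c by (simp add: marks_def cut13)
    ultimately show ?thesis unfolding cut_recorded_def by (intro exI[of _ ?Y] conjI)
  qed
  then have inv13: "alive_inv (W - C) \<sigma>13"
    using b13 W al13 by (auto simp: alive_inv_def)
  have halves: "\<exists>r0 \<in> W. par r0 \<notin> W \<and> 2 * csize (W - C) r \<le> csize W r0"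
    if "r \<in> W - C" "par r \<notin> W - C" for r
    using csize_halves[OF W R, folded C_def, OF that] root_facts[OF W R, of r] that(1)
    by (auto simp: csize_def)
  \<comment> \<open>If \<open>X\<close> contains a center \<open>c\<close>, connectedness puts it
    into the class of \<open>c\<close>, where the candidate is at most as heavy.\<close>
  have hit: "X \<subseteq> W - C \<or> vars \<sigma>13 ''best'' \<le> into X" if X: "X \<subseteq> W" "tree_connected X" for X
  proof (cases "X \<inter> C = {}")
    case False
    then obtain c where c: "c \<in> X" "c \<in> C" by auto
    have "rt x = rt c" if "x \<in> X" for x
      using connected_same_root[OF W R X(1) _ that c(1)] X(2) by (auto simp: tree_connected_def)
    then have X': "X \<subseteq> {v \<in> W. rt v = rt c}" using X(1) by auto
    have sA: "s \<in> A" by (simp add: A(1))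
    have "into {v \<in> sink_side A. rt v = rt c} \<le> into X"
      by (rule min_ccut_class[OF sA A(2,3) X' c(2,1)])
    moreover have "c < n" "c \<in> W" using c(2) CW W by auto
    ultimately show ?thesis
      using le11[OF c(2)] acc10 rtn best13 by auto
  qed (use X in auto)
  have u7': "u7 \<le> 8 * m + 3" using u7 qm by simp
  have u8': "u8 \<le> 12 * n + 24 * m + 10"
  proof -
    have "12 * (n + 2 * q) \<le> 12 * (n + 2 * m)" using qm by (intro mult_le_mono2) simp
    then show ?thesis using u8 by simp
  qed
  \<comment> \<open>The phases add up to \<open>56 * n + 52 * m + 37 + MF m n\<close>, rounded up
    below.\<close>
  have "u1 + (u2 + (u3 + (u4 + (u5 + (u6 + (u7 + (u8 + (u9 + (u10 + (u11 + (u12 + u13)))))))))))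
    \<le> (5 * n + 2) + ((5 * n + 2) + ((8 * n + 2) + ((5 * n + 2) + ((13 * m + 3) + ((1 + n + m + MF m n) + ((8 * m + 3) + ((12 * n + 24 * m + 10) + ((4 * n + 2) + ((6 * m + 2) + ((6 * n + 3) + ((5 * n + 2) + (5 * n + 3))))))))))))"
    by (intro add_mono u1 u2 u3 u4 u5 u6 u7' u8' u9 u10 u11 u12 u13)
  also have "\<dots> \<le> 60 * (n + m) + 40 + MF m n" by simp
  finally have "u1 + (u2 + (u3 + (u4 + (u5 + (u6 + (u7 + (u8 + (u9 + (u10 + (u11 + (u12 + u13))))))))))) \<le> 60 * (n + m) + 40 + MF m n" .
  moreover have "exec B k mf tm one_round \<sigma>
      (u1 + (u2 + (u3 + (u4 + (u5 + (u6 + (u7 + (u8 + (u9 + (u10 + (u11 + (u12 + u13)))))))))))) \<sigma>13"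
    unfolding one_round_def
    by (intro exec.Seq[OF e1] exec.Seq[OF e2] exec.Seq[OF e3] exec.Seq[OF e4] exec.Seq[OF e5]
        exec.Seq[OF e6] exec.Seq[OF e7] exec.Seq[OF e8] exec.Seq[OF e9] exec.Seq[OF e10]
        exec.Seq[OF e11] exec.Seq[OF e12] e13)
  moreover have "vars \<sigma>13 ''best'' \<le> vars \<sigma> ''best''" using best11 best13 best10 by simp
  moreover have "\<forall>r \<in> W - C. par r \<notin> W - C \<longrightarrow>
      (\<exists>r0 \<in> W. par r0 \<notin> W \<and> 2 * csize (W - C) r \<le> csize W r0)"
    by (intro ballI impI halves)
  moreover have "\<forall>X. X \<subseteq> W \<and> tree_connected X \<longrightarrow> X \<subseteq> W - C \<or> vars \<sigma>13 ''best'' \<le> into X"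
    by (intro allI impI, elim conjE, rule hit)
  ultimately show ?thesis
    unfolding wp_def by (intro exI conjI) (rule inv13 flag | assumption)+
qed

text \<open>After \<open>i\<close> rounds each component has at most \<open>n / 2 ^ i\<close>
  vertices. A nonempty one has at least one, so there are at most \<open>L\<close> rounds and
  \<open>L - i\<close> is the variant. In the end no vertex is alive, so the nonempty
  \<open>X\<close> must have been hit.\<close>

lemma wp_rounds:
  assumes inv: "alive_inv W \<sigma>" and flag: "0 < vars \<sigma> ''flag'' \<longleftrightarrow> W \<noteq> {}"
    and X: "X \<subseteq> W" "X \<noteq> {}" "tree_connected X"
    and mf: "maxflow_subroutine k mf tm MF" and L: "n < 2 ^ L"
  shows "wp (While (Less (Num 0) (Var ''flag'')) one_round) (\<lambda>u \<sigma>'.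
    u \<le> (60 * (n + m) + 40 + MF m n + 1) * L + 1 \<and> cut_recorded \<sigma>' \<and> vars \<sigma>' ''best'' \<le> into X) \<sigma>"
proof -
  define I where "I j \<sigma>' \<longleftrightarrow> (\<exists>i W. i + j = L \<and> alive_inv W \<sigma>' \<and> (0 < vars \<sigma>' ''flag'' \<longleftrightarrow> W \<noteq> {}) \<and>
    (\<forall>r \<in> W. par r \<notin> W \<longrightarrow> csize W r * 2 ^ i \<le> n) \<and> (X \<subseteq> W \<or> vars \<sigma>' ''best'' \<le> into X))" for j \<sigma>'
  have "wp (While (Less (Num 0) (Var ''flag'')) one_round) (\<lambda>u \<sigma>'.
    u \<le> (60 * (n + m) + 40 + MF m n + 1) * L + 1 \<and> (\<exists>j. I j \<sigma>') \<and> \<not> bval (Less (Num 0) (Var ''flag'')) \<sigma>') \<sigma>"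
  proof (rule wp_While)
    have W: "W \<subseteq> {..<n} - {s}" using inv by (simp add: alive_inv_def)
    have "csize W r * 2 ^ 0 \<le> n" if "r \<in> W" for r
      using card_desc_le[OF W, of r 0] that W by (auto simp: csize_def)
    then show "I L \<sigma>"
      unfolding I_def using inv flag X(1) by (intro exI[of _ 0] exI[of _ W]) auto
  next
    fix j \<sigma>' assume I: "I j \<sigma>'" and "bval (Less (Num 0) (Var ''flag'')) \<sigma>'"
    then obtain i W where i: "i + j = L" and inv: "alive_inv W \<sigma>'" and ne: "W \<noteq> {}"
      and size: "\<And>r. r \<in> W \<Longrightarrow> par r \<notin> W \<Longrightarrow> csize W r * 2 ^ i \<le> n"
      and X': "X \<subseteq> W \<or> vars \<sigma>' ''best'' \<le> into X"
      unfolding I_def by auto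
    have W: "W \<subseteq> {..<n} - {s}" using inv by (simp add: alive_inv_def)
    \<comment> \<open>A vertex of least position in \<open>W\<close> has its parent outside
      \<open>W\<close> and is thus a component root.\<close>
    obtain r where r: "r \<in> W" "par r \<notin> W"
    proof -
      obtain r where r: "r \<in> W" "\<And>v. v \<in> W \<Longrightarrow> pos r \<le> pos v"
        using ne ex_has_least_nat[of "\<lambda>v. v \<in> W" _ pos] by blast
      then have "par r \<notin> W" using W pos_par[of r] by fastforce
      then show ?thesis using that r(1) by blast
    qed
    have "1 \<le> csize W r" using card_desc_pos[OF W, of 0 r] by (simp add: csize_def)
    then have "2 ^ i \<le> csize W r * 2 ^ i" by simp
    also have "\<dots> < 2 ^ L" using size[OF r] L by simp
    finally have "i < L" by simp
    then obtain j' where j': "j = Suc j'" "Suc i + j' = L" using i by (metis Suc_diff_Suc add_Suc_shift add_diff_cancel_left' le_add_diff_inverse less_imp_le_nat)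
    show "wp one_round (\<lambda>u \<sigma>''. u \<le> 60 * (n + m) + 40 + MF m n \<and> (\<exists>j'<j. I j' \<sigma>'')) \<sigma>'"
    proof (rule wp_mono[OF wp_one_round[OF inv ne mf]], elim conjE exE)
      fix u \<sigma>'' W'
      assume u: "u \<le> 60 * (n + m) + 40 + MF m n" and inv': "alive_inv W' \<sigma>''"
        and flag': "(0 < vars \<sigma>'' ''flag'') = (W' \<noteq> {})"
        and half: "\<forall>r \<in> W'. par r \<notin> W' \<longrightarrow> (\<exists>r0 \<in> W. par r0 \<notin> W \<and> 2 * csize W' r \<le> csize W r0)"
        and best: "vars \<sigma>'' ''best'' \<le> vars \<sigma>' ''best''"
        and hit: "\<forall>X. X \<subseteq> W \<and> tree_connected X \<longrightarrow> X \<subseteq> W' \<or> vars \<sigma>'' ''best'' \<le> into X"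
      have "csize W' r * 2 ^ Suc i \<le> n" if r: "r \<in> W'" "par r \<notin> W'" for r
      proof -
        obtain r0 where r0: "r0 \<in> W" "par r0 \<notin> W" "2 * csize W' r \<le> csize W r0"
          using half r by blast
        have "csize W' r * 2 ^ Suc i = 2 * csize W' r * 2 ^ i" by simp
        also have "\<dots> \<le> csize W r0 * 2 ^ i" using r0(3) by (rule mult_le_mono1)
        also have "\<dots> \<le> n" by (rule size[OF r0(1,2)])
        finally show ?thesis .
      qed
      moreover have "X \<subseteq> W' \<or> vars \<sigma>'' ''best'' \<le> into X"
        using X' hit X(3) best by (meson le_trans)
      ultimately have "I j' \<sigma>''"
        unfolding I_def using j'(2) inv' flag' by (intro exI[of _ "Suc i"] exI[of _ W']) auto
      then show "u \<le> 60 * (n + m) + 40 + MF m n \<and> (\<exists>j'<j. I j' \<sigma>'')" using u j'(1) by blast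
    qed
  qed
  then show ?thesis
    by (rule wp_mono) (use X(2) in \<open>auto simp: I_def alive_inv_def\<close>)
qed

end

section \<open>The complete program\<close>

definition load_tree :: com where
  "load_tree = For ''i'' (Var ''m'')
     (If (Set ''tree'' (Var ''i''))
        (Put ''src'' (Var ''i'') (Get ''tail'' (Var ''i'')) ;; Put ''dst'' (Var ''i'') (Get ''head'' (Var ''i'')) ;;
         Put ''par'' (Get ''head'' (Var ''i'')) (Get ''tail'' (Var ''i'')))
        (Put ''src'' (Var ''i'') (Var ''s'') ;; Put ''dst'' (Var ''i'') (Var ''s''))) ;;
     Assign ''K'' (Var ''m'')"

text \<open>The queue is overwritten by the search in each round, while the tree order must
  persist.\<close>

definition copy_order :: com where
  "copy_order = For ''i'' (Var ''n'') (Put ''ord'' (Var ''i'') (Get ''queue'' (Var ''i'')))"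

text \<open>The source side \<open>{s}\<close> serves as the first recorded cut, so
  \<open>best\<close> is an actual cut weight from the beginning and the rounds only have to improve
  it.\<close>

definition start_cut :: com where
  "start_cut = For ''i'' (Var ''n'') (Put ''alive'' (Var ''i'') (Num 1)) ;;
     Put ''alive'' (Var ''s'') (Num 0) ;; Put ''cut'' (Var ''s'') (Num 1) ;; Assign ''flag'' (Num 1) ;;
     For ''i'' (Var ''m'')
       (If (Eq (Get ''tail'' (Var ''i'')) (Var ''s''))
          (Assign ''best'' (Plus (Var ''best'') (Get ''weight'' (Var ''i''))))
          Skip)"

definition min_cut_program :: com where
  "min_cut_program = load_tree ;; bfs ;; copy_order ;; start_cut ;;
     While (Less (Num 0) (Var ''flag'')) one_round"

lemma (in solver) wp_start_cut:
  assumes "base \<sigma>" and cut: "\<And>v. v < n \<Longrightarrow> arrs \<sigma> ''cut'' v = 0" and best: "vars \<sigma> ''best'' = 0" and n: "2 \<le> n"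
  shows "wp start_cut (\<lambda>u \<sigma>'. u \<le> 3 * n + 4 * m + 7 \<and> alive_inv ({..<n} - {s}) \<sigma>' \<and> 0 < vars \<sigma>' ''flag'') \<sigma>"
proof -
  define I1 where "I1 j \<sigma>' \<longleftrightarrow> base \<sigma>' \<and> arrs \<sigma>' ''cut'' = arrs \<sigma> ''cut'' \<and> vars \<sigma>' ''best'' = 0 \<and>
    (\<forall>v<j. arrs \<sigma>' ''alive'' v = 1)" for j \<sigma>'
  have 1: "wp (For ''i'' (Var ''n'') (Put ''alive'' (Var ''i'') (Num 1))) (\<lambda>u \<sigma>'. u \<le> (1 + 2) * n + 2 \<and> I1 n \<sigma>') \<sigma>"
  proof (rule wp_For)
    show "I1 0 (\<sigma>\<lparr>vars := (vars \<sigma>)(''i'' := 0)\<rparr>)"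
      using assms by (simp add: I1_def base_def)
    show "aval (Var ''n'') \<sigma>' = n" if "I1 j \<sigma>'" for j \<sigma>'
      using that by (simp add: I1_def base_def)
    show "wp (Put ''alive'' (Var ''i'') (Num 1))
      (\<lambda>u \<sigma>''. u \<le> 1 \<and> vars \<sigma>'' ''i'' = j \<and> I1 (Suc j) (\<sigma>''\<lparr>vars := (vars \<sigma>'')(''i'' := Suc j)\<rparr>)) \<sigma>'"
      if "I1 j \<sigma>'" "j < n" "vars \<sigma>' ''i'' = j" for j \<sigma>'
      using that n_B by (simp add: wp_simps I1_def base_def less_Suc_eq)
  qed (rule n_B)
  define I2 where "I2 j \<sigma>' \<longleftrightarrow> base \<sigma>' \<and> marks (arrs \<sigma>' ''cut'') {s} \<and> marks (arrs \<sigma>' ''alive'') ({..<n} - {s}) \<and>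
    vars \<sigma>' ''flag'' = 1 \<and> vars \<sigma>' ''best'' = (\<Sum>e<j. if ta e = s then w e else 0)" for j \<sigma>'
  have 2: "wp (For ''i'' (Var ''m'')
       (If (Eq (Get ''tail'' (Var ''i'')) (Var ''s''))
          (Assign ''best'' (Plus (Var ''best'') (Get ''weight'' (Var ''i''))))
          Skip)) (\<lambda>u \<sigma>'. u \<le> (2 + 2) * m + 2 \<and> I2 m \<sigma>') \<sigma>'" if "I2 0 \<sigma>'" for \<sigma>'
  proof (rule wp_For)
    show "I2 0 (\<sigma>'\<lparr>vars := (vars \<sigma>')(''i'' := 0)\<rparr>)"
      using that by (simp add: I2_def base_def)
    show "aval (Var ''m'') \<sigma>'' = m" if "I2 j \<sigma>''" for j \<sigma>''
      using that by (simp add: I2_def base_def)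
    show "m \<le> B" using m_B by simp
    fix j \<sigma>' assume I: "I2 j \<sigma>'" "j < m" "vars \<sigma>' ''i'' = j"
    have "(\<Sum>e<j. if ta e = s then w e else 0) + w j \<le> (\<Sum>e<Suc j. w e)"
      by (simp add: sum_mono)
    also have "\<dots> \<le> (\<Sum>e<m. w e)"
      using I(2) by (intro sum_mono2) auto
    finally show "wp (If (Eq (Get ''tail'' (Var ''i'')) (Var ''s''))
          (Assign ''best'' (Plus (Var ''best'') (Get ''weight'' (Var ''i''))))
          Skip)
      (\<lambda>u \<sigma>''. u \<le> 2 \<and> vars \<sigma>'' ''i'' = j \<and> I2 (Suc j) (\<sigma>''\<lparr>vars := (vars \<sigma>'')(''i'' := Suc j)\<rparr>)) \<sigma>'"
      using I w_B by (simp add: wp_simps I2_def base_def)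
  qed
  have into: "(\<Sum>e<m. if ta e = s then w e else 0) = into ({..<n} - {s})"
    unfolding cut_into_def by (rule sum.cong) (use he_less ta_less loopfree in force)+
  have rest: "{..<n} - ({..<n} - {s}) = {s}" "{..<n} - {s} \<subset> {..<n}" "{..<n} - {s} \<noteq> {}"
  proof -
    \<comment> \<open>A vertex other than \<open>s\<close>, available because there are at least
      two.\<close>
    have "(if s = 0 then 1 else 0) \<in> {..<n} - {s}" using n by auto
    then show "{..<n} - {s} \<noteq> {}" by blast
  qed (use s_less in auto)
  have fin: "alive_inv ({..<n} - {s}) \<sigma>' \<and> 0 < vars \<sigma>' ''flag''" if I: "I2 m \<sigma>'" for \<sigma>'
  proof -
    have "cut_recorded \<sigma>'"
      unfolding cut_recorded_def using I into rest
      by (intro exI[of _ "{..<n} - {s}"]) (simp add: I2_def)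
    then show ?thesis using I by (simp add: I2_def alive_inv_def)
  qed
  show ?thesis
    unfolding start_cut_def
  proof (rule wp_SeqI[OF 1])
    fix u1 \<sigma>1 assume s1: "u1 \<le> (1 + 2) * n + 2 \<and> I1 n \<sigma>1"
    let ?\<sigma> = "\<sigma>1\<lparr>arrs := (arrs \<sigma>1)(''alive'' := (arrs \<sigma>1 ''alive'')(s := 0), ''cut'' := (arrs \<sigma>1 ''cut'')(s := 1)),
      vars := (vars \<sigma>1)(''flag'' := 1)\<rparr>"
    have "I2 0 ?\<sigma>"
      using s1 cut by (auto simp: I1_def I2_def base_def marks_def)
    from wp_mono[OF 2[OF this]] show "wp (Put ''alive'' (Var ''s'') (Num 0) ;; Put ''cut'' (Var ''s'') (Num 1) ;;
      Assign ''flag'' (Num 1) ;;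
      For ''i'' (Var ''m'')
       (If (Eq (Get ''tail'' (Var ''i'')) (Var ''s''))
          (Assign ''best'' (Plus (Var ''best'') (Get ''weight'' (Var ''i''))))
          Skip)) (\<lambda>v \<sigma>'. u1 + v \<le> 3 * n + 4 * m + 7 \<and> alive_inv ({..<n} - {s}) \<sigma>' \<and> 0 < vars \<sigma>' ''flag'') \<sigma>1"
      using s1 s_less n_B fin by (simp add: wp_simps I1_def base_def)
  qed
qed

section \<open>Loading the tree and running the whole program\<close>

context ram
begin

text \<open>No two tree arcs share a head, so each parent entry is written only once and stays
  correct. Arcs outside the tree become loops at \<open>s\<close>, which do not affect the
  search.\<close>

lemma wp_load_tree:
  assumes v: "vars \<sigma> ''n'' = n" "vars \<sigma> ''m'' = m" "vars \<sigma> ''s'' = s"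
    and a: "arrs \<sigma> ''tail'' = ta" "arrs \<sigma> ''head'' = he" "arrs \<sigma> ''tree'' = tr"
    and arcs: "\<And>e. e < m \<Longrightarrow> ta e < n \<and> he e < n" and s: "s < n" and B: "n \<le> B" "m \<le> B"
    and inj: "\<And>e e'. e < m \<Longrightarrow> e' < m \<Longrightarrow> 0 < tr e \<Longrightarrow> 0 < tr e' \<Longrightarrow> he e = he e' \<Longrightarrow> e = e'"
  shows "wp load_tree (\<lambda>u \<sigma>'. u \<le> 6 * m + 3 \<and> agree {''i'', ''K''} {''src'', ''dst'', ''par''} \<sigma> \<sigma>' \<and>
    vars \<sigma>' ''K'' = m \<and> (\<forall>e<m. if 0 < tr e
      then arrs \<sigma>' ''src'' e = ta e \<and> arrs \<sigma>' ''dst'' e = he e \<and> arrs \<sigma>' ''par'' (he e) = ta e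
      else arrs \<sigma>' ''src'' e = s \<and> arrs \<sigma>' ''dst'' e = s)) \<sigma>"
proof -
  define I where "I j \<sigma>' \<longleftrightarrow> agree {''i'', ''K''} {''src'', ''dst'', ''par''} \<sigma> \<sigma>' \<and>
    vars \<sigma>' ''m'' = m \<and> vars \<sigma>' ''s'' = s \<and> arrs \<sigma>' ''tail'' = ta \<and> arrs \<sigma>' ''head'' = he \<and> arrs \<sigma>' ''tree'' = tr \<and>
    (\<forall>e<j. if 0 < tr e
      then arrs \<sigma>' ''src'' e = ta e \<and> arrs \<sigma>' ''dst'' e = he e \<and> arrs \<sigma>' ''par'' (he e) = ta e
      else arrs \<sigma>' ''src'' e = s \<and> arrs \<sigma>' ''dst'' e = s)" for j \<sigma>'
  have "wp load_tree (\<lambda>u \<sigma>'. u \<le> (4 + 2) * m + 3 \<and> I m \<sigma>' \<and> vars \<sigma>' ''K'' = m) \<sigma>"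
    unfolding load_tree_def
  proof (rule wp_SeqI[OF wp_For[where I = I and N = m and a = 4]])
    show "I 0 (\<sigma>\<lparr>vars := (vars \<sigma>)(''i'' := 0)\<rparr>)"
      using assms by (simp add: I_def agree_simps)
    show "aval (Var ''m'') \<sigma>' = m" if "I j \<sigma>'" for j \<sigma>'
      using that by (simp add: I_def)
    show "wp (Assign ''K'' (Var ''m''))
        (\<lambda>v \<sigma>''. u + v \<le> (4 + 2) * m + 3 \<and> I m \<sigma>'' \<and> vars \<sigma>'' ''K'' = m) \<sigma>'"
      if "u \<le> (4 + 2) * m + 2 \<and> I m \<sigma>'" for u \<sigma>'
      using that B by (simp add: wp_simps I_def agree_simps)
    fix j \<sigma>' assume I: "I j \<sigma>'" "j < m" "vars \<sigma>' ''i'' = j"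
    have b: "ta j \<le> B" "he j \<le> B" "s \<le> B" "j \<le> B"
      using arcs[OF I(2)] B s I(2) by auto
    have he: "he e \<noteq> he j" if "e < j" "0 < tr e" "0 < tr j" for e
      using inj[of e j] that I(2) by auto
    show "wp (If (Set ''tree'' (Var ''i''))
        (Put ''src'' (Var ''i'') (Get ''tail'' (Var ''i'')) ;; Put ''dst'' (Var ''i'') (Get ''head'' (Var ''i'')) ;;
         Put ''par'' (Get ''head'' (Var ''i'')) (Get ''tail'' (Var ''i'')))
        (Put ''src'' (Var ''i'') (Var ''s'') ;; Put ''dst'' (Var ''i'') (Var ''s'')))
      (\<lambda>u \<sigma>''. u \<le> 4 \<and> vars \<sigma>'' ''i'' = j \<and> I (Suc j) (\<sigma>''\<lparr>vars := (vars \<sigma>'')(''i'' := Suc j)\<rparr>)) \<sigma>'"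
      using I b he by (cases "0 < tr j") (simp_all add: wp_simps I_def agree_simps less_Suc_eq)
  qed (rule B)
  then show ?thesis by (rule wp_mono) (simp add: I_def)
qed

lemma wp_copy_order:
  assumes "vars \<sigma> ''n'' = n" and q: "arrs \<sigma> ''queue'' = qu" "\<And>i. i < n \<Longrightarrow> qu i \<le> B" and B: "n \<le> B"
  shows "wp copy_order (\<lambda>u \<sigma>'. u \<le> 3 * n + 2 \<and> agree {''i''} {''ord''} \<sigma> \<sigma>' \<and>
    (\<forall>i<n. arrs \<sigma>' ''ord'' i = qu i)) \<sigma>"
proof -
  define I where "I j \<sigma>' \<longleftrightarrow> agree {''i''} {''ord''} \<sigma> \<sigma>' \<and> vars \<sigma>' ''n'' = n \<and> arrs \<sigma>' ''queue'' = qu \<and>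
    (\<forall>i<j. arrs \<sigma>' ''ord'' i = qu i)" for j \<sigma>'
  have "wp copy_order (\<lambda>u \<sigma>'. u \<le> (1 + 2) * n + 2 \<and> I n \<sigma>') \<sigma>"
    unfolding copy_order_def
  proof (rule wp_For)
    show "I 0 (\<sigma>\<lparr>vars := (vars \<sigma>)(''i'' := 0)\<rparr>)"
      using assms by (simp add: I_def agree_simps)
    show "aval (Var ''n'') \<sigma>' = n" if "I j \<sigma>'" for j \<sigma>'
      using that by (simp add: I_def)
    show "wp (Put ''ord'' (Var ''i'') (Get ''queue'' (Var ''i'')))
      (\<lambda>u \<sigma>''. u \<le> 1 \<and> vars \<sigma>'' ''i'' = j \<and> I (Suc j) (\<sigma>''\<lparr>vars := (vars \<sigma>'')(''i'' := Suc j)\<rparr>)) \<sigma>'"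
      if "I j \<sigma>'" "j < n" "vars \<sigma>' ''i'' = j" for j \<sigma>'
      using that q(2)[OF that(2)] B by (simp add: wp_simps I_def agree_simps less_Suc_eq)
  qed (rule B)
  then show ?thesis by (rule wp_mono) (simp add: I_def)
qed

lemma wp_min_cut_program:
  assumes v: "vars \<sigma> ''n'' = n" "vars \<sigma> ''m'' = m" "vars \<sigma> ''s'' = s" "vars \<sigma> ''best'' = 0"
    and a: "arrs \<sigma> ''tail'' = ta" "arrs \<sigma> ''head'' = he" "arrs \<sigma> ''weight'' = w" "arrs \<sigma> ''tree'' = tr"
    and cut: "\<And>v. v < n \<Longrightarrow> arrs \<sigma> ''cut'' v = 0"
    and arcs: "\<And>e. e < m \<Longrightarrow> ta e < n \<and> he e < n \<and> ta e \<noteq> he e \<and> 0 < w e"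
    and nomulti: "\<And>e e'. e < m \<Longrightarrow> e' < m \<Longrightarrow> ta e = ta e' \<Longrightarrow> he e = he e' \<Longrightarrow> e = e'"
    and s: "s < n" and n: "2 \<le> n" and B: "n \<le> B" "2 * m \<le> B" "(\<Sum>e<m. w e) \<le> B" "(\<Sum>e<m. w e) \<le> n ^ k"
    and inj: "\<And>e e'. e < m \<Longrightarrow> e' < m \<Longrightarrow> 0 < tr e \<Longrightarrow> 0 < tr e' \<Longrightarrow> he e = he e' \<Longrightarrow> e = e'"
    and reach: "\<And>v. v < n \<Longrightarrow> (s, v) \<in> {(ta e, he e) | e. e < m \<and> 0 < tr e}\<^sup>*"
    and X: "X \<noteq> {}" "X \<subseteq> {..<n} - {s}"
    and cross: "\<And>e e'. e < m \<Longrightarrow> e' < m \<Longrightarrow> 0 < tr e \<Longrightarrow> 0 < tr e' \<Longrightarrow> ta e \<notin> X \<Longrightarrow> he e \<in> X \<Longrightarrow>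
      ta e' \<notin> X \<Longrightarrow> he e' \<in> X \<Longrightarrow> e = e'"
    and mf: "maxflow_subroutine k mf tm MF" and L: "n < 2 ^ L"
  shows "wp min_cut_program (\<lambda>u \<sigma>'. u \<le> (60 * (n + m) + 41 + MF m n) * (L + 1) \<and>
    (\<exists>Y. Y \<noteq> {} \<and> Y \<subset> {..<n} \<and> cut_into ta he w m Y \<le> cut_into ta he w m X \<and>
      (\<forall>v<n. arrs \<sigma>' ''cut'' v = of_bool (v \<notin> Y)))) \<sigma>"
proof -
  have mB: "m \<le> B" using B(2) by simp
  have arcs': "ta e < n \<and> he e < n" if "e < m" for e using arcs[OF that] by simp
  obtain u1 \<sigma>1 where e1: "exec B k mf tm load_tree \<sigma> u1 \<sigma>1" and u1: "u1 \<le> 6 * m + 3"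
    and a1: "agree {''i'', ''K''} {''src'', ''dst'', ''par''} \<sigma> \<sigma>1" and K1: "vars \<sigma>1 ''K'' = m"
    and r1: "\<forall>e<m. if 0 < tr e
      then arrs \<sigma>1 ''src'' e = ta e \<and> arrs \<sigma>1 ''dst'' e = he e \<and> arrs \<sigma>1 ''par'' (he e) = ta e
      else arrs \<sigma>1 ''src'' e = s \<and> arrs \<sigma>1 ''dst'' e = s"
    by (rule wpE[OF wp_load_tree[OF v(1-3) a(1,2,4) arcs' s B(1) mB inj]], assumption+, elim conjE, rule that, assumption+)
  let ?src = "arrs \<sigma>1 ''src''" and ?dst = "arrs \<sigma>1 ''dst''" and ?par = "arrs \<sigma>1 ''par''"
  have arcs1: "?src e < n \<and> ?dst e < n" if "e < m" for e
    using r1 that arcs s by (auto split: if_splits)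
  have v1: "vars \<sigma>1 ''n'' = n" "vars \<sigma>1 ''s'' = s" using v by (simp_all add: agree_vars[OF a1])
  obtain u2 \<sigma>2 where e2: "exec B k mf tm bfs \<sigma>1 u2 \<sigma>2" and u2: "u2 \<le> 12 * (n + m) + 10"
    and a2: "agree {''i'', ''x'', ''p'', ''qh'', ''qt''} {''vis'', ''first'', ''next'', ''queue''} \<sigma>1 \<sigma>2"
    and r2: "search.searched n m s ?src ?dst (vars \<sigma>2 ''qt'') (arrs \<sigma>2 ''vis'') (arrs \<sigma>2 ''queue'')"
    by (rule wpE[OF wp_bfs[OF v1(1) K1 v1(2) s B(1) mB refl refl arcs1]], assumption, elim conjE, rule that, assumption+)
  interpret S: search n m s ?src ?dst
    using s arcs1 by unfold_locales auto
  let ?queue = "arrs \<sigma>2 ''queue''"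
  have T: "{(ta e, he e) | e. e < m \<and> 0 < tr e} \<subseteq> S.arc_rel"
  proof
    fix x assume "x \<in> {(ta e, he e) | e. e < m \<and> 0 < tr e}"
    then obtain e where e: "e < m" "0 < tr e" "x = (ta e, he e)" by blast
    then have "x = (?src e, ?dst e)" using r1 by auto
    then show "x \<in> S.arc_rel" unfolding S.arc_rel_def using e(1) by blast
  qed
  have "v < n" if "(s, v) \<in> S.arc_rel\<^sup>*" for v
    using that by (induction rule: rtrancl_induct) (use s arcs1 in \<open>auto simp: S.arc_rel_def\<close>)
  moreover have "(s, v) \<in> S.arc_rel\<^sup>*" if "v < n" for v
    using reach[OF that] rtrancl_mono[OF T] by blast
  ultimately have img: "S.arc_rel\<^sup>* `` {s} = {..<n}" by auto
  then have "inj_on ?queue {..<vars \<sigma>2 ''qt''}" "?queue ` {..<vars \<sigma>2 ''qt''} = {..<n}"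
    and queue: "?queue 0 = s" "S.discovered (vars \<sigma>2 ''qt'') ?queue"
    using r2 by (simp_all add: S.searched_def)
  \<comment> \<open>The queue lists the reachable vertices without repetition, and all
    \<open>n\<close> vertices are reachable.\<close>
  moreover from this have qt: "vars \<sigma>2 ''qt'' = n"
    using card_image[of ?queue "{..<vars \<sigma>2 ''qt''}"] by simp
  ultimately have inj_q: "inj_on ?queue {..<n}" and img_q: "?queue ` {..<n} = {..<n}"
    and disc: "S.discovered n ?queue" by simp_all
  have qB: "?queue i \<le> B" if "i < n" for i
  proof -
    have "?queue i \<in> {..<n}" using img_q that by blast
    then show ?thesis using B(1) by simp
  qed
  have v2: "vars \<sigma>2 ''n'' = n" using v1 by (simp add: agree_vars[OF a2])
  obtain u3 \<sigma>3 where e3: "exec B k mf tm copy_order \<sigma>2 u3 \<sigma>3" and u3: "u3 \<le> 3 * n + 2"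
    and a3: "agree {''i''} {''ord''} \<sigma>2 \<sigma>3" and r3: "\<forall>i<n. arrs \<sigma>3 ''ord'' i = ?queue i"
    by (rule wpE[OF wp_copy_order[OF v2 refl qB B(1)]], assumption, elim conjE, rule that, assumption+)
  let ?ord = "arrs \<sigma>3 ''ord''"
  note ag = agree_arrs[OF a3] agree_arrs[OF a2] agree_arrs[OF a1]
    agree_vars[OF a3] agree_vars[OF a2] agree_vars[OF a1]
  have par: "\<exists>i<j. ?par (?ord j) = ?ord i" if j: "0 < j" "j < n" for j
  proof -
    obtain i where i: "i < j" "(?queue i, ?queue j) \<in> S.arc_rel"
      using disc j unfolding S.discovered_def by meson
    then obtain e where e: "e < m" "?queue i = ?src e" "?queue j = ?dst e"
      by (auto simp: S.arc_rel_def)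
    \<comment> \<open>The arc that discovered a vertex other than \<open>s\<close> is no filling
      loop, hence a tree arc, and its tail is the recorded parent.\<close>
    have "?queue j \<noteq> ?queue 0" using inj_onD[OF inj_q, of j 0] j by auto
    then have "0 < tr e" using r1[rule_format, OF e(1)] e queue(1) by (auto split: if_splits)
    then have "?par (?queue j) = ?queue i" using r1 e by auto
    then show ?thesis using r3 i(1) j(2) by (intro exI[of _ i]) simp
  qed
  interpret solver B k mf tm n s ?par ?ord m ta he w
  proof unfold_locales
    show "inj_on ?ord {..<n}" using inj_q r3 by (simp add: inj_on_def)
    have "?ord ` {..<n} = ?queue ` {..<n}" using r3 by (intro image_cong) auto
    then show "?ord ` {..<n} = {..<n}" using img_q by simp
    show "?ord 0 = s" using r3 queue(1) s by simp
  qed (use arcs nomulti s B par in auto)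
  have base: "base \<sigma>3" using v a by (simp add: base_def ag)
  have cut3: "arrs \<sigma>3 ''cut'' v = 0" if "v < n" for v using cut that by (simp add: ag)
  have best3: "vars \<sigma>3 ''best'' = 0" using v by (simp add: ag)
  obtain u4 \<sigma>4 where e4: "exec B k mf tm start_cut \<sigma>3 u4 \<sigma>4" and u4: "u4 \<le> 3 * n + 4 * m + 7"
    and inv: "alive_inv ({..<n} - {s}) \<sigma>4" and flag: "0 < vars \<sigma>4 ''flag''"
    by (rule wpE[OF wp_start_cut[OF base cut3 best3 n]], assumption, elim conjE, rule that, assumption+)
  have "(0 < vars \<sigma>4 ''flag'') = ({..<n} - {s} \<noteq> {})" using flag X by auto
  moreover have "tree_connected X"
    unfolding tree_connected_def
  proof (intro ballI impI)
    fix u v assume uv: "u \<in> X" "v \<in> X" "?par u \<notin> X" "?par v \<notin> X"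
    \<comment> \<open>The last arc of the tree path to a vertex of \<open>X\<close> comes from its
      parent. A parent outside \<open>X\<close> thus gives a tree arc entering \<open>X\<close>, and
      there is only one.\<close>
    have arc: "\<exists>e<m. 0 < tr e \<and> he e = x \<and> ta e = ?par x" if "x \<in> X" for x
    proof -
      have x: "x < n" "x \<noteq> s" using that X(2) by auto
      from reach[OF x(1)] show ?thesis
      proof (cases rule: rtranclE)
        case base
        then show ?thesis using x(2) by simp
      next
        case (step y)
        then obtain e where "e < m" "0 < tr e" "he e = x" by blast
        then show ?thesis using r1 by auto
      qed
    qed
    obtain e where e: "e < m" "0 < tr e" "he e = u" "ta e = ?par u" using arc[OF uv(1)] by blast
    obtain e' where e': "e' < m" "0 < tr e'" "he e' = v" "ta e' = ?par v" using arc[OF uv(2)] by blast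
    show "u = v" using cross[OF e(1) e'(1) e(2) e'(2)] e e' uv by auto
  qed
  ultimately obtain u5 \<sigma>5 where e5: "exec B k mf tm (While (Less (Num 0) (Var ''flag'')) one_round) \<sigma>4 u5 \<sigma>5"
    and u5: "u5 \<le> (60 * (n + m) + 40 + MF m n + 1) * L + 1"
    and rec: "cut_recorded \<sigma>5" and best: "vars \<sigma>5 ''best'' \<le> into X"
    using wpE[OF wp_rounds[OF inv _ X(2,1) _ mf L]] by metis
  \<comment> \<open>Preparation costs no more than one further round, which accounts for the factor
    \<open>L + 1\<close>.\<close>
  have "u1 + (u2 + (u3 + (u4 + u5))) \<le> (60 * (n + m) + 41 + MF m n) * (L + 1)"
  proof -
    have "u1 + (u2 + (u3 + (u4 + u5))) \<le>
        (6 * m + 3) + ((12 * (n + m) + 10) + ((3 * n + 2) + ((3 * n + 4 * m + 7) +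
          ((60 * (n + m) + 40 + MF m n + 1) * L + 1))))"
      by (intro add_mono u1 u2 u3 u4 u5)
    also have "\<dots> \<le> (60 * (n + m) + 41 + MF m n) + (60 * (n + m) + 41 + MF m n) * L"
      by (simp add: algebra_simps)
    finally show ?thesis by (simp add: algebra_simps)
  qed
  moreover have "exec B k mf tm min_cut_program \<sigma> (u1 + (u2 + (u3 + (u4 + u5)))) \<sigma>5"
    unfolding min_cut_program_def
    by (intro exec.Seq[OF e1] exec.Seq[OF e2] exec.Seq[OF e3] exec.Seq[OF e4] e5)
  moreover obtain Y where Y: "Y \<noteq> {}" "Y \<subset> {..<n}" "vars \<sigma>5 ''best'' = into Y"
    "marks (arrs \<sigma>5 ''cut'') ({..<n} - Y)"
    using rec unfolding cut_recorded_def by blast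
  moreover have "\<forall>v<n. arrs \<sigma>5 ''cut'' v = of_bool (v \<notin> Y)"
    using Y(4) by (simp add: marks_def)
  ultimately show ?thesis
    unfolding wp_def using best by metis
qed

end

section \<open>Spanning arborescences\<close>

text \<open>Two arcs with a common head would extend walks from the root to two different walks to
  that head. So unique walks give unique parents, while their existence gives reachability.\<close>

lemma spanning_arborescence_arcs:
  assumes "spanning_arborescence T G s"
  shows "arcs T \<subseteq> arcs G" "tail T = tail G" "head T = head G"
    and "\<And>e e'. e \<in> arcs T \<Longrightarrow> e' \<in> arcs T \<Longrightarrow> head T e = head T e' \<Longrightarrow> e = e'"
    and "\<And>v. v \<in> verts G \<Longrightarrow> (s, v) \<in> {(tail G e, head G e) | e. e \<in> arcs T}\<^sup>*"
proof -
  have T: "spanning T G" "wf_digraph T" "s \<in> verts T"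
    and uniq: "\<And>v. v \<in> verts T \<Longrightarrow> \<exists>!p. pre_digraph.awalk T s p v"
    using assms by (auto simp: spanning_arborescence_def arborescence_def)
  then show sub: "arcs T \<subseteq> arcs G" "tail T = tail G" "head T = head G"
    by (auto simp: spanning_def subgraph_def compatible_def)
  have vT: "verts T = verts G" using T(1) by (simp add: spanning_def)
  interpret wf_digraph T by (rule T(2))
  show "e = e'" if e: "e \<in> arcs T" "e' \<in> arcs T" "head T e = head T e'" for e e'
  proof -
    have "\<exists>p. awalk s p (tail T f)" if "f \<in> arcs T" for f
      using uniq[of "tail T f"] that by auto
    then obtain p p' where p: "awalk s p (tail T e)" "awalk s p' (tail T e')" using e by blast
    have "awalk (tail T f) [f] (head T f)" if "f \<in> arcs T" for f
      using that by (simp add: awalk_simps)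
    then have "awalk s (p @ [e]) (head T e)" "awalk s (p' @ [e']) (head T e')"
      using p e(1,2) by (blast intro: awalk_appendI)+
    moreover have "\<exists>!p. awalk s p (head T e)" using uniq e(1) by simp
    ultimately have "p @ [e] = p' @ [e']" using e(3) by metis
    then show ?thesis by simp
  qed
  show "(s, v) \<in> {(tail G e, head G e) | e. e \<in> arcs T}\<^sup>*" if v: "v \<in> verts G" for v
  proof -
    obtain p where "awalk s p v" using uniq[of v] v vT by auto
    then have "s \<rightarrow>\<^sup>*\<^bsub>T\<^esub> v" by (rule reachable_awalkI)
    then have "(s, v) \<in> (arcs_ends T)\<^sup>*" by (rule reachable_rtranclI)
    moreover have "arcs_ends T = {(tail G e, head G e) | e. e \<in> arcs T}"
      using sub by (auto simp: arcs_ends_conv)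
    ultimately show ?thesis by simp
  qed
qed

text \<open>Passing to the complement turns a source side into a sink side. The arrays need to match
  the graph only on actual arcs.\<close>

lemma cut_weight_eq_cut_into:
  assumes G: "verts G = {..<n}" "arcs G = {..<m}"
    and ta: "\<And>e. e < m \<Longrightarrow> ta e = tail G e \<and> he e = head G e \<and> w' e = w e \<and> tail G e < n" and U: "U \<subseteq> {..<n}"
  shows "cut_weight G w U = cut_into ta he w' m ({..<n} - U)"
proof -
  have "cut_weight G w U = (\<Sum>e<m. if tail G e \<in> U \<and> head G e \<in> verts G - U then w e else 0)"
    unfolding cut_weight_def by (rule sum.mono_neutral_cong_left) (auto simp: G)
  also have "\<dots> = cut_into ta he w' m ({..<n} - U)"
    unfolding cut_into_def by (rule sum.cong) (use ta in \<open>auto simp: G(1)\<close>)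
  finally show ?thesis .
qed

theorem theorem12:
  fixes d :: nat
  shows "\<exists>(P :: com) (k :: nat) (C :: real).
    \<forall>(mf :: network \<Rightarrow> nat \<Rightarrow> nat) (tm :: network \<Rightarrow> nat) (MF :: nat \<Rightarrow> nat \<Rightarrow> nat)
      (G :: (nat, nat) pre_digraph) (n :: nat) (m :: nat) (w :: nat \<Rightarrow> nat)
      (S :: nat set) (T :: (nat, nat) pre_digraph) (s :: nat).
      maxflow_subroutine k mf tm MF \<and>
      digraph G \<and> verts G = {..<n} \<and> arcs G = {..<m} \<and>
      (\<forall>e \<in> arcs G. 0 < w e \<and> w e \<le> n ^ d) \<and>
      global_min_cut G w S \<and>
      spanning_arborescence T G s \<and> s \<in> S \<and>
      card {e \<in> arcs T. tail T e \<in> S \<and> head T e \<in> verts G - S} = 1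
      \<longrightarrow> (\<exists>t \<sigma>. exec (n ^ k) k mf tm P (input_state G w T s) t \<sigma> \<and>
            global_min_cut G w (output_set n \<sigma>) \<and>
            real t \<le> C * ((real (MF m n) + real m) * log 2 (real n)))"
\<comment> \<open>With at most \<open>n * n\<close> arcs of weight at most \<open>n ^ d\<close>, the
  total weight stays below \<open>n ^ (d + 3)\<close>; the third extra factor covers
  \<open>2 * m \<le> n * (n * n)\<close> also for \<open>d = 0\<close>. The constant 700 rounds up
  663, which is 3 times 221.\<close>
proof (rule exI[of _ min_cut_program], rule exI[of _ "d + 3"], rule exI[of _ "700 :: real"],
    intro allI impI, elim conjE)
  fix mf :: "network \<Rightarrow> nat \<Rightarrow> nat" and tm :: "network \<Rightarrow> nat" and MF :: "nat \<Rightarrow> nat \<Rightarrow> nat"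
    and G :: "(nat, nat) pre_digraph" and n m :: nat and w :: "nat \<Rightarrow> nat" and S :: "nat set"
    and T :: "(nat, nat) pre_digraph" and s :: nat
  define k where "k = d + 3"
  assume mf: "maxflow_subroutine (d + 3) mf tm MF" and G: "digraph G"
    and vG: "verts G = {..<n}" and aG: "arcs G = {..<m}"
    and wG: "\<forall>e \<in> arcs G. 0 < w e \<and> w e \<le> n ^ d"
    and S: "global_min_cut G w S" and T: "spanning_arborescence T G s" and sS: "s \<in> S"
    and one: "card {e \<in> arcs T. tail T e \<in> S \<and> head T e \<in> verts G - S} = 1"
  interpret G: digraph G by (rule G)
  interpret ram "n ^ k" k mf tm .
  have SV: "S \<noteq> {}" "S \<subset> {..<n}"
    and Smin: "\<And>U. U \<noteq> {} \<Longrightarrow> U \<subset> {..<n} \<Longrightarrow> cut_weight G w S \<le> cut_weight G w U"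
    using S by (auto simp: global_min_cut_def vG)
  note TA = spanning_arborescence_arcs[OF T]
  have s: "s < n" using sS SV(2) by auto
  obtain x where x: "x < n" "x \<notin> S" using SV(2) by auto
  then have n: "2 \<le> n" using sS s by (cases "n = 1") auto
  define ta he w' tr where
    "ta = (\<lambda>e. if e \<in> arcs G then tail G e else 0)" and
    "he = (\<lambda>e. if e \<in> arcs G then head G e else 0)" and
    "w' = (\<lambda>e. if e \<in> arcs G then w e else 0)" and
    "tr = (\<lambda>e. if e \<in> arcs T then 1 else 0 :: nat)"
  note defs = ta_def he_def w'_def tr_def
  let ?\<sigma> = "input_state G w T s"
  have tree: "0 < tr e \<longleftrightarrow> e \<in> arcs T" for e by (simp add: tr_def)
  have eq: "ta e = tail G e" "he e = head G e" "w' e = w e" if "e < m" for e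
    using that by (simp_all add: defs aG)
  have arcs: "ta e < n \<and> he e < n \<and> ta e \<noteq> he e \<and> 0 < w' e" if "e < m" for e
    using that G.tail_in_verts[of e] G.head_in_verts[of e] G.no_loops[of e] wG by (simp add: eq vG aG)
  have nomulti: "e = e'" if "e < m" "e' < m" "ta e = ta e'" "he e = he e'" for e e'
    using that G.no_multi_arcs[of e e'] by (simp add: eq aG arc_to_ends_def)
  have m_le: "m \<le> n * n"
  proof -
    have "inj_on (\<lambda>e. (ta e, he e)) {..<m}" using nomulti by (auto intro!: inj_onI)
    moreover have "(\<lambda>e. (ta e, he e)) ` {..<m} \<subseteq> {..<n} \<times> {..<n}" using arcs by auto
    ultimately have "card {..<m} \<le> card ({..<n} \<times> {..<n})" by (intro card_inj_on_le) auto
    then show ?thesis by (simp add: card_cartesian_product)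
  qed
  have "(\<Sum>e<m. w' e) \<le> (\<Sum>e<m. n ^ d)"
    by (rule sum_mono) (use wG in \<open>simp add: eq aG\<close>)
  also have "\<dots> \<le> n * n * n ^ d" using m_le by simp
  also have "\<dots> \<le> n ^ k"
    using n by (simp add: k_def power_add numeral_3_eq_3 mult.commute mult.left_commute)
  finally have w_le: "(\<Sum>e<m. w' e) \<le> n ^ k" .
  have "n * (n * n) * 1 \<le> n * (n * n) * n ^ d" using n by (intro mult_le_mono2) simp
  then have n3: "n * (n * n) \<le> n ^ k" by (simp add: k_def power_add numeral_3_eq_3 mult.commute)
  have "2 * m \<le> n * (n * n)" using m_le n by (intro mult_le_mono)
  then have m_B: "2 * m \<le> n ^ k" using n3 by simp
  have n_B: "n \<le> n ^ k"
    by (rule self_le_power) (use n in \<open>auto simp: k_def\<close>)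
  have inj: "e = e'" if "e < m" "e' < m" "0 < tr e" "0 < tr e'" "he e = he e'" for e e'
    using that TA(4)[of e e'] TA(3) by (simp add: tree eq)
  have arcsT: "arcs T \<subseteq> {..<m}" using TA(1) aG by simp
  have "{(tail G e, head G e) | e. e \<in> arcs T} = {(ta e, he e) | e. e < m \<and> 0 < tr e}"
    using arcsT eq tree by (auto; metis lessThan_iff subsetD)
  then have reach: "(s, v) \<in> {(ta e, he e) | e. e < m \<and> 0 < tr e}\<^sup>*" if "v < n" for v
    using TA(5)[of v] that vG by simp
  let ?X = "{..<n} - S"
  have X: "?X \<noteq> {}" "?X \<subseteq> {..<n} - {s}" using x sS by auto
  obtain e0 where e0: "{e \<in> arcs T. tail T e \<in> S \<and> head T e \<in> verts G - S} = {e0}"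
    using one by (auto simp: card_1_singleton_iff)
  have cross1: "e = e0" if "e < m" "0 < tr e" "ta e \<notin> ?X" "he e \<in> ?X" for e
  proof -
    have "e \<in> {e \<in> arcs T. tail T e \<in> S \<and> head T e \<in> verts G - S}"
      using that arcs[of e] TA(2,3) by (simp add: tree eq vG)
    then show ?thesis unfolding e0 by simp
  qed
  have cross: "e = e'" if "e < m" "e' < m" "0 < tr e" "0 < tr e'" "ta e \<notin> ?X" "he e \<in> ?X"
    "ta e' \<notin> ?X" "he e' \<in> ?X" for e e'
    using cross1[of e] cross1[of e'] that by simp
  \<comment> \<open>The integer part of the binary logarithm of \<open>n\<close>. The number of
    rounds is at most \<open>L0 + 1\<close>.\<close>
  obtain L0 where L0: "2 ^ L0 \<le> n" "n < 2 ^ (L0 + 1)"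
    using ex_power_ivl1[of 2 n] n by auto
  have in_v: "vars ?\<sigma> ''n'' = n" "vars ?\<sigma> ''m'' = m" "vars ?\<sigma> ''s'' = s" "vars ?\<sigma> ''best'' = 0"
    and in_a: "arrs ?\<sigma> ''tail'' = ta" "arrs ?\<sigma> ''head'' = he" "arrs ?\<sigma> ''weight'' = w'" "arrs ?\<sigma> ''tree'' = tr"
    and in_c: "\<And>v. v < n \<Longrightarrow> arrs ?\<sigma> ''cut'' v = 0"
    by (simp_all add: input_state_def vG aG defs)
  obtain u \<sigma>' Y where ex: "exec (n ^ k) k mf tm min_cut_program ?\<sigma> u \<sigma>'"
    and u: "u \<le> (60 * (n + m) + 41 + MF m n) * (L0 + 1 + 1)"
    and Y: "Y \<noteq> {}" "Y \<subset> {..<n}" "cut_into ta he w' m Y \<le> cut_into ta he w' m ?X"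
      "\<forall>v<n. arrs \<sigma>' ''cut'' v = of_bool (v \<notin> Y)"
    by (rule wpE[OF wp_min_cut_program[OF in_v in_a in_c arcs nomulti s n n_B m_B w_le w_le inj reach X cross
          mf[folded k_def] L0(2)]], assumption+, elim conjE exE, rule that, assumption+)
  have cw: "cut_weight G w U = cut_into ta he w' m ({..<n} - U)" if "U \<subseteq> {..<n}" for U
    by (rule cut_weight_eq_cut_into[OF vG aG _ that]) (use eq arcs in force)
  have out: "output_set n \<sigma>' = {..<n} - Y"
    using Y(4) by (auto simp: output_set_def)
  have YY: "{..<n} - ({..<n} - Y) = Y" using Y(2) by auto
  have sub: "{..<n} - Y \<subset> {..<n}" "{..<n} - Y \<noteq> {}" using Y(1,2) by auto
  \<comment> \<open>The recorded cut is at most as heavy as the fixed minimum cut, so it is a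
    minimum cut itself.\<close>
  have "cut_weight G w ({..<n} - Y) \<le> cut_weight G w S"
    using Y(3) cw[of "{..<n} - Y"] cw[of S] SV(2) by (simp add: YY psubset_imp_subset)
  then have min: "global_min_cut G w (output_set n \<sigma>')"
    using sub Smin unfolding global_min_cut_def out vG by (meson le_trans)
  \<comment> \<open>Each vertex other than \<open>s\<close> is the head of a tree arc. This absorbs
    the terms in \<open>n\<close> into the claimed bound, which mentions only
    \<open>m\<close>.\<close>
  have nm: "n \<le> m + 1"
  proof -
    have "{..<n} \<subseteq> insert s (he ` {..<m})"
    proof
      fix v assume "v \<in> {..<n}"
      then have "(s, v) \<in> {(ta e, he e) | e. e < m \<and> 0 < tr e}\<^sup>*" using reach by simp
      then show "v \<in> insert s (he ` {..<m})" by (cases rule: rtranclE) auto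
    qed
    then have "card {..<n} \<le> card (insert s (he ` {..<m}))" by (intro card_mono) auto
    also have "\<dots> \<le> Suc (card (he ` {..<m}))" by (simp add: card_insert_le_m1)
    also have "\<dots> \<le> Suc m" using card_image_le[of "{..<m}" he] by simp
    finally show ?thesis by simp
  qed
  have "real u \<le> 700 * ((real (MF m n) + real m) * log 2 (real n))"
  proof -
    have "60 * (n + m) \<le> 60 * (m + 1 + m)" using nm by (intro mult_le_mono2) simp
    moreover have "1 \<le> m" using nm n by simp
    \<comment> \<open>The left side is at most \<open>120 * m + 101 + MF m n\<close>, and the
      constant 101 is charged to \<open>m\<close>, which is positive.\<close>
    ultimately have "60 * (n + m) + 41 + MF m n \<le> 221 * m + MF m n" by simp
    then have "u \<le> (221 * m + MF m n) * (L0 + 2)"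
      using u mult_le_mono1[of _ _ "L0 + 2"] by (metis add.assoc le_trans one_add_one)
    then have "real u \<le> real (221 * m + MF m n) * real (L0 + 2)"
      by (metis of_nat_le_iff of_nat_mult)
    also have "\<dots> \<le> (221 * (real (MF m n) + real m)) * (3 * log 2 (real n))"
    proof (rule mult_mono)
      have "real L0 \<le> log 2 (real n)"
        using L0(1) n by (simp add: le_log_iff powr_realpow)
      \<comment> \<open>As \<open>n\<close> is at least 2, the two additional units are charged to
        the logarithm, giving the factor 3.\<close>
      moreover have "1 \<le> log 2 (real n)" using n by (simp add: le_log_iff)
      ultimately show "real (L0 + 2) \<le> 3 * log 2 (real n)" by simp
    qed auto
    also have "\<dots> = 663 * ((real (MF m n) + real m) * log 2 (real n))" by simp
    also have "\<dots> \<le> 700 * ((real (MF m n) + real m) * log 2 (real n))"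
      using n by (intro mult_right_mono mult_nonneg_nonneg) auto
    finally show ?thesis .
  qed
  with ex min show "\<exists>t \<sigma>. exec (n ^ (d + 3)) (d + 3) mf tm min_cut_program (input_state G w T s) t \<sigma> \<and>
      global_min_cut G w (output_set n \<sigma>) \<and>
      real t \<le> 700 * ((real (MF m n) + real m) * log 2 (real n))"
    unfolding k_def by blast
qed

end
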